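(* Let $k$ be an algebraically closed field of characteristic zero. For every $k$-vector space $V$ define the $k$-linear map $D_V : {!}V \otimes V \longrightarrow {!}V$ by \[ D_V\big( |\nu_1,\ldots,\nu_s\rangle_P \otimes \nu \big) = |\nu,\nu_1,\ldots,\nu_s\rangle_P \qquad (s \ge 0,\ P,\nu,\nu_1,\ldots,\nu_s \in V). \] Then the family $(D_V)_V$ is a deriving transformation for $(\mathcal{V}, {!}, \delta, d, \Delta, w)$, where $\mathcal{V}$ is the category of $k$-vector spaces. That is, $D_V$ is natural in $V$ (i.e. $D_W \circ ({!}\varphi \otimes \varphi) = {!}\varphi \circ D_V$ for every linear map $\varphi: V \to W$), and for every $V$ the following hold: (D.1) $w \circ D_V = 0$; (D.2) $\Delta \circ D_V = (1 \otimes D_V)\circ(\Delta \otimes 1) + (D_V \otimes 1)\circ(1 \otimes \sigma_{{!}V,V})\circ(\Delta \otimes 1)$ as maps ${!}V\otimes V \to {!}V \otimes {!}V$; (D.3) $d \circ D_V = a \circ (w \otimes 1)$, where $a: k \otimes V \to V$, $a(\lambda \otimes x) = \lambda x$; (D.4) $\delta \circ D_V = D_{{!}V} \circ (\delta \otimes D_V) \circ (\Delta \otimes 1)$ as maps ${!}V \otimes V \to {!}{!}V$.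
   Context: $k$ is an algebraically closed field of characteristic zero. For a $k$-vector space $V$, ${!}V$ denotes the cofree (universal) cocommutative counital coalgebra mapping to $V$; explicitly ${!}V = \bigoplus_{P \in V} \mathrm{Sym}_P(V)$, where each $\mathrm{Sym}_P(V)$ is a copy of the symmetric algebra $\mathrm{Sym}(V)$. For $P,\nu_1,\ldots,\nu_s \in V$, $|\nu_1,\ldots,\nu_s\rangle_P$ denotes the image of $\nu_1\otimes\cdots\otimes\nu_s$ in $\mathrm{Sym}_P(V)$ (so it is multilinear and symmetric in the $\nu_i$), and $|\emptyset\rangle_P$ denotes $1 \in \mathrm{Sym}_P(V)$. For $C=\{i_1,\ldots,i_t\}\subseteq\{1,\ldots,s\}$ write $|\nu_C\rangle_P = |\nu_{i_1},\ldots,\nu_{i_t}\rangle_P$. The structure maps are: coproduct $\Delta|\nu_1,\ldots,\nu_s\rangle_P = \sum_{I \subseteq \{1,\ldots,s\}} |\nu_I\rangle_P \otimes |\nu_{I^c}\rangle_P$; counit $w|\nu_1,\ldots,\nu_s\rangle_P = 1$ if $s=0$ and $0$ if $s>0$; dereliction (universal map) $d: {!}V \to V$, $d|\emptyset\rangle_P = P$, $d|\nu\rangle_P = \nu$, and $d|\nu_1,\ldots,\nu_s\rangle_P = 0$ for $s \ge 2$; for a linear map $\varphi: V\to W$, ${!}\varphi |\nu_1,\ldots,\nu_s\rangle_P = |\varphi\nu_1,\ldots,\varphi\nu_s\rangle_{\varphi(P)}$; promotion $\delta: {!}V \to {!}{!}V$, $\delta|\nu_1,\ldots,\nu_s\rangle_P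 = \sum_{\{C_1,\ldots,C_l\}} \big|\, |\nu_{C_1}\rangle_P, \ldots, |\nu_{C_l}\rangle_P \big\rangle_Q$, the sum over all partitions of $\{1,\ldots,s\}$ into nonempty blocks, with $Q = |\emptyset\rangle_P \in {!}V$ (in particular $\delta|\emptyset\rangle_P = |\emptyset\rangle_Q$). $\sigma_{X,Y}: X\otimes Y \to Y \otimes X$ is the swap $x\otimes y \mapsto y \otimes x$. *)

theory Defs
  imports "HOL-Algebra.Algebra" "HOL-Library.Disjoint_Sets"
begin

text \<open>
  Vector spaces over a field \<open>k\<close> are HOL-Algebra modules over \<open>k\<close>. Only their additive and scalar
  structure matters; the ring components \<open>mult\<close> and \<open>one\<close> of the record are left unspecified
  in the constructions below. A linear map is represented by its extensional representative
  (value \<open>undefined\<close> outside the carrier), so that a map prescribed on a spanning set is unique.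
\<close>

definition linear_maps :: "'k ring \<Rightarrow> ('k, 'v) module \<Rightarrow> ('k, 'w) module \<Rightarrow> ('v \<Rightarrow> 'w) set" where
  "linear_maps k V W = {f \<in> carrier V \<rightarrow>\<^sub>E carrier W.
     (\<forall>x\<in>carrier V. \<forall>y\<in>carrier V. f (x \<oplus>\<^bsub>V\<^esub> y) = f x \<oplus>\<^bsub>W\<^esub> f y) \<and>
     (\<forall>c\<in>carrier k. \<forall>x\<in>carrier V. f (c \<odot>\<^bsub>V\<^esub> x) = c \<odot>\<^bsub>W\<^esub> f x)}"

definition id_map :: "('k, 'v) module \<Rightarrow> 'v \<Rightarrow> 'v" where
  "id_map V = (\<lambda>x\<in>carrier V. x)"

definition scalars :: "'k ring \<Rightarrow> ('k, 'k) module" where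
  "scalars k = \<lparr>carrier = carrier k, monoid.mult = monoid.mult k, one = \<one>\<^bsub>k\<^esub>,
     ring.zero = \<zero>\<^bsub>k\<^esub>, ring.add = ring.add k,
     smult = monoid.mult k\<rparr>"

text \<open>The direct sum of copies of \<open>M\<close> indexed by the set \<open>I\<close>, as finitely supported functions.\<close>

definition copies :: "'i set \<Rightarrow> ('k, 'v) module \<Rightarrow> ('k, 'i \<Rightarrow> 'v) module" where
  "copies I M =
     \<lparr>carrier = {f. f ` I \<subseteq> carrier M \<and> (\<forall>i. i \<notin> I \<longrightarrow> f i = \<zero>\<^bsub>M\<^esub>) \<and> finite {i. f i \<noteq> \<zero>\<^bsub>M\<^esub>}},
      monoid.mult = undefined, one = undefined,
      ring.zero = (\<lambda>i. \<zero>\<^bsub>M\<^esub>), ring.add = (\<lambda>f g i. f i \<oplus>\<^bsub>M\<^esub> g i),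
      smult = (\<lambda>c f i. c \<odot>\<^bsub>M\<^esub> f i)\<rparr>"

definition summand_incl :: "('k, 'v) module \<Rightarrow> 'i \<Rightarrow> 'v \<Rightarrow> 'i \<Rightarrow> 'v" where
  "summand_incl M i x = (\<lambda>j. if j = i then x else \<zero>\<^bsub>M\<^esub>)"

definition free_module :: "'k ring \<Rightarrow> 'x set \<Rightarrow> ('k, 'x \<Rightarrow> 'k) module" where
  "free_module k I = copies I (scalars k)"

definition basis_vec :: "'k ring \<Rightarrow> 'x \<Rightarrow> 'x \<Rightarrow> 'k" where
  "basis_vec k x = summand_incl (scalars k) x \<one>\<^bsub>k\<^esub>"

definition submodule_span :: "'k ring \<Rightarrow> ('k, 'v) module \<Rightarrow> 'v set \<Rightarrow> 'v set" where
  "submodule_span k M S = \<Inter>{H. submodule H k M \<and> S \<subseteq> H}"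

definition quotient_module :: "('k, 'v) module \<Rightarrow> 'v set \<Rightarrow> ('k, 'v set) module" where
  "quotient_module M H =
     \<lparr>carrier = a_rcosets\<^bsub>M\<^esub> H, monoid.mult = undefined, one = undefined,
      ring.zero = H, ring.add = set_add M, smult = (\<lambda>c A. \<Union>x\<in>A. H +>\<^bsub>M\<^esub> (c \<odot>\<^bsub>M\<^esub> x))\<rparr>"

text \<open>Tensor products: the free module on pairs modulo bilinearity.\<close>

definition tensor_rel :: "'k ring \<Rightarrow> ('k, 'v) module \<Rightarrow> ('k, 'w) module \<Rightarrow> ('v \<times> 'w \<Rightarrow> 'k) set" where
  "tensor_rel k V W =
     (let F = free_module k (carrier V \<times> carrier W); e = basis_vec k in submodule_span k F
       ({e (v \<oplus>\<^bsub>V\<^esub> v', w) \<ominus>\<^bsub>F\<^esub> (e (v, w) \<oplus>\<^bsub>F\<^esub> e (v', w)) | v v' w.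
           v \<in> carrier V \<and> v' \<in> carrier V \<and> w \<in> carrier W} \<union>
        {e (v, w \<oplus>\<^bsub>W\<^esub> w') \<ominus>\<^bsub>F\<^esub> (e (v, w) \<oplus>\<^bsub>F\<^esub> e (v, w')) | v w w'.
           v \<in> carrier V \<and> w \<in> carrier W \<and> w' \<in> carrier W} \<union>
        {e (c \<odot>\<^bsub>V\<^esub> v, w) \<ominus>\<^bsub>F\<^esub> (c \<odot>\<^bsub>F\<^esub> e (v, w)) | c v w.
           c \<in> carrier k \<and> v \<in> carrier V \<and> w \<in> carrier W} \<union>
        {e (v, c \<odot>\<^bsub>W\<^esub> w) \<ominus>\<^bsub>F\<^esub> (c \<odot>\<^bsub>F\<^esub> e (v, w)) | c v w.
           c \<in> carrier k \<and> v \<in> carrier V \<and> w \<in> carrier W}))"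

definition tensor ::
  "'k ring \<Rightarrow> ('k, 'v) module \<Rightarrow> ('k, 'w) module \<Rightarrow> ('k, ('v \<times> 'w \<Rightarrow> 'k) set) module" where
  "tensor k V W = quotient_module (free_module k (carrier V \<times> carrier W)) (tensor_rel k V W)"

definition pure_tensor ::
  "'k ring \<Rightarrow> ('k, 'v) module \<Rightarrow> ('k, 'w) module \<Rightarrow> 'v \<Rightarrow> 'w \<Rightarrow> ('v \<times> 'w \<Rightarrow> 'k) set" where
  "pure_tensor k V W v w =
     tensor_rel k V W +>\<^bsub>free_module k (carrier V \<times> carrier W)\<^esub> basis_vec k (v, w)"

text \<open>The linear map on \<open>V \<otimes> W\<close> induced by a bilinear map \<open>b\<close>.\<close>

definition tensor_lift ::
  "'k ring \<Rightarrow> ('k, 'v) module \<Rightarrow> ('k, 'w) module \<Rightarrow> ('k, 'x) module \<Rightarrow> ('v \<Rightarrow> 'w \<Rightarrow> 'x) \<Rightarrow>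
   ('v \<times> 'w \<Rightarrow> 'k) set \<Rightarrow> 'x" where
  "tensor_lift k V W U b = (THE f. f \<in> linear_maps k (tensor k V W) U \<and>
     (\<forall>v\<in>carrier V. \<forall>w\<in>carrier W. f (pure_tensor k V W v w) = b v w))"

definition tensor_map ::
  "'k ring \<Rightarrow> ('k, 'v) module \<Rightarrow> ('k, 'w) module \<Rightarrow> ('k, 'v') module \<Rightarrow> ('k, 'w') module \<Rightarrow>
   ('v \<Rightarrow> 'v') \<Rightarrow> ('w \<Rightarrow> 'w') \<Rightarrow> ('v \<times> 'w \<Rightarrow> 'k) set \<Rightarrow> ('v' \<times> 'w' \<Rightarrow> 'k) set" where
  "tensor_map k V W V' W' f g =
     tensor_lift k V W (tensor k V' W') (\<lambda>v w. pure_tensor k V' W' (f v) (g w))"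

definition tensor_swap ::
  "'k ring \<Rightarrow> ('k, 'v) module \<Rightarrow> ('k, 'w) module \<Rightarrow> ('v \<times> 'w \<Rightarrow> 'k) set \<Rightarrow> ('w \<times> 'v \<Rightarrow> 'k) set" where
  "tensor_swap k V W = tensor_lift k V W (tensor k W V) (\<lambda>v w. pure_tensor k W V w v)"

text \<open>The canonical isomorphisms \<open>(U \<otimes> V) \<otimes> W \<rightarrow> U \<otimes> (V \<otimes> W)\<close> and
  \<open>U \<otimes> (V \<otimes> W) \<rightarrow> (U \<otimes> V) \<otimes> W\<close>.\<close>

definition tensor_assoc ::
  "'k ring \<Rightarrow> ('k, 'u) module \<Rightarrow> ('k, 'v) module \<Rightarrow> ('k, 'w) module \<Rightarrow>
   (('u \<times> 'v \<Rightarrow> 'k) set \<times> 'w \<Rightarrow> 'k) set \<Rightarrow> ('u \<times> ('v \<times> 'w \<Rightarrow> 'k) set \<Rightarrow> 'k) set" where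
  "tensor_assoc k U V W = tensor_lift k (tensor k U V) W (tensor k U (tensor k V W))
     (\<lambda>t w. tensor_lift k U V (tensor k U (tensor k V W))
        (\<lambda>u v. pure_tensor k U (tensor k V W) u (pure_tensor k V W v w)) t)"

definition tensor_assoc_inv ::
  "'k ring \<Rightarrow> ('k, 'u) module \<Rightarrow> ('k, 'v) module \<Rightarrow> ('k, 'w) module \<Rightarrow>
   ('u \<times> ('v \<times> 'w \<Rightarrow> 'k) set \<Rightarrow> 'k) set \<Rightarrow> (('u \<times> 'v \<Rightarrow> 'k) set \<times> 'w \<Rightarrow> 'k) set" where
  "tensor_assoc_inv k U V W = tensor_lift k U (tensor k V W) (tensor k (tensor k U V) W)
     (\<lambda>u t. tensor_lift k V W (tensor k (tensor k U V) W)
        (\<lambda>v w. pure_tensor k (tensor k U V) W (pure_tensor k U V u v) w) t)"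

definition scalar_action :: "'k ring \<Rightarrow> ('k, 'v) module \<Rightarrow> ('k \<times> 'v \<Rightarrow> 'k) set \<Rightarrow> 'v" where
  "scalar_action k V = tensor_lift k (scalars k) V V (\<lambda>c x. c \<odot>\<^bsub>V\<^esub> x)"

text \<open>
  The underlying vector space of \<open>Sym(V) = T(V) / (v \<otimes> w - w \<otimes> v)\<close>. A word \<open>[\<nu>\<^sub>1, \<dots>, \<nu>\<^sub>s]\<close>
  stands for \<open>\<nu>\<^sub>1 \<otimes> \<dots> \<otimes> \<nu>\<^sub>s\<close>: the tensor algebra \<open>T(V)\<close> is the free module on all words modulo
  multilinearity (first two families), and the third family spans the ideal of commutators.
\<close>

definition sym_rel :: "'k ring \<Rightarrow> ('k, 'v) module \<Rightarrow> ('v list \<Rightarrow> 'k) set" where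
  "sym_rel k V =
     (let F = free_module k (lists (carrier V)); e = basis_vec k in submodule_span k F
       ({e (xs @ [v \<oplus>\<^bsub>V\<^esub> w] @ ys) \<ominus>\<^bsub>F\<^esub> (e (xs @ [v] @ ys) \<oplus>\<^bsub>F\<^esub> e (xs @ [w] @ ys)) | xs ys v w.
           xs \<in> lists (carrier V) \<and> ys \<in> lists (carrier V) \<and> v \<in> carrier V \<and> w \<in> carrier V} \<union>
        {e (xs @ [c \<odot>\<^bsub>V\<^esub> v] @ ys) \<ominus>\<^bsub>F\<^esub> (c \<odot>\<^bsub>F\<^esub> e (xs @ [v] @ ys)) | xs ys c v.
           xs \<in> lists (carrier V) \<and> ys \<in> lists (carrier V) \<and> c \<in> carrier k \<and> v \<in> carrier V} \<union>
        {e (xs @ [v, w] @ ys) \<ominus>\<^bsub>F\<^esub> e (xs @ [w, v] @ ys) | xs ys v w.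
           xs \<in> lists (carrier V) \<and> ys \<in> lists (carrier V) \<and> v \<in> carrier V \<and> w \<in> carrier V}))"

definition Sym :: "'k ring \<Rightarrow> ('k, 'v) module \<Rightarrow> ('k, ('v list \<Rightarrow> 'k) set) module" where
  "Sym k V = quotient_module (free_module k (lists (carrier V))) (sym_rel k V)"

definition sym_word :: "'k ring \<Rightarrow> ('k, 'v) module \<Rightarrow> 'v list \<Rightarrow> ('v list \<Rightarrow> 'k) set" where
  "sym_word k V \<nu>s = sym_rel k V +>\<^bsub>free_module k (lists (carrier V))\<^esub> basis_vec k \<nu>s"

text \<open>\<open>!V = \<Oplus>\<^sub>P Sym\<^sub>P(V)\<close>, with \<open>ket k V P [\<nu>\<^sub>1, \<dots>, \<nu>\<^sub>s] = |\<nu>\<^sub>1, \<dots>, \<nu>\<^sub>s\<rangle>\<^sub>P\<close>.\<close>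

type_synonym ('k, 'v) bang_elem = "'v \<Rightarrow> ('v list \<Rightarrow> 'k) set"

definition bang :: "'k ring \<Rightarrow> ('k, 'v) module \<Rightarrow> ('k, ('k, 'v) bang_elem) module" where
  "bang k V = copies (carrier V) (Sym k V)"

definition ket :: "'k ring \<Rightarrow> ('k, 'v) module \<Rightarrow> 'v \<Rightarrow> 'v list \<Rightarrow> ('k, 'v) bang_elem" where
  "ket k V P \<nu>s = summand_incl (Sym k V) P (sym_word k V \<nu>s)"

text \<open>The linear map on \<open>!V\<close> with value \<open>g P \<nu>s\<close> at \<open>ket k V P \<nu>s\<close>; it exists whenever \<open>g P\<close> is
  multilinear and symmetric for each \<open>P\<close>.\<close>

definition bang_lift ::
  "'k ring \<Rightarrow> ('k, 'v) module \<Rightarrow> ('k, 'x) module \<Rightarrow> ('v \<Rightarrow> 'v list \<Rightarrow> 'x) \<Rightarrow>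
   ('k, 'v) bang_elem \<Rightarrow> 'x" where
  "bang_lift k V U g = (THE f. f \<in> linear_maps k (bang k V) U \<and>
     (\<forall>P\<in>carrier V. \<forall>\<nu>s\<in>lists (carrier V). f (ket k V P \<nu>s) = g P \<nu>s))"

text \<open>Subsets \<open>C\<close> of the index set are subsets of \<open>{..<s}\<close>, and \<open>nths \<nu>s C\<close> is the list \<open>\<nu>\<^sub>C\<close>.\<close>

definition coproduct ::
  "'k ring \<Rightarrow> ('k, 'v) module \<Rightarrow> ('k, 'v) bang_elem \<Rightarrow>
   (('k, 'v) bang_elem \<times> ('k, 'v) bang_elem \<Rightarrow> 'k) set" where
  "coproduct k V = bang_lift k V (tensor k (bang k V) (bang k V))
     (\<lambda>P \<nu>s. \<Oplus>\<^bsub>tensor k (bang k V) (bang k V)\<^esub>I\<in>Pow {..<length \<nu>s}.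
        pure_tensor k (bang k V) (bang k V)
          (ket k V P (nths \<nu>s I)) (ket k V P (nths \<nu>s ({..<length \<nu>s} - I))))"

definition counit :: "'k ring \<Rightarrow> ('k, 'v) module \<Rightarrow> ('k, 'v) bang_elem \<Rightarrow> 'k" where
  "counit k V = bang_lift k V (scalars k) (\<lambda>P \<nu>s. if \<nu>s = [] then \<one>\<^bsub>k\<^esub> else \<zero>\<^bsub>k\<^esub>)"

definition dereliction :: "'k ring \<Rightarrow> ('k, 'v) module \<Rightarrow> ('k, 'v) bang_elem \<Rightarrow> 'v" where
  "dereliction k V =
     bang_lift k V V (\<lambda>P \<nu>s. case \<nu>s of [] \<Rightarrow> P | [\<nu>] \<Rightarrow> \<nu> | _ \<Rightarrow> \<zero>\<^bsub>V\<^esub>)"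

definition bang_map ::
  "'k ring \<Rightarrow> ('k, 'v) module \<Rightarrow> ('k, 'w) module \<Rightarrow> ('v \<Rightarrow> 'w) \<Rightarrow>
   ('k, 'v) bang_elem \<Rightarrow> ('k, 'w) bang_elem" where
  "bang_map k V W \<phi> = bang_lift k V (bang k W) (\<lambda>P \<nu>s. ket k W (\<phi> P) (map \<phi> \<nu>s))"

text \<open>The blocks of a finite set partition, in some order. The order is irrelevant below, since kets
  are symmetric.\<close>

definition blocks :: "nat set set \<Rightarrow> nat set list" where
  "blocks \<C> = (SOME Cs. distinct Cs \<and> set Cs = \<C>)"

definition promotion ::
  "'k ring \<Rightarrow> ('k, 'v) module \<Rightarrow> ('k, 'v) bang_elem \<Rightarrow> ('k, ('k, 'v) bang_elem) bang_elem" where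
  "promotion k V = bang_lift k V (bang k (bang k V))
     (\<lambda>P \<nu>s. \<Oplus>\<^bsub>bang k (bang k V)\<^esub>\<C>\<in>{\<C>. partition_on {..<length \<nu>s} \<C>}.
        ket k (bang k V) (ket k V P []) (map (\<lambda>C. ket k V P (nths \<nu>s C)) (blocks \<C>)))"

definition deriv_map ::
  "'k ring \<Rightarrow> ('k, 'v) module \<Rightarrow> (('k, 'v) bang_elem \<times> 'v \<Rightarrow> 'k) set \<Rightarrow> ('k, 'v) bang_elem" where
  "deriv_map k V = (THE f. f \<in> linear_maps k (tensor k (bang k V) V) (bang k V) \<and>
     (\<forall>P\<in>carrier V. \<forall>\<nu>s\<in>lists (carrier V). \<forall>\<nu>\<in>carrier V.
        f (pure_tensor k (bang k V) V (ket k V P \<nu>s) \<nu>) = ket k V P (\<nu> # \<nu>s)))"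


section \<open>Universal properties\<close>

text \<open>The definite descriptions \<^const>\<open>tensor_lift\<close> and \<^const>\<open>bang_lift\<close> denote the intended maps: see the
  lemmas \<open>tensor_lift\<close> and \<open>bang_lift\<close> at the end.\<close>

lemma linear_mapsI: 
  assumes "\<And>x. x \<in> carrier V \<Longrightarrow> f x \<in> carrier W" "\<And>x. x \<notin> carrier V \<Longrightarrow> f x = undefined"
   "\<And>x y. x \<in> carrier V \<Longrightarrow> y \<in> carrier V \<Longrightarrow> f (x \<oplus>\<^bsub>V\<^esub> y) = f x \<oplus>\<^bsub>W\<^esub> f y"
   "\<And>c x. c \<in> carrier k \<Longrightarrow> x \<in> carrier V \<Longrightarrow> f (c \<odot>\<^bsub>V\<^esub> x) = c \<odot>\<^bsub>W\<^esub> f x"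
  shows "f \<in> linear_maps k V W"
  using assms unfolding linear_maps_def by (auto intro!: PiE_I)

lemma linear_mapsD:
  assumes "f \<in> linear_maps k V W"
  shows "x \<in> carrier V \<Longrightarrow> f x \<in> carrier W" "x \<notin> carrier V \<Longrightarrow> f x = undefined"
   "x \<in> carrier V \<Longrightarrow> y \<in> carrier V \<Longrightarrow> f (x \<oplus>\<^bsub>V\<^esub> y) = f x \<oplus>\<^bsub>W\<^esub> f y"
   "c \<in> carrier k \<Longrightarrow> x \<in> carrier V \<Longrightarrow> f (c \<odot>\<^bsub>V\<^esub> x) = c \<odot>\<^bsub>W\<^esub> f x"
  using assms unfolding linear_maps_def by (auto dest: PiE_mem PiE_arb)

lemma module_scalars: assumes "cring k" shows "module k (scalars k)"
proof -
  interpret cring k by fact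
  show ?thesis
  proof (rule moduleI)
    show "cring k" by fact
    show "abelian_group (scalars k)"
    proof (rule abelian_groupI)
      fix x assume "x \<in> carrier (scalars k)"
      then show "\<exists>y\<in>carrier (scalars k). y \<oplus>\<^bsub>scalars k\<^esub> x = \<zero>\<^bsub>scalars k\<^esub>"
        by (intro bexI[of _ "\<ominus>\<^bsub>k\<^esub> x"]) (auto simp: scalars_def l_neg)
    qed (auto simp: scalars_def a_assoc a_comm a_lcomm)
  qed (auto simp: scalars_def l_distr r_distr m_assoc)
qed

lemma module_copies: assumes "module k M" shows "module k (copies I M)"
proof -
  interpret module k M by fact
  have fin: "finite {i. f i \<oplus>\<^bsub>M\<^esub> g i \<noteq> \<zero>\<^bsub>M\<^esub>}" if "finite {i. f i \<noteq> \<zero>\<^bsub>M\<^esub>}" "finite {i. g i \<noteq> \<zero>\<^bsub>M\<^esub>}" for f g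
    by (rule finite_subset[of _ "{i. f i \<noteq> \<zero>\<^bsub>M\<^esub>} \<union> {i. g i \<noteq> \<zero>\<^bsub>M\<^esub>}"]) (use that in auto)
  have mem: "f i \<in> carrier M" if "f \<in> carrier (copies I M)" for f i
    using that by (cases "i \<in> I") (auto simp: copies_def)
  have car: "f \<in> carrier (copies I M)" if "\<And>i. f i \<in> carrier M" "\<And>i. i \<notin> I \<Longrightarrow> f i = \<zero>\<^bsub>M\<^esub>" "finite {i. f i \<noteq> \<zero>\<^bsub>M\<^esub>}" for f
    using that by (auto simp: copies_def)
  have carD: "i \<notin> I \<Longrightarrow> f i = \<zero>\<^bsub>M\<^esub>" "finite {i. f i \<noteq> \<zero>\<^bsub>M\<^esub>}" if "f \<in> carrier (copies I M)" for f i
    using that by (auto simp: copies_def)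
  have sm: "module.smult (copies I M) c f = (\<lambda>i. c \<odot>\<^bsub>M\<^esub> f i)" for c f by (simp add: copies_def)
  have ad: "ring.add (copies I M) f g = (\<lambda>i. f i \<oplus>\<^bsub>M\<^esub> g i)" for f g by (simp add: copies_def)
  have ze: "ring.zero (copies I M) = (\<lambda>i. \<zero>\<^bsub>M\<^esub>)" by (simp add: copies_def)
  note S = sm ad ze
  show ?thesis
  proof (rule moduleI)
    show "cring k" by (rule R.is_cring)
    show "abelian_group (copies I M)"
    proof (rule abelian_groupI)
      fix x assume x: "x \<in> carrier (copies I M)"
      show "\<exists>y\<in>carrier (copies I M). y \<oplus>\<^bsub>copies I M\<^esub> x = \<zero>\<^bsub>copies I M\<^esub>"
      proof (rule bexI[of _ "\<lambda>i. \<ominus>\<^bsub>M\<^esub> x i"])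
        show "(\<lambda>i. \<ominus>\<^bsub>M\<^esub> x i) \<in> carrier (copies I M)"
          apply (rule car) using mem[OF x] carD[OF x] 
            apply (auto)
          done
        show "(\<lambda>i. \<ominus>\<^bsub>M\<^esub> x i) \<oplus>\<^bsub>copies I M\<^esub> x = \<zero>\<^bsub>copies I M\<^esub>"
          using mem[OF x] by (simp add: S M.l_neg)
      qed
    qed (auto simp: S mem carD M.a_assoc M.a_comm M.add.m_lcomm intro!: car intro: fin[OF carD(2) carD(2)])
    show "c \<odot>\<^bsub>copies I M\<^esub> x \<in> carrier (copies I M)" if "c \<in> carrier k" "x \<in> carrier (copies I M)" for c x
      unfolding S
    proof (rule car)
      show "finite {i. c \<odot>\<^bsub>M\<^esub> x i \<noteq> \<zero>\<^bsub>M\<^esub>}"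
        by (rule finite_subset[OF _ carD(2)[OF that(2)]]) (use that in auto)
    qed (use that mem carD(1)[OF that(2)] in auto)
  qed (auto simp: S mem smult_l_distr smult_r_distr smult_assoc1)
qed

lemma submodule_spanI: assumes "module k M" "S \<subseteq> carrier M" shows "submodule (submodule_span k M S) k M" "S \<subseteq> submodule_span k M S"
proof -
  interpret module k M by fact
  have "carrier M \<in> {H. submodule H k M \<and> S \<subseteq> H}"
    using carrier_is_submodule assms by auto
  then show "submodule (submodule_span k M S) k M"
  proof (intro submoduleI)
    let ?C = "{H. submodule H k M \<and> S \<subseteq> H}"
    assume C: "carrier M \<in> ?C"
    show "submodule_span k M S \<subseteq> carrier M" unfolding submodule_span_def by (rule Inter_lower[OF C])
    have z: "\<zero>\<^bsub>M\<^esub> \<in> H" if "submodule H k M" for H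
      using subgroup.one_closed[OF submodule.axioms(1)[OF that]] by simp
    show "\<zero>\<^bsub>M\<^esub> \<in> submodule_span k M S" unfolding submodule_span_def using z by blast
    show "\<ominus>\<^bsub>M\<^esub> a \<in> submodule_span k M S" if "a \<in> submodule_span k M S" for a
      using that submoduleE(3) unfolding submodule_span_def by blast
    show "a \<oplus>\<^bsub>M\<^esub> b \<in> submodule_span k M S" if "a \<in> submodule_span k M S" "b \<in> submodule_span k M S" for a b
      using that submoduleE(5) unfolding submodule_span_def by blast
    show "c \<odot>\<^bsub>M\<^esub> b \<in> submodule_span k M S" if "c \<in> carrier k" "b \<in> submodule_span k M S" for c b
      using that submoduleE(4) unfolding submodule_span_def by blast
  qed
qed (auto simp: submodule_span_def)

context
  fixes k :: "'k ring" and M :: "('k,'v) module" and H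
  assumes M: "module k M" and H: "submodule H k M"
begin

interpretation module k M by (rule M)
interpretation ah: abelian_subgroup H M
  using H submodule.axioms(1) 
  by (metis a_comm_group additive_subgroup.intro abelian_subgroupI3 abelian_group_axioms)

lemma coset_carrier: "x \<in> carrier M \<Longrightarrow> H +>\<^bsub>M\<^esub> x \<in> carrier (quotient_module M H)"
  by (auto simp: quotient_module_def A_RCOSETS_def' )
lemma coset_carE: "A \<in> carrier (quotient_module M H) \<Longrightarrow> \<exists>x\<in>carrier M. A = H +>\<^bsub>M\<^esub> x"
  by (auto simp: quotient_module_def A_RCOSETS_def' )
lemma coset_add: "x \<in> carrier M \<Longrightarrow> y \<in> carrier M \<Longrightarrow> 
  (H +>\<^bsub>M\<^esub> x) \<oplus>\<^bsub>quotient_module M H\<^esub> (H +>\<^bsub>M\<^esub> y) = H +>\<^bsub>M\<^esub> (x \<oplus>\<^bsub>M\<^esub> y)"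
  by (simp add: quotient_module_def ah.a_rcos_sum)
lemma coset_eq: "x \<in> carrier M \<Longrightarrow> y \<in> carrier M \<Longrightarrow> (H +>\<^bsub>M\<^esub> x = H +>\<^bsub>M\<^esub> y) \<longleftrightarrow> x \<ominus>\<^bsub>M\<^esub> y \<in> H"
  using ah.a_rcos_module[of y x] a_repr_independence[of x H y] ah.a_rcos_self[of x] H submodule.axioms(1)[OF H]
  by (auto simp: minus_eq abelian_subgroup_def)
lemma coset_smult: assumes "c \<in> carrier k" "x \<in> carrier M"
 shows "c \<odot>\<^bsub>quotient_module M H\<^esub> (H +>\<^bsub>M\<^esub> x) = H +>\<^bsub>M\<^esub> (c \<odot>\<^bsub>M\<^esub> x)"
proof -
  have "H +>\<^bsub>M\<^esub> (c \<odot>\<^bsub>M\<^esub> y) = H +>\<^bsub>M\<^esub> (c \<odot>\<^bsub>M\<^esub> x)" if y: "y \<in> H +>\<^bsub>M\<^esub> x" for y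
  proof -
    obtain h where h: "h \<in> H" "y = h \<oplus>\<^bsub>M\<^esub> x" using y by (auto simp: a_r_coset_def')
    have hc: "h \<in> carrier M" using h ah.a_subset by auto
    have "y \<in> carrier M" using h hc assms by auto
    moreover have "c \<odot>\<^bsub>M\<^esub> y \<ominus>\<^bsub>M\<^esub> c \<odot>\<^bsub>M\<^esub> x = c \<odot>\<^bsub>M\<^esub> h"
      using hc assms h by (simp add: smult_r_distr M.minus_eq M.a_assoc M.r_neg)
    ultimately show ?thesis using assms h submodule.smult_closed[OF H] coset_eq by simp
  qed
  then have "(\<Union>y\<in>H +>\<^bsub>M\<^esub> x. H +>\<^bsub>M\<^esub> (c \<odot>\<^bsub>M\<^esub> y)) = (\<Union>y\<in>H +>\<^bsub>M\<^esub> x. H +>\<^bsub>M\<^esub> (c \<odot>\<^bsub>M\<^esub> x))" by (rule SUP_cong[OF refl])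
  moreover have "H +>\<^bsub>M\<^esub> x \<noteq> {}" using ah.a_rcos_self[OF assms(2)] by blast
  ultimately show ?thesis by (simp add: quotient_module_def)
qed

lemma module_quotient: "module k (quotient_module M H)"
proof (rule moduleI)
  show "cring k" by (rule R.is_cring)
  have z: "\<zero>\<^bsub>quotient_module M H\<^esub> = H +>\<^bsub>M\<^esub> \<zero>\<^bsub>M\<^esub>"
    using a_coset_add_zero ah.a_subset by (simp add: quotient_module_def)
  show "abelian_group (quotient_module M H)"
  proof (rule abelian_groupI)
    fix A assume "A \<in> carrier (quotient_module M H)"
    then obtain x where x: "x \<in> carrier M" "A = H +>\<^bsub>M\<^esub> x" using coset_carE by blast
    show "\<exists>B\<in>carrier (quotient_module M H). B \<oplus>\<^bsub>quotient_module M H\<^esub> A = \<zero>\<^bsub>quotient_module M H\<^esub>"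
      by (rule bexI[of _ "H +>\<^bsub>M\<^esub> (\<ominus>\<^bsub>M\<^esub> x)"]) (use x in \<open>auto simp: coset_add z coset_carrier M.l_neg\<close>)
  qed (auto dest!: coset_carE simp: coset_add z coset_carrier M.a_assoc M.a_comm M.add.m_lcomm)
qed (auto dest!: coset_carE simp: coset_add coset_smult coset_carrier smult_l_distr smult_r_distr smult_assoc1)

lemma quotient_lift:
  assumes N: "module k N" and f: "f \<in> linear_maps k M N" "\<And>x. x \<in> H \<Longrightarrow> f x = \<zero>\<^bsub>N\<^esub>"
  shows "\<exists>!g. g \<in> linear_maps k (quotient_module M H) N \<and> (\<forall>x\<in>carrier M. g (H +>\<^bsub>M\<^esub> x) = f x)"
proof -
  interpret N: module k N by fact
  note fD = linear_mapsD[OF f(1)]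
  have wd: "f x = f y" if "x \<in> carrier M" "y \<in> carrier M" "H +>\<^bsub>M\<^esub> x = H +>\<^bsub>M\<^esub> y" for x y
  proof -
    have "x \<ominus>\<^bsub>M\<^esub> y \<in> H" using that coset_eq by auto
    moreover have "x = (x \<ominus>\<^bsub>M\<^esub> y) \<oplus>\<^bsub>M\<^esub> y" using that by (simp add: M.minus_eq M.a_assoc M.l_neg)
    ultimately have "f x = \<zero>\<^bsub>N\<^esub> \<oplus>\<^bsub>N\<^esub> f y" using f(2) fD(3) that by (metis M.minus_closed)
    then show ?thesis using that fD by simp
  qed
  define g where "g A = (if A \<in> carrier (quotient_module M H) then f (SOME x. x \<in> carrier M \<and> A = H +>\<^bsub>M\<^esub> x) else undefined)" for A
  have g: "g (H +>\<^bsub>M\<^esub> x) = f x" if "x \<in> carrier M" for x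
    using wd that coset_carrier unfolding g_def by (smt (verit) someI_ex)
  have "g \<in> linear_maps k (quotient_module M H) N"
    apply (rule linear_mapsI)
    apply (auto dest!: coset_carE simp: coset_add coset_smult g fD)
    by (simp add: g_def)
  moreover have "g' = g" if "g' \<in> linear_maps k (quotient_module M H) N \<and> (\<forall>x\<in>carrier M. g' (H +>\<^bsub>M\<^esub> x) = f x)" for g'
    apply (rule ext) subgoal for A
    apply (cases "A \<in> carrier (quotient_module M H)")
    using that g coset_carE apply metis
      using that linear_mapsD(2) calculation by metis done
  ultimately show ?thesis using g by blast
qed
end

lemma copies_lift:
  assumes M: "module k M" and N: "module k N" and f: "\<And>i. i \<in> I \<Longrightarrow> f i \<in> linear_maps k M N"
  shows "\<exists>g. g \<in> linear_maps k (copies I M) N \<and> (\<forall>i\<in>I. \<forall>x\<in>carrier M. g (summand_incl M i x) = f i x)"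
proof -
  interpret M: module k M by fact
  interpret N: module k N by fact
  have fz: "f i \<zero>\<^bsub>M\<^esub> = \<zero>\<^bsub>N\<^esub>" if "i \<in> I" for i
  proof -
    have "f i (\<zero>\<^bsub>k\<^esub> \<odot>\<^bsub>M\<^esub> \<zero>\<^bsub>M\<^esub>) = \<zero>\<^bsub>k\<^esub> \<odot>\<^bsub>N\<^esub> f i \<zero>\<^bsub>M\<^esub>"
      by (rule linear_mapsD(4)[OF f[OF that]]) auto
    then show ?thesis using linear_mapsD(1)[OF f[OF that]] by simp
  qed
  have car: "a \<in> carrier (copies I M) \<longleftrightarrow> (\<forall>i\<in>I. a i \<in> carrier M) \<and> (\<forall>i. i \<notin> I \<longrightarrow> a i = \<zero>\<^bsub>M\<^esub>) \<and> finite {i. a i \<noteq> \<zero>\<^bsub>M\<^esub>}" for a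
    by (auto simp: copies_def)
  define g where "g a = (if a \<in> carrier (copies I M) then finsum N (\<lambda>i. f i (a i)) {i. a i \<noteq> \<zero>\<^bsub>M\<^esub>} else undefined)" for a
  have gS: "g a = finsum N (\<lambda>i. f i (a i)) S" if a: "a \<in> carrier (copies I M)" and S: "finite S" "{i. a i \<noteq> \<zero>\<^bsub>M\<^esub>} \<subseteq> S" "S \<subseteq> I" for a S
  proof -
    have "finsum N (\<lambda>i. f i (a i)) {i. a i \<noteq> \<zero>\<^bsub>M\<^esub>} = finsum N (\<lambda>i. f i (a i)) S"
      apply (rule N.M.add.finprod_mono_neutral_cong_left[simplified])
      using S a fz linear_mapsD(1)[OF f] by (auto simp: car finsum_def)
    then show ?thesis using a by (simp add: g_def)
  qed
  have sup: "{i. a i \<noteq> \<zero>\<^bsub>M\<^esub>} \<subseteq> I" "finite {i. a i \<noteq> \<zero>\<^bsub>M\<^esub>}" if "a \<in> carrier (copies I M)" for a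
    using that by (auto simp: car)
  note mc = module.axioms
  interpret C: module k "copies I M" by (rule module_copies[OF M])
  have "g \<in> linear_maps k (copies I M) N"
  proof (rule linear_mapsI)
    fix a assume "a \<in> carrier (copies I M)"
    then show "g a \<in> carrier N" unfolding g_def using linear_mapsD(1)[OF f] 
      by (auto simp: car intro!: N.M.finsum_closed)
  next
    fix a b assume a: "a \<in> carrier (copies I M)" and b: "b \<in> carrier (copies I M)"
    let ?S = "{i. a i \<noteq> \<zero>\<^bsub>M\<^esub>} \<union> {i. b i \<noteq> \<zero>\<^bsub>M\<^esub>}"
    have S: "finite ?S" "?S \<subseteq> I" using sup a b by auto
    have ab: "(a \<oplus>\<^bsub>copies I M\<^esub> b) = (\<lambda>i. a i \<oplus>\<^bsub>M\<^esub> b i)" by (simp add: copies_def)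
    have "g (a \<oplus>\<^bsub>copies I M\<^esub> b) = finsum N (\<lambda>i. f i ((a \<oplus>\<^bsub>copies I M\<^esub> b) i)) ?S"
      by (rule gS) (use a b S C.M.a_closed[OF a b] in \<open>auto simp: ab\<close>)
    also have "\<dots> = finsum N (\<lambda>i. f i (a i) \<oplus>\<^bsub>N\<^esub> f i (b i)) ?S"
      apply (rule N.M.finsum_cong')
      using S a b linear_mapsD(1,3)[OF f] by (auto simp: ab car)
    also have "\<dots> = finsum N (\<lambda>i. f i (a i)) ?S \<oplus>\<^bsub>N\<^esub> finsum N (\<lambda>i. f i (b i)) ?S"
      apply (rule N.M.finsum_addf) using S a b linear_mapsD(1)[OF f] by (auto simp: car)
    also have "\<dots> = g a \<oplus>\<^bsub>N\<^esub> g b" using gS[OF a, of ?S] gS[OF b, of ?S] S by auto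
    finally show "g (a \<oplus>\<^bsub>copies I M\<^esub> b) = g a \<oplus>\<^bsub>N\<^esub> g b" .
  next
    fix c a assume a: "a \<in> carrier (copies I M)" and c: "c \<in> carrier k"
    let ?S = "{i. a i \<noteq> \<zero>\<^bsub>M\<^esub>}"
    have S: "finite ?S" "?S \<subseteq> I" using sup a by auto
    have ab: "(c \<odot>\<^bsub>copies I M\<^esub> a) = (\<lambda>i. c \<odot>\<^bsub>M\<^esub> a i)" by (simp add: copies_def)
    have "g (c \<odot>\<^bsub>copies I M\<^esub> a) = finsum N (\<lambda>i. f i ((c \<odot>\<^bsub>copies I M\<^esub> a) i)) ?S"
      by (rule gS) (use a c S C.smult_closed[OF c a] in \<open>auto simp: ab\<close>)
    also have "\<dots> = finsum N (\<lambda>i. c \<odot>\<^bsub>N\<^esub> f i (a i)) ?S"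
      apply (rule N.M.finsum_cong')
      using S a c linear_mapsD(1,4)[OF f] by (auto simp: ab car)
    also have "\<dots> = c \<odot>\<^bsub>N\<^esub> finsum N (\<lambda>i. f i (a i)) ?S"
      apply (rule N.finsum_smult_ldistr[symmetric]) using S a c linear_mapsD(1)[OF f] by (auto simp: car)
    finally show "g (c \<odot>\<^bsub>copies I M\<^esub> a) = c \<odot>\<^bsub>N\<^esub> g a" using gS[OF a, of ?S] S by auto
  qed (simp add: g_def)
  moreover have "g (summand_incl M i x) = f i x" if i: "i \<in> I" and x: "x \<in> carrier M" for i x
  proof -
    have c: "summand_incl M i x \<in> carrier (copies I M)"
      using i x by (auto simp: car summand_incl_def)
    have "g (summand_incl M i x) = finsum N (\<lambda>j. f j (summand_incl M i x j)) {i}"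
      by (rule gS[OF c]) (use i in \<open>auto simp: summand_incl_def\<close>)
    also have "\<dots> = f i x" using linear_mapsD(1)[OF f[OF i] x] by (simp add: summand_incl_def)
    finally show ?thesis .
  qed
  ultimately show ?thesis by blast
qed


lemma linear_maps_comp:
  assumes "f \<in> linear_maps k A B" "g \<in> linear_maps k B C" and A: "module k A"
  shows "compose (carrier A) g f \<in> linear_maps k A C"
proof -
  interpret module k A by fact
  show ?thesis
  apply (rule linear_mapsI) using linear_mapsD[OF assms(1)] linear_mapsD[OF assms(2)] by (auto simp: compose_def)
qed

lemma free_lift:
  assumes N: "module k N" and g: "\<And>i. i \<in> I \<Longrightarrow> g i \<in> carrier N"
  shows "\<exists>f. f \<in> linear_maps k (free_module k I) N \<and> (\<forall>i\<in>I. f (basis_vec k i) = g i)"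
proof -
  interpret N: module k N by fact
  let ?f = "\<lambda>i. \<lambda>c\<in>carrier k. c \<odot>\<^bsub>N\<^esub> g i"
  have l: "?f i \<in> linear_maps k (scalars k) N" if "i \<in> I" for i
    apply (rule linear_mapsI)
    using g[OF that] by (auto simp: scalars_def N.smult_l_distr N.smult_assoc1)
  have "\<exists>f. f \<in> linear_maps k (copies I (scalars k)) N \<and>
     (\<forall>i\<in>I. \<forall>x\<in>carrier (scalars k). f (summand_incl (scalars k) i x) = ?f i x)"
    by (rule copies_lift[OF module_scalars[OF N.R.is_cring] N l])
  then obtain f where f: "f \<in> linear_maps k (copies I (scalars k)) N"
     "\<forall>i\<in>I. \<forall>x\<in>carrier (scalars k). f (summand_incl (scalars k) i x) = ?f i x" by blast
  have "\<one>\<^bsub>k\<^esub> \<in> carrier (scalars k)" by (simp add: scalars_def)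
  then have "f (basis_vec k i) = g i" if "i \<in> I" for i
    using f(2)[rule_format, OF that, of "\<one>\<^bsub>k\<^esub>"] g[OF that] by (simp add: basis_vec_def)
  then show ?thesis using f(1) unfolding free_module_def by (intro exI[of _ f]) simp
qed

lemma linear_map_arith: assumes "module k M" "module k N" "f \<in> linear_maps k M N"
  shows "f \<zero>\<^bsub>M\<^esub> = \<zero>\<^bsub>N\<^esub>" "x \<in> carrier M \<Longrightarrow> f (\<ominus>\<^bsub>M\<^esub> x) = \<ominus>\<^bsub>N\<^esub> f x"
  "x \<in> carrier M \<Longrightarrow> y \<in> carrier M \<Longrightarrow> f (x \<ominus>\<^bsub>M\<^esub> y) = f x \<ominus>\<^bsub>N\<^esub> f y"
proof -
  interpret M: module k M by fact
  interpret N: module k N by fact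
  note D = linear_mapsD[OF assms(3)]
  have "f (\<zero>\<^bsub>k\<^esub> \<odot>\<^bsub>M\<^esub> \<zero>\<^bsub>M\<^esub>) = \<zero>\<^bsub>k\<^esub> \<odot>\<^bsub>N\<^esub> f \<zero>\<^bsub>M\<^esub>"
      by (rule D(4)) auto
  then show 1: "f \<zero>\<^bsub>M\<^esub> = \<zero>\<^bsub>N\<^esub>" using D(1) by simp
  show 2: "f (\<ominus>\<^bsub>M\<^esub> x) = \<ominus>\<^bsub>N\<^esub> f x" if "x \<in> carrier M" for x
    using that 1 D(1,3) by (metis M.M.a_inv_closed M.M.r_neg N.M.add.inv_unique' N.M.minus_equality M.M.l_neg)
  show "x \<in> carrier M \<Longrightarrow> y \<in> carrier M \<Longrightarrow> f (x \<ominus>\<^bsub>M\<^esub> y) = f x \<ominus>\<^bsub>N\<^esub> f y"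
    using 2 D by (simp add: M.M.minus_eq N.M.minus_eq)
qed

lemma submodule_kernel: assumes "module k M" "module k N" "f \<in> linear_maps k M N"
  shows "submodule {x \<in> carrier M. f x = \<zero>\<^bsub>N\<^esub>} k M"
proof -
  interpret M: module k M by fact
  interpret N: module k N by fact
  show ?thesis
  proof (rule M.submoduleI)
    show "{x \<in> carrier M. f x = \<zero>\<^bsub>N\<^esub>} \<subseteq> carrier M" by blast
    show "\<zero>\<^bsub>M\<^esub> \<in> {x \<in> carrier M. f x = \<zero>\<^bsub>N\<^esub>}" using linear_map_arith(1)[OF assms] by simp
    show "\<ominus>\<^bsub>M\<^esub> a \<in> {x \<in> carrier M. f x = \<zero>\<^bsub>N\<^esub>}" if "a \<in> {x \<in> carrier M. f x = \<zero>\<^bsub>N\<^esub>}" for a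
      using linear_map_arith(2)[OF assms, of a] that by simp
    show "a \<oplus>\<^bsub>M\<^esub> b \<in> {x \<in> carrier M. f x = \<zero>\<^bsub>N\<^esub>}" if "a \<in> {x \<in> carrier M. f x = \<zero>\<^bsub>N\<^esub>}" "b \<in> {x \<in> carrier M. f x = \<zero>\<^bsub>N\<^esub>}" for a b
      using linear_mapsD(3)[OF assms(3), of a b] that by simp
    show "c \<odot>\<^bsub>M\<^esub> b \<in> {x \<in> carrier M. f x = \<zero>\<^bsub>N\<^esub>}" if "c \<in> carrier k" "b \<in> {x \<in> carrier M. f x = \<zero>\<^bsub>N\<^esub>}" for c b
      using linear_mapsD(4)[OF assms(3), of c b] that by simp
  qed
qed

lemma basis_vec_closed: assumes "cring k" "i \<in> I" shows "basis_vec k i \<in> carrier (free_module k I)"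
proof -
  interpret cring k by fact
  have "finite {j. basis_vec k i j \<noteq> \<zero>\<^bsub>k\<^esub>}"
    by (rule finite_subset[of _ "{i}"]) (auto simp: basis_vec_def summand_incl_def scalars_def)
  then show ?thesis using assms(2)
    by (auto simp: basis_vec_def free_module_def copies_def summand_incl_def scalars_def)
qed

lemma module_free: "cring k \<Longrightarrow> module k (free_module k I)"
  unfolding free_module_def by (intro module_copies module_scalars)

lemma copies_ext:
  assumes M: "module k M" and N: "module k N"
   and f: "f \<in> linear_maps k (copies I M) N" and g: "g \<in> linear_maps k (copies I M) N"
   and eq: "\<And>i x. i \<in> I \<Longrightarrow> x \<in> carrier M \<Longrightarrow> f (summand_incl M i x) = g (summand_incl M i x)"
  shows "f = g"
proof
  fix a
  interpret M: module k M by fact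
  interpret N: module k N by fact
  interpret C: module k "copies I M" by (rule module_copies[OF M])
  have car: "a \<in> carrier (copies I M) \<longleftrightarrow> (\<forall>i\<in>I. a i \<in> carrier M) \<and> (\<forall>i. i \<notin> I \<longrightarrow> a i = \<zero>\<^bsub>M\<^esub>) \<and> finite {i. a i \<noteq> \<zero>\<^bsub>M\<^esub>}" for a
    by (auto simp: copies_def)
  have "\<forall>a. {i. a i \<noteq> \<zero>\<^bsub>M\<^esub>} \<subseteq> S \<longrightarrow> a \<in> carrier (copies I M) \<longrightarrow> f a = g a" if "finite S" for S
    using that
  proof induction
    case empty
    have "a = \<zero>\<^bsub>copies I M\<^esub>" if "{i. a i \<noteq> \<zero>\<^bsub>M\<^esub>} \<subseteq> {}" for a using that by (auto simp: copies_def)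
    then show ?case using linear_map_arith(1)[OF C.module_axioms N] f g by metis
  next
    case (insert i S)
    show ?case
    proof (intro allI impI)
      fix a assume a: "{i. a i \<noteq> \<zero>\<^bsub>M\<^esub>} \<subseteq> insert i S" "a \<in> carrier (copies I M)"
      show "f a = g a"
      proof (cases "i \<in> I")
        case False
        then have "{i. a i \<noteq> \<zero>\<^bsub>M\<^esub>} \<subseteq> S" using a car by auto
        then show ?thesis using a insert by blast
      next
        case True
        let ?b = "a(i := \<zero>\<^bsub>M\<^esub>)" let ?c = "summand_incl M i (a i)"
        have b: "?b \<in> carrier (copies I M)" "{i. ?b i \<noteq> \<zero>\<^bsub>M\<^esub>} \<subseteq> S" using a rev_finite_subset[of "{j. a j \<noteq> \<zero>\<^bsub>M\<^esub>}" "{ia. ia \<noteq> i \<and> (ia \<noteq> i \<longrightarrow> a ia \<noteq> \<zero>\<^bsub>M\<^esub>)}"] by (auto simp: car)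
        have c: "?c \<in> carrier (copies I M)" using a True by (auto simp: car summand_incl_def)
        have am: "a j \<in> carrier M" for j using a car[of a] by (cases "j \<in> I") auto
        have "a = ?b \<oplus>\<^bsub>copies I M\<^esub> ?c" using am by (auto simp: copies_def summand_incl_def)
        moreover have "f ?b = g ?b" using insert b by blast
        moreover have "f ?c = g ?c" using eq True a car by blast
        ultimately show ?thesis using linear_mapsD(3)[OF f b(1) c] linear_mapsD(3)[OF g b(1) c] by simp
      qed
    qed
  qed
  then have "a \<in> carrier (copies I M) \<Longrightarrow> f a = g a" using car by blast
  then show "f a = g a" using linear_mapsD(2)[OF f] linear_mapsD(2)[OF g] by metis
qed

lemma quotient_map_linear:
  assumes M: "module k M" and H: "submodule H k M"
  shows "(\<lambda>x\<in>carrier M. H +>\<^bsub>M\<^esub> x) \<in> linear_maps k M (quotient_module M H)"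
proof -
  interpret module k M by fact
  show ?thesis
  apply (rule linear_mapsI)
     apply (auto simp: coset_carrier[OF M H] coset_add[OF M H] coset_smult[OF M H])
    done
qed

lemma presentation_lift:
  assumes k: "cring k" and N: "module k N" and g: "\<And>i. i \<in> I \<Longrightarrow> g i \<in> carrier N"
   and R: "R \<subseteq> carrier (free_module k I)"
   and rel: "\<And>f. f \<in> linear_maps k (free_module k I) N \<Longrightarrow> (\<forall>i\<in>I. f (basis_vec k i) = g i) \<Longrightarrow> (\<forall>r\<in>R. f r = \<zero>\<^bsub>N\<^esub>)"
  shows "\<exists>h. h \<in> linear_maps k (quotient_module (free_module k I) (submodule_span k (free_module k I) R)) N \<and>
    (\<forall>i\<in>I. h (submodule_span k (free_module k I) R +>\<^bsub>free_module k I\<^esub> basis_vec k i) = g i)"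
proof -
  let ?F = "free_module k I"
  note F = module_free[OF k, of I]
  have "\<exists>f. f \<in> linear_maps k ?F N \<and> (\<forall>i\<in>I. f (basis_vec k i) = g i)" by (rule free_lift[OF N g])
  then obtain f where f: "f \<in> linear_maps k ?F N \<and> (\<forall>i\<in>I. f (basis_vec k i) = g i)" by (rule exE)
  note f = conjunct1[OF f] conjunct2[OF f]
  have "submodule_span k ?F R \<subseteq> {x \<in> carrier ?F. f x = \<zero>\<^bsub>N\<^esub>}"
  proof -
    have "R \<subseteq> {x \<in> carrier ?F. f x = \<zero>\<^bsub>N\<^esub>}" using rel[OF f] R by auto
    then have "{x \<in> carrier ?F. f x = \<zero>\<^bsub>N\<^esub>} \<in> {H. submodule H k ?F \<and> R \<subseteq> H}"
      using submodule_kernel[OF F N f(1)] by simp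
    then show ?thesis unfolding submodule_span_def by (rule Inter_lower)
  qed
  then have sz: "f x = \<zero>\<^bsub>N\<^esub>" if "x \<in> submodule_span k ?F R" for x using that by blast
  have "\<exists>!h. h \<in> linear_maps k (quotient_module ?F (submodule_span k ?F R)) N \<and> (\<forall>x\<in>carrier ?F. h (submodule_span k ?F R +>\<^bsub>?F\<^esub> x) = f x)"
    by (rule quotient_lift[OF F submodule_spanI(1)[OF F R] N f(1) sz])
  then obtain h where h: "h \<in> linear_maps k (quotient_module ?F (submodule_span k ?F R)) N \<and>
    (\<forall>x\<in>carrier ?F. h (submodule_span k ?F R +>\<^bsub>?F\<^esub> x) = f x)" by (rule ex1E)
  note h = conjunct1[OF h] conjunct2[OF h]
  show ?thesis
  proof (rule exI[of _ h], rule conjI[OF h(1)], rule ballI)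
    fix i assume i: "i \<in> I"
    show "h (submodule_span k ?F R +>\<^bsub>?F\<^esub> basis_vec k i) = g i"
      by (rule trans[OF h(2)[rule_format, OF basis_vec_closed[OF k i]] f(2)[rule_format, OF i]])
  qed
qed

lemma presentation_unique:
  assumes k: "cring k" and N: "module k N" and R: "R \<subseteq> carrier (free_module k I)"
   and f: "f \<in> linear_maps k (quotient_module (free_module k I) (submodule_span k (free_module k I) R)) N"
   and g: "g \<in> linear_maps k (quotient_module (free_module k I) (submodule_span k (free_module k I) R)) N"
   and eq: "\<And>i. i \<in> I \<Longrightarrow> f (submodule_span k (free_module k I) R +>\<^bsub>free_module k I\<^esub> basis_vec k i) = g (submodule_span k (free_module k I) R +>\<^bsub>free_module k I\<^esub> basis_vec k i)"
  shows "f = g"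
proof -
  let ?F = "free_module k I" let ?H = "submodule_span k ?F R"
  interpret F: module k ?F by (rule module_free[OF k])
  interpret N: module k N by fact
  have H: "submodule ?H k ?F" using submodule_spanI[OF F.module_axioms R] by blast
  let ?q = "\<lambda>x\<in>carrier ?F. ?H +>\<^bsub>?F\<^esub> x"
  note q = quotient_map_linear[OF F.module_axioms H]
  have fq: "compose (carrier ?F) f ?q \<in> linear_maps k ?F N" "compose (carrier ?F) g ?q \<in> linear_maps k ?F N"
    using linear_maps_comp[OF q f] linear_maps_comp[OF q g] F.module_axioms by auto
  have fq': "compose (carrier ?F) f ?q \<in> linear_maps k (copies I (scalars k)) N" "compose (carrier ?F) g ?q \<in> linear_maps k (copies I (scalars k)) N"
    using fq by (simp_all only: free_module_def)
  have ceq: "compose (carrier ?F) f ?q = compose (carrier ?F) g ?q"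
  proof (rule copies_ext[OF module_scalars[OF k] N fq'])
    fix i x assume i: "i \<in> I" and x: "x \<in> carrier (scalars k)"
    have xk: "x \<in> carrier k" using x by (simp add: scalars_def)
    have e: "summand_incl (scalars k) i x = x \<odot>\<^bsub>?F\<^esub> basis_vec k i"
      using xk by (simp add: free_module_def copies_def summand_incl_def basis_vec_def scalars_def fun_eq_iff)
    note b = basis_vec_closed[OF k i]
    have "compose (carrier ?F) f ?q (basis_vec k i) = compose (carrier ?F) g ?q (basis_vec k i)"
      using eq[OF i] b by (simp add: compose_def)
    then show "compose (carrier ?F) f ?q (summand_incl (scalars k) i x) = compose (carrier ?F) g ?q (summand_incl (scalars k) i x)"
      unfolding e linear_mapsD(4)[OF fq(1) xk b] linear_mapsD(4)[OF fq(2) xk b] by simp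
  qed
  have *: "f (?H +>\<^bsub>?F\<^esub> x) = g (?H +>\<^bsub>?F\<^esub> x)" if "x \<in> carrier ?F" for x
    using fun_cong[OF ceq, of x] that by (simp add: compose_def)
  show ?thesis
  proof
    fix A show "f A = g A"
    proof (cases "A \<in> carrier (quotient_module ?F ?H)")
      case True then show ?thesis using coset_carE[OF F.module_axioms H True] * by (elim bexE) (simp only:)
    next
      case False then show ?thesis using linear_mapsD(2)[OF f] linear_mapsD(2)[OF g] by simp
    qed
  qed
qed
lemma presentation_ex1:
  assumes k: "cring k" and N: "module k N" and g: "\<And>i. i \<in> I \<Longrightarrow> g i \<in> carrier N"
   and R: "R \<subseteq> carrier (free_module k I)"
   and rel: "\<And>f. f \<in> linear_maps k (free_module k I) N \<Longrightarrow> (\<forall>i\<in>I. f (basis_vec k i) = g i) \<Longrightarrow> (\<forall>r\<in>R. f r = \<zero>\<^bsub>N\<^esub>)"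
  shows "\<exists>!h. h \<in> linear_maps k (quotient_module (free_module k I) (submodule_span k (free_module k I) R)) N \<and>
    (\<forall>i\<in>I. h (submodule_span k (free_module k I) R +>\<^bsub>free_module k I\<^esub> basis_vec k i) = g i)"
proof (rule ex_ex1I)
  show "\<exists>h. h \<in> linear_maps k (quotient_module (free_module k I) (submodule_span k (free_module k I) R)) N \<and>
    (\<forall>i\<in>I. h (submodule_span k (free_module k I) R +>\<^bsub>free_module k I\<^esub> basis_vec k i) = g i)"
    by (rule presentation_lift[OF k N g R rel])
qed (rule presentation_unique[OF k N R]; simp)

lemma tensor_lift_ex1:
  assumes k: "cring k" and V: "module k V" and W: "module k W" and N: "module k N"
  and b: "\<And>v w. v \<in> carrier V \<Longrightarrow> w \<in> carrier W \<Longrightarrow> b v w \<in> carrier N"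
   "\<And>v v' w. v \<in> carrier V \<Longrightarrow> v' \<in> carrier V \<Longrightarrow> w \<in> carrier W \<Longrightarrow> b (v \<oplus>\<^bsub>V\<^esub> v') w = b v w \<oplus>\<^bsub>N\<^esub> b v' w"
   "\<And>v v' w. v \<in> carrier V \<Longrightarrow> v' \<in> carrier W \<Longrightarrow> w \<in> carrier W \<Longrightarrow> b v (w \<oplus>\<^bsub>W\<^esub> v') = b v w \<oplus>\<^bsub>N\<^esub> b v v'"
   "\<And>v c w. v \<in> carrier V \<Longrightarrow> c \<in> carrier k \<Longrightarrow> w \<in> carrier W \<Longrightarrow> b (c \<odot>\<^bsub>V\<^esub> v) w = c \<odot>\<^bsub>N\<^esub> b v w"
   "\<And>v c w. v \<in> carrier V \<Longrightarrow> c \<in> carrier k \<Longrightarrow> w \<in> carrier W \<Longrightarrow> b v (c \<odot>\<^bsub>W\<^esub> w) = c \<odot>\<^bsub>N\<^esub> b v w"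
 shows "\<exists>!f. f \<in> linear_maps k (tensor k V W) N \<and>
     (\<forall>v\<in>carrier V. \<forall>w\<in>carrier W. f (pure_tensor k V W v w) = b v w)"
proof -
  interpret V: module k V by fact
  interpret W: module k W by fact
  interpret N: module k N by fact
  let ?I = "carrier V \<times> carrier W"
  let ?F = "free_module k ?I"
  interpret F: module k ?F by (rule module_free[OF k])
  note bc = basis_vec_closed[OF k, of _ ?I]
  have lz: "f (x \<ominus>\<^bsub>?F\<^esub> y) = f x \<ominus>\<^bsub>N\<^esub> f y" if "f \<in> linear_maps k ?F N" "x \<in> carrier ?F" "y \<in> carrier ?F" for f x y
    using linear_map_arith(3)[OF F.module_axioms N that] .
  have z: "f (x \<ominus>\<^bsub>?F\<^esub> y) = \<zero>\<^bsub>N\<^esub>" if "f \<in> linear_maps k ?F N" "x \<in> carrier ?F" "y \<in> carrier ?F" "f x = f y" for f x y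
    using lz[OF that(1-3)] linear_mapsD(1)[OF that(1,3)] that(4) by (simp add: N.M.minus_eq N.M.r_neg)
  have "\<exists>!h. h \<in> linear_maps k (tensor k V W) N \<and> (\<forall>i\<in>?I. h (tensor_rel k V W +>\<^bsub>?F\<^esub> basis_vec k i) = (\<lambda>i. b (fst i) (snd i)) i)"
    unfolding tensor_def tensor_rel_def Let_def
  proof (rule presentation_ex1[OF k N], goal_cases)
    case (1 i) then show ?case using b(1) by auto
  next
    case 2 show ?case 
      by (intro Un_least subsetI; elim CollectE exE conjE; simp add: bc F.M.minus_closed)
  next
    case (3 f)
    have fb: "f (basis_vec k (v,w)) = b v w" if "v \<in> carrier V" "w \<in> carrier W" for v w
      using 3(2) that by simp
    show ?case
      apply (rule ballI)
      apply (elim UnE CollectE exE conjE; hypsubst; rule z[OF 3(1)])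
      by (simp_all add: bc fb b linear_mapsD(3,4)[OF 3(1)])
  qed
  then show ?thesis unfolding pure_tensor_def by simp
qed

lemma Sym_ex1:
  assumes k: "cring k" and V: "module k V" and N: "module k N"
  and b: "\<And>xs. xs \<in> lists (carrier V) \<Longrightarrow> g xs \<in> carrier N"
   "\<And>xs ys v w. xs \<in> lists (carrier V) \<Longrightarrow> ys \<in> lists (carrier V) \<Longrightarrow> v \<in> carrier V \<Longrightarrow> w \<in> carrier V \<Longrightarrow> g (xs @ (v \<oplus>\<^bsub>V\<^esub> w) # ys) = g (xs @ v # ys) \<oplus>\<^bsub>N\<^esub> g (xs @ w # ys)"
   "\<And>xs ys v c. xs \<in> lists (carrier V) \<Longrightarrow> ys \<in> lists (carrier V) \<Longrightarrow> v \<in> carrier V \<Longrightarrow> c \<in> carrier k \<Longrightarrow> g (xs @ (c \<odot>\<^bsub>V\<^esub> v) # ys) = c \<odot>\<^bsub>N\<^esub> g (xs @ v # ys)"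
   "\<And>xs ys v w. xs \<in> lists (carrier V) \<Longrightarrow> ys \<in> lists (carrier V) \<Longrightarrow> v \<in> carrier V \<Longrightarrow> w \<in> carrier V \<Longrightarrow> g (xs @ v # w # ys) = g (xs @ w # v # ys)"
 shows "\<exists>!f. f \<in> linear_maps k (Sym k V) N \<and> (\<forall>xs\<in>lists (carrier V). f (sym_word k V xs) = g xs)"
proof -
  interpret V: module k V by fact
  interpret N: module k N by fact
  let ?I = "lists (carrier V)"
  let ?F = "free_module k ?I"
  interpret F: module k ?F by (rule module_free[OF k])
  note bc = basis_vec_closed[OF k, of _ ?I]
  have lz: "f (x \<ominus>\<^bsub>?F\<^esub> y) = f x \<ominus>\<^bsub>N\<^esub> f y" if "f \<in> linear_maps k ?F N" "x \<in> carrier ?F" "y \<in> carrier ?F" for f x y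
    using linear_map_arith(3)[OF F.module_axioms N that] .
  have z: "f (x \<ominus>\<^bsub>?F\<^esub> y) = \<zero>\<^bsub>N\<^esub>" if "f \<in> linear_maps k ?F N" "x \<in> carrier ?F" "y \<in> carrier ?F" "f x = f y" for f x y
    using lz[OF that(1-3)] linear_mapsD(1)[OF that(1,3)] that(4) by (simp add: N.M.minus_eq N.M.r_neg)
  show ?thesis
    unfolding Sym_def sym_word_def sym_rel_def Let_def
  proof (rule presentation_ex1[OF k N], goal_cases)
    case (1 i) then show ?case using b(1) by auto
  next
    case 2 show ?case 
      by (intro Un_least subsetI; elim CollectE exE conjE; simp add: bc F.M.minus_closed)
  next
    case (3 f)
    have fb: "f (basis_vec k xs) = g xs" if "xs \<in> ?I" for xs
      using 3(2) that by simp
    show ?case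
      apply (rule ballI)
      apply (elim UnE CollectE exE conjE; hypsubst; rule z[OF 3(1)])
      by (simp_all add: bc fb b linear_mapsD(3,4)[OF 3(1)])
  qed
qed


lemma tensor_lift:
  assumes "cring k" and "module k V" and "module k W" and "module k N"
  and "\<And>v w. v \<in> carrier V \<Longrightarrow> w \<in> carrier W \<Longrightarrow> b v w \<in> carrier N"
   "\<And>v v' w. v \<in> carrier V \<Longrightarrow> v' \<in> carrier V \<Longrightarrow> w \<in> carrier W \<Longrightarrow> b (v \<oplus>\<^bsub>V\<^esub> v') w = b v w \<oplus>\<^bsub>N\<^esub> b v' w"
   "\<And>v w w'. v \<in> carrier V \<Longrightarrow> w \<in> carrier W \<Longrightarrow> w' \<in> carrier W \<Longrightarrow> b v (w \<oplus>\<^bsub>W\<^esub> w') = b v w \<oplus>\<^bsub>N\<^esub> b v w'"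
   "\<And>c v w. c \<in> carrier k \<Longrightarrow> v \<in> carrier V \<Longrightarrow> w \<in> carrier W \<Longrightarrow> b (c \<odot>\<^bsub>V\<^esub> v) w = c \<odot>\<^bsub>N\<^esub> b v w"
   "\<And>c v w. c \<in> carrier k \<Longrightarrow> v \<in> carrier V \<Longrightarrow> w \<in> carrier W \<Longrightarrow> b v (c \<odot>\<^bsub>W\<^esub> w) = c \<odot>\<^bsub>N\<^esub> b v w"
 shows "tensor_lift k V W N b \<in> linear_maps k (tensor k V W) N \<and>
     (\<forall>v\<in>carrier V. \<forall>w\<in>carrier W. tensor_lift k V W N b (pure_tensor k V W v w) = b v w)"
  unfolding tensor_lift_def by (rule theI'[OF tensor_lift_ex1]) (use assms in auto)

lemma module_Sym: assumes k: "cring k" and V: "module k V" shows "module k (Sym k V)"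
proof -
  interpret V: module k V by fact
  interpret F: module k "free_module k (lists (carrier V))" by (rule module_free[OF k])
  note bc = basis_vec_closed[OF k, of _ "lists (carrier V)"]
  show ?thesis unfolding Sym_def sym_rel_def Let_def
  proof (rule module_quotient[OF F.module_axioms], rule submodule_spanI[OF F.module_axioms], goal_cases)
    case 1 show ?case 
      by (intro Un_least subsetI; elim CollectE exE conjE; simp add: bc F.M.minus_closed)
  qed
qed

lemma module_tensor: assumes k: "cring k" and V: "module k V" and W: "module k W"
  shows "module k (tensor k V W)"
proof -
  interpret V: module k V by fact
  interpret W: module k W by fact
  interpret F: module k "free_module k (carrier V \<times> carrier W)" by (rule module_free[OF k])
  note bc = basis_vec_closed[OF k, of _ "carrier V \<times> carrier W"]
  show ?thesis unfolding tensor_def tensor_rel_def Let_def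
  proof (rule module_quotient[OF F.module_axioms], rule submodule_spanI[OF F.module_axioms], goal_cases)
    case 1 show ?case 
      by (intro Un_least subsetI; elim CollectE exE conjE; simp add: bc F.M.minus_closed)
  qed
qed

lemma module_bang: "cring k \<Longrightarrow> module k V \<Longrightarrow> module k (bang k V)"
  unfolding bang_def by (intro module_copies module_Sym)

lemma summand_incl_linear:
  assumes M: "module k M" and i: "i \<in> I"
  shows "(\<lambda>x\<in>carrier M. summand_incl M i x) \<in> linear_maps k M (copies I M)"
proof -
  interpret module k M by fact
  have "summand_incl M i x \<in> carrier (copies I M)" if "x \<in> carrier M" for x
  proof -
    have "finite {j. summand_incl M i x j \<noteq> \<zero>\<^bsub>M\<^esub>}"
      by (rule finite_subset[of _ "{i}"]) (auto simp: summand_incl_def)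
    then show ?thesis using that i by (auto simp: copies_def summand_incl_def)
  qed
  then show ?thesis
    by (intro linear_mapsI) (auto simp: copies_def summand_incl_def)
qed

lemma bang_lift_ex1:
  assumes k: "cring k" and V: "module k V" and N: "module k N"
  and g: "\<And>P xs. P \<in> carrier V \<Longrightarrow> xs \<in> lists (carrier V) \<Longrightarrow> g P xs \<in> carrier N"
   "\<And>P xs ys v w. P \<in> carrier V \<Longrightarrow> xs \<in> lists (carrier V) \<Longrightarrow> ys \<in> lists (carrier V) \<Longrightarrow> v \<in> carrier V \<Longrightarrow> w \<in> carrier V \<Longrightarrow>
     g P (xs @ (v \<oplus>\<^bsub>V\<^esub> w) # ys) = g P (xs @ v # ys) \<oplus>\<^bsub>N\<^esub> g P (xs @ w # ys)"
   "\<And>P xs ys v c. P \<in> carrier V \<Longrightarrow> xs \<in> lists (carrier V) \<Longrightarrow> ys \<in> lists (carrier V) \<Longrightarrow> v \<in> carrier V \<Longrightarrow> c \<in> carrier k \<Longrightarrow>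
     g P (xs @ (c \<odot>\<^bsub>V\<^esub> v) # ys) = c \<odot>\<^bsub>N\<^esub> g P (xs @ v # ys)"
   "\<And>P xs ys v w. P \<in> carrier V \<Longrightarrow> xs \<in> lists (carrier V) \<Longrightarrow> ys \<in> lists (carrier V) \<Longrightarrow> v \<in> carrier V \<Longrightarrow> w \<in> carrier V \<Longrightarrow>
     g P (xs @ v # w # ys) = g P (xs @ w # v # ys)"
  shows "\<exists>!f. f \<in> linear_maps k (bang k V) N \<and>
     (\<forall>P\<in>carrier V. \<forall>\<nu>s\<in>lists (carrier V). f (ket k V P \<nu>s) = g P \<nu>s)"
proof -
  note S = module_Sym[OF k V]
  have ex1: "\<exists>!f. f \<in> linear_maps k (Sym k V) N \<and> (\<forall>xs\<in>lists (carrier V). f (sym_word k V xs) = g P xs)"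
    if P: "P \<in> carrier V" for P
    by (rule Sym_ex1[where g = "g P", OF k V N g(1)[OF P] g(2)[OF P] g(3)[OF P] g(4)[OF P]])
  have sw: "sym_word k V xs \<in> carrier (Sym k V)" if "xs \<in> lists (carrier V)" for xs
  proof -
    interpret V: module k V by fact
    interpret F: module k "free_module k (lists (carrier V))" by (rule module_free[OF k])
    note bc = basis_vec_closed[OF k, of _ "lists (carrier V)"]
    show ?thesis unfolding Sym_def sym_word_def sym_rel_def Let_def
    proof (rule coset_carrier[OF F.module_axioms], rule submodule_spanI[OF F.module_axioms], goal_cases)
      case 1 show ?case 
        by (intro Un_least subsetI; elim CollectE exE conjE; simp add: bc F.M.minus_closed)
    qed (rule bc[OF that])
  qed
  define s where "s P = (THE f. f \<in> linear_maps k (Sym k V) N \<and> (\<forall>xs\<in>lists (carrier V). f (sym_word k V xs) = g P xs))" for P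
  have s: "s P \<in> linear_maps k (Sym k V) N" "\<forall>xs\<in>lists (carrier V). s P (sym_word k V xs) = g P xs"
    if "P \<in> carrier V" for P
    using theI'[OF ex1[OF that], folded s_def] by (rule conjunct1) (rule conjunct2[OF theI'[OF ex1[OF that], folded s_def]])
  show ?thesis
  proof (rule ex_ex1I)
    have "\<exists>f. f \<in> linear_maps k (copies (carrier V) (Sym k V)) N \<and>
      (\<forall>P\<in>carrier V. \<forall>x\<in>carrier (Sym k V). f (summand_incl (Sym k V) P x) = s P x)"
      by (rule copies_lift[OF S N s(1)])
    then obtain f where f: "f \<in> linear_maps k (copies (carrier V) (Sym k V)) N \<and>
      (\<forall>P\<in>carrier V. \<forall>x\<in>carrier (Sym k V). f (summand_incl (Sym k V) P x) = s P x)" by (rule exE)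
    show "\<exists>f. f \<in> linear_maps k (bang k V) N \<and>
     (\<forall>P\<in>carrier V. \<forall>\<nu>s\<in>lists (carrier V). f (ket k V P \<nu>s) = g P \<nu>s)"
    proof (rule exI[of _ f], intro conjI ballI)
      show "f \<in> linear_maps k (bang k V) N" using f by (simp add: bang_def)
      fix P xs assume P: "P \<in> carrier V" and xs: "xs \<in> lists (carrier V)"
      have "f (ket k V P xs) = s P (sym_word k V xs)"
        unfolding ket_def using conjunct2[OF f, rule_format, OF P sw[OF xs]] .
      then show "f (ket k V P xs) = g P xs" using s(2)[OF P, rule_format, OF xs] by (rule trans)
    qed
  next
    fix f f' assume f: "f \<in> linear_maps k (bang k V) N \<and>
     (\<forall>P\<in>carrier V. \<forall>\<nu>s\<in>lists (carrier V). f (ket k V P \<nu>s) = g P \<nu>s)"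
     and f': "f' \<in> linear_maps k (bang k V) N \<and>
     (\<forall>P\<in>carrier V. \<forall>\<nu>s\<in>lists (carrier V). f' (ket k V P \<nu>s) = g P \<nu>s)"
    show "f = f'"
    proof (rule copies_ext[OF S N, of _ "carrier V"])
      fix P x assume P: "P \<in> carrier V" and x: "x \<in> carrier (Sym k V)"
      let ?i = "\<lambda>x\<in>carrier (Sym k V). summand_incl (Sym k V) P x"
      note i = summand_incl_linear[OF S P]
      have *: "compose (carrier (Sym k V)) h ?i = s P" if "h \<in> linear_maps k (bang k V) N \<and>
        (\<forall>P\<in>carrier V. \<forall>\<nu>s\<in>lists (carrier V). h (ket k V P \<nu>s) = g P \<nu>s)" for h
      proof -
        have "compose (carrier (Sym k V)) h ?i \<in> linear_maps k (Sym k V) N \<and>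
          (\<forall>xs\<in>lists (carrier V). compose (carrier (Sym k V)) h ?i (sym_word k V xs) = g P xs)"
        proof
          show "compose (carrier (Sym k V)) h ?i \<in> linear_maps k (Sym k V) N"
            by (rule linear_maps_comp[OF i _ S]) (use that in \<open>simp add: bang_def\<close>)
          show "\<forall>xs\<in>lists (carrier V). compose (carrier (Sym k V)) h ?i (sym_word k V xs) = g P xs"
          proof
            fix xs assume xs: "xs \<in> lists (carrier V)"
            have "h (ket k V P xs) = g P xs" using that P xs by simp
            then show "compose (carrier (Sym k V)) h ?i (sym_word k V xs) = g P xs"
              by (simp add: compose_def sw[OF xs] ket_def)
          qed
        qed
        then show ?thesis unfolding s_def by (rule the1_equality[OF ex1[OF P], symmetric])
      qed
      show "f (summand_incl (Sym k V) P x) = f' (summand_incl (Sym k V) P x)"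
        using fun_cong[OF trans[OF *[OF f] *[OF f', symmetric]], of x] x by (simp add: compose_def)
    qed (use f f' in \<open>simp_all add: bang_def\<close>)
  qed
qed

lemma bang_lift:
  assumes "cring k" and "module k V" and "module k N"
  and "\<And>P xs. P \<in> carrier V \<Longrightarrow> xs \<in> lists (carrier V) \<Longrightarrow> g P xs \<in> carrier N"
   "\<And>P xs ys v w. P \<in> carrier V \<Longrightarrow> xs \<in> lists (carrier V) \<Longrightarrow> ys \<in> lists (carrier V) \<Longrightarrow> v \<in> carrier V \<Longrightarrow> w \<in> carrier V \<Longrightarrow>
     g P (xs @ (v \<oplus>\<^bsub>V\<^esub> w) # ys) = g P (xs @ v # ys) \<oplus>\<^bsub>N\<^esub> g P (xs @ w # ys)"
   "\<And>P xs ys v c. P \<in> carrier V \<Longrightarrow> xs \<in> lists (carrier V) \<Longrightarrow> ys \<in> lists (carrier V) \<Longrightarrow> v \<in> carrier V \<Longrightarrow> c \<in> carrier k \<Longrightarrow>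
     g P (xs @ (c \<odot>\<^bsub>V\<^esub> v) # ys) = c \<odot>\<^bsub>N\<^esub> g P (xs @ v # ys)"
   "\<And>P xs ys v w. P \<in> carrier V \<Longrightarrow> xs \<in> lists (carrier V) \<Longrightarrow> ys \<in> lists (carrier V) \<Longrightarrow> v \<in> carrier V \<Longrightarrow> w \<in> carrier V \<Longrightarrow>
     g P (xs @ v # w # ys) = g P (xs @ w # v # ys)"
  shows "bang_lift k V N g \<in> linear_maps k (bang k V) N \<and>
     (\<forall>P\<in>carrier V. \<forall>\<nu>s\<in>lists (carrier V). bang_lift k V N g (ket k V P \<nu>s) = g P \<nu>s)"
  unfolding bang_lift_def by (rule theI'[OF bang_lift_ex1[OF assms]])

end

theory Submission
  imports Defs
begin

text \<open>
  All maps are linear, so every identity is checked on the elements \<open>|\<nu>\<^sub>1, \<dots>, \<nu>\<^sub>s\<rangle>\<^sub>P \<otimes> \<nu>\<close>, where it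
  becomes combinatorial. A subset of \<open>{\<nu>, \<nu>\<^sub>1, \<dots>, \<nu>\<^sub>s}\<close> either contains \<open>\<nu>\<close> or its complement does: this is
  (D.2). A set partition of \<open>{\<nu>, \<nu>\<^sub>1, \<dots>, \<nu>\<^sub>s}\<close> is the choice of the block \<open>{\<nu>} \<union> I\<^sup>c\<close> of \<open>\<nu>\<close> together with a
  partition of \<open>I\<close>: this is (D.4). The same two recursions show that the defining formulas of
  \<open>\<Delta>\<close> and \<open>\<delta>\<close> are multilinear and symmetric in \<open>\<nu>\<^sub>1, \<dots>, \<nu>\<^sub>s\<close>, i.e. that these maps exist.
\<close>

section \<open>Linear maps and tensor products\<close>

text \<open>Each structure map is a definite description, so its values are known only once the
  prescribed formula has been shown to be multilinear and symmetric. The obstacle lies in the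
  formulas: they run over subsets and partitions of \<open>{..<s}\<close>, and putting \<nu> in
  front of the word renumbers every letter. They are therefore rewritten as \<open>split_sum\<close>
  and \<open>part_sum\<close>, which recurse on the word and mention no index. The conversion is
  made once, with an arbitrary finite ordered set in place of \<open>{..<s}\<close>, so that
  removing its least element takes the place of renumbering. After that the product rule for
  \<Delta> and the chain rule for \<delta> each come from unfolding one recursion step. The price is
  symmetry: \<open>part_sum\<close> treats the first letter specially, so exchanging the first two
  letters needs an argument of its own, an exchange of two parts in a splitting into three.\<close>

definition linear_on :: "'k ring \<Rightarrow> ('k, 'v) module \<Rightarrow> ('k, 'w) module \<Rightarrow> ('v \<Rightarrow> 'w) \<Rightarrow> bool" where
  "linear_on k V W f \<longleftrightarrow> (\<forall>x\<in>carrier V. f x \<in> carrier W) \<and>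
     (\<forall>x\<in>carrier V. \<forall>y\<in>carrier V. f (x \<oplus>\<^bsub>V\<^esub> y) = f x \<oplus>\<^bsub>W\<^esub> f y) \<and>
     (\<forall>c\<in>carrier k. \<forall>x\<in>carrier V. f (c \<odot>\<^bsub>V\<^esub> x) = c \<odot>\<^bsub>W\<^esub> f x)"

lemma linear_onI:
  assumes "\<And>x. x \<in> carrier V \<Longrightarrow> f x \<in> carrier W"
    and "\<And>x y. x \<in> carrier V \<Longrightarrow> y \<in> carrier V \<Longrightarrow> f (x \<oplus>\<^bsub>V\<^esub> y) = f x \<oplus>\<^bsub>W\<^esub> f y"
    and "\<And>c x. c \<in> carrier k \<Longrightarrow> x \<in> carrier V \<Longrightarrow> f (c \<odot>\<^bsub>V\<^esub> x) = c \<odot>\<^bsub>W\<^esub> f x"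
  shows "linear_on k V W f"
  using assms by (simp add: linear_on_def)

lemma linear_onD:
  assumes "linear_on k V W f"
  shows "x \<in> carrier V \<Longrightarrow> f x \<in> carrier W"
    and "x \<in> carrier V \<Longrightarrow> y \<in> carrier V \<Longrightarrow> f (x \<oplus>\<^bsub>V\<^esub> y) = f x \<oplus>\<^bsub>W\<^esub> f y"
    and "c \<in> carrier k \<Longrightarrow> x \<in> carrier V \<Longrightarrow> f (c \<odot>\<^bsub>V\<^esub> x) = c \<odot>\<^bsub>W\<^esub> f x"
  using assms by (simp_all add: linear_on_def)

lemma linear_on_linear_maps: "f \<in> linear_maps k V W \<Longrightarrow> linear_on k V W f"
  by (rule linear_onI; erule linear_mapsD; assumption)

lemma linear_on_cong:
  assumes "linear_on k V W f" and "module k V" and "\<And>x. x \<in> carrier V \<Longrightarrow> g x = f x"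
  shows "linear_on k V W g"
proof -
  interpret module k V by fact
  show ?thesis
    by (rule linear_onI) (simp_all add: assms(3) linear_onD[OF assms(1)])
qed

text \<open>\<open>linear_maps\<close> contains only extensional functions, and a composite or a sum
  written as a lambda term is in general not one. The reasoning is done with
  \<open>linear_on\<close>, which ignores values outside the carrier; restriction leads back
  wherever membership in \<open>linear_maps\<close> is required, notably for uniqueness.\<close>

lemma restrict_linear_maps:
  assumes "linear_on k V W f" and "module k V"
  shows "restrict f (carrier V) \<in> linear_maps k V W"
proof -
  interpret module k V by fact
  show ?thesis
    by (rule linear_mapsI) (simp_all add: linear_onD[OF assms(1)])
qed

lemma linear_on_zero:
  assumes "linear_on k V W f" and "module k V" and "module k W"
  shows "f \<zero>\<^bsub>V\<^esub> = \<zero>\<^bsub>W\<^esub>"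
proof -
  interpret V: module k V by fact
  show ?thesis
    using linear_map_arith(1)[OF assms(2,3) restrict_linear_maps[OF assms(1,2)]] by simp
qed

lemma linear_on_ident: "module k V \<Longrightarrow> linear_on k V V (\<lambda>x. x)"
  by (simp add: linear_on_def)

lemma linear_on_const_zero:
  assumes "module k W" shows "linear_on k V W (\<lambda>_. \<zero>\<^bsub>W\<^esub>)"
proof -
  interpret module k W by fact
  show ?thesis by (rule linear_onI) simp_all
qed

lemma linear_on_comp:
  assumes "linear_on k U V f" and "linear_on k V W g"
  shows "linear_on k U W (\<lambda>x. g (f x))"
  by (rule linear_onI) (simp_all add: linear_onD[OF assms(1)] linear_onD[OF assms(2)])

lemma linear_on_add:
  assumes "linear_on k V W f" and "linear_on k V W g" and "module k W"
  shows "linear_on k V W (\<lambda>x. f x \<oplus>\<^bsub>W\<^esub> g x)"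
proof -
  interpret module k W by fact
  show ?thesis
    by (rule linear_onI)
      (simp_all add: linear_onD[OF assms(1)] linear_onD[OF assms(2)] smult_r_distr M.add.m_ac)
qed

lemma linear_on_smult:
  assumes "linear_on k V W f" and "module k W" and c: "c \<in> carrier k"
  shows "linear_on k V W (\<lambda>x. c \<odot>\<^bsub>W\<^esub> f x)"
proof -
  interpret module k W by fact
  show ?thesis
    by (rule linear_onI)
      (simp_all add: linear_onD[OF assms(1)] smult_r_distr smult_assoc1[symmetric] R.m_comm c)
qed

text \<open>The universal property concerns maps out of the tensor product; this is the other half,
  bilinearity of the pure tensor itself. Each bilinearity law is one of the generators of
  \<open>tensor_rel\<close>, listed here as \<open>R\<close>, and \<open>coset_eq\<close> turns
  membership of a difference in \<open>tensor_rel\<close> into equality of cosets.\<close>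

lemma pure_tensor_closed_linear:
  assumes k: "cring k" and V: "module k V" and W: "module k W"
  shows pure_tensor_closed: "v \<in> carrier V \<Longrightarrow> w \<in> carrier W \<Longrightarrow> pure_tensor k V W v w \<in> carrier (tensor k V W)"
    and pure_tensor_linear1: "w \<in> carrier W \<Longrightarrow> linear_on k V (tensor k V W) (\<lambda>v. pure_tensor k V W v w)"
    and pure_tensor_linear2: "v \<in> carrier V \<Longrightarrow> linear_on k W (tensor k V W) (\<lambda>w. pure_tensor k V W v w)"
proof -
  interpret V: module k V by fact
  interpret W: module k W by fact
  let ?I = "carrier V \<times> carrier W"
  let ?F = "free_module k ?I"
  interpret F: module k ?F by (rule module_free[OF k])
  note bc = basis_vec_closed[OF k, of _ ?I]
  define R where "R = ({basis_vec k (v \<oplus>\<^bsub>V\<^esub> v', w) \<ominus>\<^bsub>?F\<^esub> (basis_vec k (v, w) \<oplus>\<^bsub>?F\<^esub> basis_vec k (v', w)) | v v' w.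
           v \<in> carrier V \<and> v' \<in> carrier V \<and> w \<in> carrier W} \<union>
        {basis_vec k (v, w \<oplus>\<^bsub>W\<^esub> w') \<ominus>\<^bsub>?F\<^esub> (basis_vec k (v, w) \<oplus>\<^bsub>?F\<^esub> basis_vec k (v, w')) | v w w'.
           v \<in> carrier V \<and> w \<in> carrier W \<and> w' \<in> carrier W} \<union>
        {basis_vec k (c \<odot>\<^bsub>V\<^esub> v, w) \<ominus>\<^bsub>?F\<^esub> (c \<odot>\<^bsub>?F\<^esub> basis_vec k (v, w)) | c v w.
           c \<in> carrier k \<and> v \<in> carrier V \<and> w \<in> carrier W} \<union>
        {basis_vec k (v, c \<odot>\<^bsub>W\<^esub> w) \<ominus>\<^bsub>?F\<^esub> (c \<odot>\<^bsub>?F\<^esub> basis_vec k (v, w)) | c v w.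
           c \<in> carrier k \<and> v \<in> carrier V \<and> w \<in> carrier W})"
  have rel: "tensor_rel k V W = submodule_span k ?F R"
    unfolding tensor_rel_def Let_def R_def ..
  have R: "R \<subseteq> carrier ?F" unfolding R_def
    by (intro Un_least subsetI; elim CollectE exE conjE; simp add: bc F.M.minus_closed)
  have H: "submodule (tensor_rel k V W) k ?F" "R \<subseteq> tensor_rel k V W"
    unfolding rel using submodule_spanI[OF F.module_axioms R] by auto
  note ca = coset_add[OF F.module_axioms H(1)] and cs = coset_smult[OF F.module_axioms H(1)]
    and ce = coset_eq[OF F.module_axioms H(1), THEN iffD2]
  show cl: "pure_tensor k V W v w \<in> carrier (tensor k V W)" if "v \<in> carrier V" "w \<in> carrier W" for v w
    unfolding tensor_def pure_tensor_def by (rule coset_carrier[OF F.module_axioms H(1)]) (simp add: bc that)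
  show "linear_on k V (tensor k V W) (\<lambda>v. pure_tensor k V W v w)" if w: "w \<in> carrier W" for w
  proof (rule linear_onI)
    fix x y assume xy: "x \<in> carrier V" "y \<in> carrier V"
    have "basis_vec k (x \<oplus>\<^bsub>V\<^esub> y, w) \<ominus>\<^bsub>?F\<^esub> (basis_vec k (x, w) \<oplus>\<^bsub>?F\<^esub> basis_vec k (y, w)) \<in> R"
      unfolding R_def using xy w by blast
    then show "pure_tensor k V W (x \<oplus>\<^bsub>V\<^esub> y) w = pure_tensor k V W x w \<oplus>\<^bsub>tensor k V W\<^esub> pure_tensor k V W y w"
      unfolding tensor_def pure_tensor_def using H(2) xy w by (simp add: ca bc ce subset_iff)
  next
    fix c x assume xy: "x \<in> carrier V" "c \<in> carrier k"
    have "basis_vec k (c \<odot>\<^bsub>V\<^esub> x, w) \<ominus>\<^bsub>?F\<^esub> (c \<odot>\<^bsub>?F\<^esub> basis_vec k (x, w)) \<in> R"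
      unfolding R_def using xy w by blast
    then show "pure_tensor k V W (c \<odot>\<^bsub>V\<^esub> x) w = c \<odot>\<^bsub>tensor k V W\<^esub> pure_tensor k V W x w"
      unfolding tensor_def pure_tensor_def using H(2) xy w by (simp add: cs bc ce subset_iff)
  qed (simp add: cl w)
  show "linear_on k W (tensor k V W) (\<lambda>w. pure_tensor k V W v w)" if v: "v \<in> carrier V" for v
  proof (rule linear_onI)
    fix x y assume xy: "x \<in> carrier W" "y \<in> carrier W"
    have "basis_vec k (v, x \<oplus>\<^bsub>W\<^esub> y) \<ominus>\<^bsub>?F\<^esub> (basis_vec k (v, x) \<oplus>\<^bsub>?F\<^esub> basis_vec k (v, y)) \<in> R"
      unfolding R_def using xy v by blast
    then show "pure_tensor k V W v (x \<oplus>\<^bsub>W\<^esub> y) = pure_tensor k V W v x \<oplus>\<^bsub>tensor k V W\<^esub> pure_tensor k V W v y"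
      unfolding tensor_def pure_tensor_def using H(2) xy v by (simp add: ca bc ce subset_iff)
  next
    fix c x assume xy: "x \<in> carrier W" "c \<in> carrier k"
    have "basis_vec k (v, c \<odot>\<^bsub>W\<^esub> x) \<ominus>\<^bsub>?F\<^esub> (c \<odot>\<^bsub>?F\<^esub> basis_vec k (v, x)) \<in> R"
      unfolding R_def using xy v by blast
    then show "pure_tensor k V W v (c \<odot>\<^bsub>W\<^esub> x) = c \<odot>\<^bsub>tensor k V W\<^esub> pure_tensor k V W v x"
      unfolding tensor_def pure_tensor_def using H(2) xy v by (simp add: cs bc ce subset_iff)
  qed (simp add: cl v)
qed

lemma tensor_lift_bilinear:
  assumes "cring k" "module k V" "module k W" "module k N"
    and "\<And>w. w \<in> carrier W \<Longrightarrow> linear_on k V N (\<lambda>v. b v w)"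
    and "\<And>v. v \<in> carrier V \<Longrightarrow> linear_on k W N (b v)"
  shows tensor_lift_linear: "linear_on k (tensor k V W) N (tensor_lift k V W N b)"
    and tensor_lift_pure: "v \<in> carrier V \<Longrightarrow> w \<in> carrier W \<Longrightarrow>
      tensor_lift k V W N b (pure_tensor k V W v w) = b v w"
proof -
  have "tensor_lift k V W N b \<in> linear_maps k (tensor k V W) N \<and>
     (\<forall>v\<in>carrier V. \<forall>w\<in>carrier W. tensor_lift k V W N b (pure_tensor k V W v w) = b v w)"
    by (rule tensor_lift[OF assms(1-4)]) (simp_all add: linear_onD[OF assms(5)] linear_onD[OF assms(6)])
  then show "linear_on k (tensor k V W) N (tensor_lift k V W N b)"
    and "v \<in> carrier V \<Longrightarrow> w \<in> carrier W \<Longrightarrow>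
      tensor_lift k V W N b (pure_tensor k V W v w) = b v w"
    by (simp_all add: linear_on_linear_maps)
qed

lemma ex1_unique: "\<exists>!x. Q x \<Longrightarrow> Q a \<Longrightarrow> Q b \<Longrightarrow> a = b"
  by blast

text \<open>No spanning argument is needed: sending \<open>v\<close>, \<open>w\<close> to the value
  of \<open>f\<close> at their pure tensor is bilinear, and by \<open>tensor_lift_ex1\<close>
  exactly one extensional linear map induces it. The restrictions of \<open>f\<close> and
  \<open>g\<close> both do, so they coincide.\<close>

lemma tensor_ext:
  assumes k: "cring k" and V: "module k V" and W: "module k W" and N: "module k N"
    and f: "linear_on k (tensor k V W) N f" and g: "linear_on k (tensor k V W) N g"
    and eq: "\<And>v w. v \<in> carrier V \<Longrightarrow> w \<in> carrier W \<Longrightarrow> f (pure_tensor k V W v w) = g (pure_tensor k V W v w)"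
    and t: "t \<in> carrier (tensor k V W)"
  shows "f t = g t"
proof -
  let ?T = "tensor k V W"
  note T = module_tensor[OF k V W]
  note p1 = linear_onD[OF pure_tensor_linear1[OF k V W]] and p2 = linear_onD[OF pure_tensor_linear2[OF k V W]]
  have ex1: "\<exists>!h. h \<in> linear_maps k ?T N \<and>
     (\<forall>v\<in>carrier V. \<forall>w\<in>carrier W. h (pure_tensor k V W v w) = f (pure_tensor k V W v w))"
    by (rule tensor_lift_ex1[OF k V W N])
      (simp_all add: linear_onD[OF f] p1 p2 pure_tensor_closed[OF k V W])
  have "restrict f (carrier ?T) = restrict g (carrier ?T)"
    using restrict_linear_maps[OF f T] restrict_linear_maps[OF g T]
    by (intro ex1_unique[OF ex1]) (simp_all add: pure_tensor_closed[OF k V W] eq)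
  then show ?thesis using t by (metis restrict_apply')
qed

section \<open>Induced maps, swap, associators and scalar action on pure tensors\<close>

lemma tensor_map_linear_pure:
  assumes k: "cring k" "module k V" "module k W" "module k V'" "module k W'"
    and f: "linear_on k V V' f" and g: "linear_on k W W' g"
  shows tensor_map_linear: "linear_on k (tensor k V W) (tensor k V' W') (tensor_map k V W V' W' f g)"
    and tensor_map_pure: "v \<in> carrier V \<Longrightarrow> w \<in> carrier W \<Longrightarrow>
      tensor_map k V W V' W' f g (pure_tensor k V W v w) = pure_tensor k V' W' (f v) (g w)"
proof -
  have 1: "linear_on k V (tensor k V' W') (\<lambda>v. pure_tensor k V' W' (f v) (g w))" if "w \<in> carrier W" for w
    by (rule linear_on_comp[OF f pure_tensor_linear1[OF k(1,4,5)]]) (rule linear_onD(1)[OF g that])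
  have 2: "linear_on k W (tensor k V' W') (\<lambda>w. pure_tensor k V' W' (f v) (g w))" if "v \<in> carrier V" for v
    by (rule linear_on_comp[OF g pure_tensor_linear2[OF k(1,4,5)]]) (rule linear_onD(1)[OF f that])
  note T = module_tensor[OF k(1,4,5)]
  show "linear_on k (tensor k V W) (tensor k V' W') (tensor_map k V W V' W' f g)"
    unfolding tensor_map_def by (rule tensor_lift_linear[OF k(1-3) T 1 2])
  show "v \<in> carrier V \<Longrightarrow> w \<in> carrier W \<Longrightarrow>
      tensor_map k V W V' W' f g (pure_tensor k V W v w) = pure_tensor k V' W' (f v) (g w)"
    unfolding tensor_map_def by (rule tensor_lift_pure[OF k(1-3) T 1 2])
qed

lemma tensor_swap_linear_pure:
  assumes k: "cring k" "module k V" "module k W"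
  shows tensor_swap_linear: "linear_on k (tensor k V W) (tensor k W V) (tensor_swap k V W)"
    and tensor_swap_pure: "v \<in> carrier V \<Longrightarrow> w \<in> carrier W \<Longrightarrow>
      tensor_swap k V W (pure_tensor k V W v w) = pure_tensor k W V w v"
  unfolding tensor_swap_def
  by (rule tensor_lift_linear tensor_lift_pure;
    simp add: k module_tensor pure_tensor_linear1 pure_tensor_linear2)+

text \<open>The associators are lifts whose values are again lifts. For the outer lift to exist, the
  inner one must depend linearly on the remaining variable \<open>w\<close>; by
  \<open>tensor_ext\<close> this can be tested on pure tensors, where it is linearity of
  \<open>b\<close> in \<open>w\<close>.\<close>

lemma tensor_lift_param_linear:
  assumes k: "cring k" "module k U" "module k V" "module k W" and N: "module k N"
    and b: "\<And>u v. u \<in> carrier U \<Longrightarrow> v \<in> carrier V \<Longrightarrow> linear_on k W N (\<lambda>w. b w u v)"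
      "\<And>v w. v \<in> carrier V \<Longrightarrow> w \<in> carrier W \<Longrightarrow> linear_on k U N (\<lambda>u. b w u v)"
      "\<And>u w. u \<in> carrier U \<Longrightarrow> w \<in> carrier W \<Longrightarrow> linear_on k V N (b w u)"
    and t: "t \<in> carrier (tensor k U V)"
  shows "linear_on k W N (\<lambda>w. tensor_lift k U V N (b w) t)"
proof -
  interpret W: module k W by fact
  have lin: "linear_on k (tensor k U V) N (tensor_lift k U V N (b w))" if "w \<in> carrier W" for w
    by (rule tensor_lift_linear[OF k(1-3) N b(2,3)]) (rule that | assumption)+
  have pure: "tensor_lift k U V N (b w) (pure_tensor k U V u v) = b w u v"
    if "u \<in> carrier U" "v \<in> carrier V" "w \<in> carrier W" for u v w
    by (rule tensor_lift_pure[OF k(1-3) N b(2,3)]) (rule that | assumption)+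
  show ?thesis
  proof (rule linear_onI)
    fix x assume "x \<in> carrier W"
    then show "tensor_lift k U V N (b x) t \<in> carrier N" by (rule linear_onD(1)[OF lin _ ]) (rule t)
  next
    fix x y assume xy: "x \<in> carrier W" "y \<in> carrier W"
    show "tensor_lift k U V N (b (x \<oplus>\<^bsub>W\<^esub> y)) t =
      tensor_lift k U V N (b x) t \<oplus>\<^bsub>N\<^esub> tensor_lift k U V N (b y) t"
      by (rule tensor_ext[OF k(1-3) N lin linear_on_add[OF lin lin N] _ t])
        (simp_all add: xy pure linear_onD(2)[OF b(1)])
  next
    fix c x assume xy: "c \<in> carrier k" "x \<in> carrier W"
    show "tensor_lift k U V N (b (c \<odot>\<^bsub>W\<^esub> x)) t = c \<odot>\<^bsub>N\<^esub> tensor_lift k U V N (b x) t"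
      by (rule tensor_ext[OF k(1-3) N lin linear_on_smult[OF lin N] _ t])
        (simp_all add: xy pure linear_onD(3)[OF b(1)])
  qed
qed

lemma tensor_assoc_linear_pure:
  assumes k: "cring k" "module k U" "module k V" "module k W"
  shows tensor_assoc_linear: "linear_on k (tensor k (tensor k U V) W) (tensor k U (tensor k V W)) (tensor_assoc k U V W)"
    and tensor_assoc_pure: "u \<in> carrier U \<Longrightarrow> v \<in> carrier V \<Longrightarrow> w \<in> carrier W \<Longrightarrow>
      tensor_assoc k U V W (pure_tensor k (tensor k U V) W (pure_tensor k U V u v) w) =
      pure_tensor k U (tensor k V W) u (pure_tensor k V W v w)"
proof -
  let ?N = "tensor k U (tensor k V W)"
  \<comment> \<open>The parameter comes first, so that \<open>?b w\<close> is the bilinear map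
    lifted for fixed \<open>w\<close>, as in \<open>tensor_lift_param_linear\<close>.\<close>
  let ?b = "\<lambda>w u v. pure_tensor k U (tensor k V W) u (pure_tensor k V W v w)"
  note VW = module_tensor[OF k(1,3,4)] and UV = module_tensor[OF k(1,2,3)]
  note N = module_tensor[OF k(1,2) VW]
  have b1: "linear_on k U ?N (\<lambda>u. ?b w u v)" if "v \<in> carrier V" "w \<in> carrier W" for v w
    by (rule pure_tensor_linear1[OF k(1,2) VW pure_tensor_closed[OF k(1,3,4) that]])
  have b2: "linear_on k V ?N (?b w u)" if "u \<in> carrier U" "w \<in> carrier W" for u w
    by (rule linear_on_comp[OF pure_tensor_linear1[OF k(1,3,4) that(2)] pure_tensor_linear2[OF k(1,2) VW that(1)]])
  have b3: "linear_on k W ?N (\<lambda>w. ?b w u v)" if "u \<in> carrier U" "v \<in> carrier V" for u v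
    by (rule linear_on_comp[OF pure_tensor_linear2[OF k(1,3,4) that(2)] pure_tensor_linear2[OF k(1,2) VW that(1)]])
  have lin1: "linear_on k (tensor k U V) ?N (tensor_lift k U V ?N (?b w))" if "w \<in> carrier W" for w
    by (rule tensor_lift_linear[OF k(1-3) N b1 b2]) (rule that | assumption)+
  have lin2: "linear_on k W ?N (\<lambda>w. tensor_lift k U V ?N (?b w) t)" if "t \<in> carrier (tensor k U V)" for t
    by (rule tensor_lift_param_linear[OF k N b3 b1 b2 that])
  show "linear_on k (tensor k (tensor k U V) W) ?N (tensor_assoc k U V W)"
    unfolding tensor_assoc_def by (rule tensor_lift_linear[OF k(1) UV k(4) N lin1 lin2])
  show "tensor_assoc k U V W (pure_tensor k (tensor k U V) W (pure_tensor k U V u v) w) = ?b w u v"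
    if "u \<in> carrier U" "v \<in> carrier V" "w \<in> carrier W"
  proof -
    have "tensor_assoc k U V W (pure_tensor k (tensor k U V) W (pure_tensor k U V u v) w) =
        tensor_lift k U V ?N (?b w) (pure_tensor k U V u v)"
      unfolding tensor_assoc_def
      by (rule tensor_lift_pure[OF k(1) UV k(4) N lin1 lin2 pure_tensor_closed[OF k(1-3) that(1,2)] that(3)])
    also have "\<dots> = ?b w u v"
      by (rule tensor_lift_pure[OF k(1-3) N b1 b2 that(1,2)]) (rule that | assumption)+
    finally show ?thesis .
  qed
qed

lemma tensor_assoc_inv_linear_pure:
  assumes k: "cring k" "module k U" "module k V" "module k W"
  shows tensor_assoc_inv_linear: "linear_on k (tensor k U (tensor k V W)) (tensor k (tensor k U V) W) (tensor_assoc_inv k U V W)"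
    and tensor_assoc_inv_pure: "u \<in> carrier U \<Longrightarrow> v \<in> carrier V \<Longrightarrow> w \<in> carrier W \<Longrightarrow>
      tensor_assoc_inv k U V W (pure_tensor k U (tensor k V W) u (pure_tensor k V W v w)) =
      pure_tensor k (tensor k U V) W (pure_tensor k U V u v) w"
proof -
  let ?N = "tensor k (tensor k U V) W"
  let ?b = "\<lambda>u v w. pure_tensor k (tensor k U V) W (pure_tensor k U V u v) w"
  note VW = module_tensor[OF k(1,3,4)] and UV = module_tensor[OF k(1,2,3)]
  note N = module_tensor[OF k(1) UV k(4)]
  have b1: "linear_on k U ?N (\<lambda>u. ?b u v w)" if "v \<in> carrier V" "w \<in> carrier W" for v w
    by (rule linear_on_comp[OF pure_tensor_linear1[OF k(1-3) that(1)] pure_tensor_linear1[OF k(1) UV k(4) that(2)]])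
  have b2: "linear_on k V ?N (\<lambda>v. ?b u v w)" if "w \<in> carrier W" "u \<in> carrier U" for u w
    by (rule linear_on_comp[OF pure_tensor_linear2[OF k(1-3) that(2)] pure_tensor_linear1[OF k(1) UV k(4) that(1)]])
  have b3: "linear_on k W ?N (?b u v)" if "v \<in> carrier V" "u \<in> carrier U" for u v
    by (rule pure_tensor_linear2[OF k(1) UV k(4) pure_tensor_closed[OF k(1-3) that(2,1)]])
  have lin1: "linear_on k (tensor k V W) ?N (tensor_lift k V W ?N (?b u))" if "u \<in> carrier U" for u
    by (rule tensor_lift_linear[OF k(1,3,4) N b2 b3]) (rule that | assumption)+
  have lin2: "linear_on k U ?N (\<lambda>u. tensor_lift k V W ?N (?b u) t)" if "t \<in> carrier (tensor k V W)" for t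
    by (rule tensor_lift_param_linear[OF k(1,3,4,2) N b1 b2 b3 that])
  show "linear_on k (tensor k U (tensor k V W)) ?N (tensor_assoc_inv k U V W)"
    unfolding tensor_assoc_inv_def by (rule tensor_lift_linear[OF k(1,2) VW N lin2 lin1])
  show "tensor_assoc_inv k U V W (pure_tensor k U (tensor k V W) u (pure_tensor k V W v w)) = ?b u v w"
    if "u \<in> carrier U" "v \<in> carrier V" "w \<in> carrier W"
  proof -
    have "tensor_assoc_inv k U V W (pure_tensor k U (tensor k V W) u (pure_tensor k V W v w)) =
        tensor_lift k V W ?N (?b u) (pure_tensor k V W v w)"
      unfolding tensor_assoc_inv_def
      by (rule tensor_lift_pure[OF k(1,2) VW N lin2 lin1 that(1) pure_tensor_closed[OF k(1,3,4) that(2,3)]])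
    also have "\<dots> = ?b u v w"
      by (rule tensor_lift_pure[OF k(1,3,4) N b2 b3 that(2,3)]) (rule that | assumption)+
    finally show ?thesis .
  qed
qed

lemma scalar_action_linear_pure:
  assumes V: "module k V"
  shows scalar_action_linear: "linear_on k (tensor k (scalars k) V) V (scalar_action k V)"
    and scalar_action_pure: "c \<in> carrier k \<Longrightarrow> v \<in> carrier V \<Longrightarrow>
      scalar_action k V (pure_tensor k (scalars k) V c v) = c \<odot>\<^bsub>V\<^esub> v"
proof -
  interpret module k V by fact
  note k = R.is_cring
  have 1: "linear_on k (scalars k) V (\<lambda>c. c \<odot>\<^bsub>V\<^esub> v)" if "v \<in> carrier V" for v
    using that by (intro linear_onI) (simp_all add: scalars_def smult_l_distr smult_assoc1)
  have 2: "linear_on k V V (\<lambda>v. c \<odot>\<^bsub>V\<^esub> v)" if "c \<in> carrier (scalars k)" for c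
    using that by (intro linear_on_smult linear_on_ident V) (simp add: scalars_def)
  show "linear_on k (tensor k (scalars k) V) V (scalar_action k V)"
    unfolding scalar_action_def by (rule tensor_lift_linear[OF k module_scalars[OF k] V V 1 2])
  show "c \<in> carrier k \<Longrightarrow> v \<in> carrier V \<Longrightarrow>
      scalar_action k V (pure_tensor k (scalars k) V c v) = c \<odot>\<^bsub>V\<^esub> v"
    unfolding scalar_action_def
    by (rule tensor_lift_pure[OF k module_scalars[OF k] V V 1 2]) (simp_all add: scalars_def)
qed

section \<open>Symmetric multilinear maps on words\<close>

text \<open>The conditions match the three families generating \<open>sym_rel\<close>, so they are
  what \<open>bang_lift\<close> asks of a formula at each base point. Symmetry is required for
  neighbouring letters only; \<open>sym_multilinear_mset\<close> recovers all permutations.\<close>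

definition sym_multilinear ::
  "'k ring \<Rightarrow> ('k, 'v) module \<Rightarrow> ('k, 'w) module \<Rightarrow> ('v list \<Rightarrow> 'w) \<Rightarrow> bool" where
  "sym_multilinear k V N g \<longleftrightarrow>
     (\<forall>xs\<in>lists (carrier V). g xs \<in> carrier N) \<and>
     (\<forall>xs\<in>lists (carrier V). \<forall>ys\<in>lists (carrier V). linear_on k V N (\<lambda>v. g (xs @ v # ys))) \<and>
     (\<forall>xs\<in>lists (carrier V). \<forall>ys\<in>lists (carrier V). \<forall>v\<in>carrier V. \<forall>w\<in>carrier V.
        g (xs @ v # w # ys) = g (xs @ w # v # ys))"

lemma sym_multilinearI:
  assumes "\<And>xs. xs \<in> lists (carrier V) \<Longrightarrow> g xs \<in> carrier N"
    and "\<And>xs ys. xs \<in> lists (carrier V) \<Longrightarrow> ys \<in> lists (carrier V) \<Longrightarrow> linear_on k V N (\<lambda>v. g (xs @ v # ys))"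
    and "\<And>xs ys v w. xs \<in> lists (carrier V) \<Longrightarrow> ys \<in> lists (carrier V) \<Longrightarrow> v \<in> carrier V \<Longrightarrow> w \<in> carrier V \<Longrightarrow>
      g (xs @ v # w # ys) = g (xs @ w # v # ys)"
  shows "sym_multilinear k V N g"
  using assms by (simp add: sym_multilinear_def)

lemma sym_multilinearD:
  assumes "sym_multilinear k V N g"
  shows "xs \<in> lists (carrier V) \<Longrightarrow> g xs \<in> carrier N"
    and "xs \<in> lists (carrier V) \<Longrightarrow> ys \<in> lists (carrier V) \<Longrightarrow> linear_on k V N (\<lambda>v. g (xs @ v # ys))"
    and "xs \<in> lists (carrier V) \<Longrightarrow> ys \<in> lists (carrier V) \<Longrightarrow> v \<in> carrier V \<Longrightarrow> w \<in> carrier V \<Longrightarrow>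
      g (xs @ v # w # ys) = g (xs @ w # v # ys)"
  using assms by (simp_all add: sym_multilinear_def)

text \<open>Inductions along a word generalise over the function and absorb into it each letter
  already passed; this lemma keeps their hypothesis alive.\<close>

lemma sym_multilinear_Cons:
  assumes g: "sym_multilinear k V N g" and x: "x \<in> carrier V"
  shows "sym_multilinear k V N (\<lambda>xs. g (x # xs))"
proof (rule sym_multilinearI)
  have x': "x # xs \<in> lists (carrier V)" if "xs \<in> lists (carrier V)" for xs
    using x that by simp
  show "g (x # xs) \<in> carrier N" if "xs \<in> lists (carrier V)" for xs
    by (rule sym_multilinearD(1)[OF g x'[OF that]])
  show "linear_on k V N (\<lambda>v. g (x # xs @ v # ys))"
    if "xs \<in> lists (carrier V)" "ys \<in> lists (carrier V)" for xs ys
    using sym_multilinearD(2)[OF g x'[OF that(1)] that(2)] by simp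
  show "g (x # xs @ v # w # ys) = g (x # xs @ w # v # ys)"
    if "xs \<in> lists (carrier V)" "ys \<in> lists (carrier V)" "v \<in> carrier V" "w \<in> carrier V" for xs ys v w
    using sym_multilinearD(3)[OF g x'[OF that(1)] that(2-4)] by simp
qed

lemma sym_multilinear_comp:
  assumes g: "sym_multilinear k V N g" and f: "linear_on k N M f"
  shows "sym_multilinear k V M (\<lambda>xs. f (g xs))"
proof (rule sym_multilinearI)
  show "linear_on k V M (\<lambda>v. f (g (xs @ v # ys)))"
    if "xs \<in> lists (carrier V)" "ys \<in> lists (carrier V)" for xs ys
    by (rule linear_on_comp[OF sym_multilinearD(2)[OF g that] f])
  show "f (g (xs @ v # w # ys)) = f (g (xs @ w # v # ys))"
    if "xs \<in> lists (carrier V)" "ys \<in> lists (carrier V)" "v \<in> carrier V" "w \<in> carrier V" for xs ys v w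
    using sym_multilinearD(3)[OF g that] by simp
qed (simp add: linear_onD[OF f] sym_multilinearD(1)[OF g])

lemma sym_multilinear_map:
  assumes g: "sym_multilinear k W N g" and f: "linear_on k V W f"
  shows "sym_multilinear k V N (\<lambda>xs. g (map f xs))"
proof (rule sym_multilinearI)
  have m: "map f xs \<in> lists (carrier W)" if "xs \<in> lists (carrier V)" for xs
    using that by (induction xs) (simp_all add: linear_onD[OF f])
  show "g (map f xs) \<in> carrier N" if "xs \<in> lists (carrier V)" for xs
    by (rule sym_multilinearD(1)[OF g m[OF that]])
  show "linear_on k V N (\<lambda>v. g (map f (xs @ v # ys)))"
    if "xs \<in> lists (carrier V)" "ys \<in> lists (carrier V)" for xs ys
    using linear_on_comp[OF f sym_multilinearD(2)[OF g m m]] that by simp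
  show "g (map f (xs @ v # w # ys)) = g (map f (xs @ w # v # ys))"
    if "xs \<in> lists (carrier V)" "ys \<in> lists (carrier V)" "v \<in> carrier V" "w \<in> carrier V" for xs ys v w
    using sym_multilinearD(3)[OF g m m] that by (simp add: linear_onD[OF f])
qed

lemma sym_multilinear_move_front:
  assumes g: "sym_multilinear k V N g"
    and "xs \<in> lists (carrier V)" "ys \<in> lists (carrier V)" "v \<in> carrier V"
  shows "g (xs @ v # ys) = g (v # xs @ ys)"
  using assms(2,3)
proof (induction xs arbitrary: ys rule: rev_induct)
  case (snoc x xs)
  then show ?case
    using sym_multilinearD(3)[OF g, of xs ys x v] assms(4) by simp
qed simp

text \<open>The first letter of one word is located in the other and moved to its front by
  neighbouring exchanges; the rest is the induction hypothesis for the function that has absorbed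
  this letter. Full permutation invariance is needed because \<open>blocks\<close> picks an
  unspecified order of the blocks.\<close>

lemma sym_multilinear_mset:
  assumes "sym_multilinear k V N g" and "mset xs = mset ys"
    and "xs \<in> lists (carrier V)" and "ys \<in> lists (carrier V)"
  shows "g xs = g ys"
  using assms
proof (induction xs arbitrary: ys g)
  case Nil
  then show ?case by simp
next
  case (Cons x xs)
  have "x \<in> set ys" using Cons.prems(2) by (metis list.set_intros(1) mset_eq_setD)
  then obtain as bs where ys: "ys = as @ x # bs" by (meson split_list)
  have "g (x # xs) = g (x # as @ bs)"
    by (rule Cons.IH[OF sym_multilinear_Cons[OF Cons.prems(1)]]) (use Cons.prems(2-) ys in auto)
  also have "\<dots> = g ys"
    unfolding ys using Cons.prems(4) ys
    by (intro sym_multilinear_move_front[OF Cons.prems(1), symmetric]) auto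
  finally show ?case .
qed

section \<open>Kets, and linear maps out of \<open>bang k V\<close>\<close>

lemma sym_word_sym_multilinear:
  assumes k: "cring k" and V: "module k V"
  shows "sym_multilinear k V (Sym k V) (sym_word k V)"
proof -
  interpret V: module k V by fact
  let ?I = "lists (carrier V)"
  let ?F = "free_module k ?I"
  interpret F: module k ?F by (rule module_free[OF k])
  note bc = basis_vec_closed[OF k, of _ ?I]
  define R where "R = ({basis_vec k (xs @ [v \<oplus>\<^bsub>V\<^esub> w] @ ys) \<ominus>\<^bsub>?F\<^esub> (basis_vec k (xs @ [v] @ ys) \<oplus>\<^bsub>?F\<^esub> basis_vec k (xs @ [w] @ ys)) | xs ys v w.
           xs \<in> lists (carrier V) \<and> ys \<in> lists (carrier V) \<and> v \<in> carrier V \<and> w \<in> carrier V} \<union>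
        {basis_vec k (xs @ [c \<odot>\<^bsub>V\<^esub> v] @ ys) \<ominus>\<^bsub>?F\<^esub> (c \<odot>\<^bsub>?F\<^esub> basis_vec k (xs @ [v] @ ys)) | xs ys c v.
           xs \<in> lists (carrier V) \<and> ys \<in> lists (carrier V) \<and> c \<in> carrier k \<and> v \<in> carrier V} \<union>
        {basis_vec k (xs @ [v, w] @ ys) \<ominus>\<^bsub>?F\<^esub> basis_vec k (xs @ [w, v] @ ys) | xs ys v w.
           xs \<in> lists (carrier V) \<and> ys \<in> lists (carrier V) \<and> v \<in> carrier V \<and> w \<in> carrier V})"
  have rel: "sym_rel k V = submodule_span k ?F R"
    unfolding sym_rel_def Let_def R_def ..
  have R: "R \<subseteq> carrier ?F" unfolding R_def
    by (intro Un_least subsetI; elim CollectE exE conjE; simp add: bc F.M.minus_closed)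
  have H: "submodule (sym_rel k V) k ?F" "R \<subseteq> sym_rel k V"
    unfolding rel using submodule_spanI[OF F.module_axioms R] by auto
  note ca = coset_add[OF F.module_axioms H(1)] and cs = coset_smult[OF F.module_axioms H(1)]
    and ce = coset_eq[OF F.module_axioms H(1), THEN iffD2]
  have cl: "sym_word k V xs \<in> carrier (Sym k V)" if "xs \<in> lists (carrier V)" for xs
    unfolding Sym_def sym_word_def by (rule coset_carrier[OF F.module_axioms H(1) bc[OF that]])
  show ?thesis
  proof (rule sym_multilinearI)
    fix xs ys assume xs: "xs \<in> ?I" "ys \<in> ?I"
    show "linear_on k V (Sym k V) (\<lambda>v. sym_word k V (xs @ v # ys))"
    proof (rule linear_onI)
      fix x y assume xy: "x \<in> carrier V" "y \<in> carrier V"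
      have "basis_vec k (xs @ [x \<oplus>\<^bsub>V\<^esub> y] @ ys) \<ominus>\<^bsub>?F\<^esub> (basis_vec k (xs @ [x] @ ys) \<oplus>\<^bsub>?F\<^esub> basis_vec k (xs @ [y] @ ys)) \<in> R"
        unfolding R_def using xy xs by blast
      then have "basis_vec k (xs @ (x \<oplus>\<^bsub>V\<^esub> y) # ys) \<ominus>\<^bsub>?F\<^esub> (basis_vec k (xs @ x # ys) \<oplus>\<^bsub>?F\<^esub> basis_vec k (xs @ y # ys)) \<in> sym_rel k V"
        using H(2) by auto
      then show "sym_word k V (xs @ (x \<oplus>\<^bsub>V\<^esub> y) # ys) =
          sym_word k V (xs @ x # ys) \<oplus>\<^bsub>Sym k V\<^esub> sym_word k V (xs @ y # ys)"
        unfolding Sym_def sym_word_def using xy xs by (simp add: ca bc ce)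
    next
      fix c x assume xy: "c \<in> carrier k" "x \<in> carrier V"
      have "basis_vec k (xs @ [c \<odot>\<^bsub>V\<^esub> x] @ ys) \<ominus>\<^bsub>?F\<^esub> (c \<odot>\<^bsub>?F\<^esub> basis_vec k (xs @ [x] @ ys)) \<in> R"
        unfolding R_def using xy xs by blast
      then have "basis_vec k (xs @ (c \<odot>\<^bsub>V\<^esub> x) # ys) \<ominus>\<^bsub>?F\<^esub> (c \<odot>\<^bsub>?F\<^esub> basis_vec k (xs @ x # ys)) \<in> sym_rel k V"
        using H(2) by auto
      then show "sym_word k V (xs @ (c \<odot>\<^bsub>V\<^esub> x) # ys) = c \<odot>\<^bsub>Sym k V\<^esub> sym_word k V (xs @ x # ys)"
        unfolding Sym_def sym_word_def using xy xs by (simp add: cs bc ce)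
    qed (use xs in \<open>simp add: cl\<close>)
    show "sym_word k V (xs @ v # w # ys) = sym_word k V (xs @ w # v # ys)"
      if vw: "v \<in> carrier V" "w \<in> carrier V" for v w
    proof -
      have "basis_vec k (xs @ [v, w] @ ys) \<ominus>\<^bsub>?F\<^esub> basis_vec k (xs @ [w, v] @ ys) \<in> R"
        unfolding R_def using vw xs by blast
      then have "basis_vec k (xs @ v # w # ys) \<ominus>\<^bsub>?F\<^esub> basis_vec k (xs @ w # v # ys) \<in> sym_rel k V"
        using H(2) by auto
      then show ?thesis
        unfolding sym_word_def using vw xs by (simp add: bc ce)
    qed
  qed (rule cl)
qed

lemma ket_sym_multilinear:
  assumes k: "cring k" and V: "module k V" and P: "P \<in> carrier V"
  shows "sym_multilinear k V (bang k V) (ket k V P)"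
proof -
  note S = module_Sym[OF k V]
  have "linear_on k (Sym k V) (bang k V) (\<lambda>x. summand_incl (Sym k V) P x)"
    by (rule linear_on_cong[OF linear_on_linear_maps[OF summand_incl_linear[OF S P], folded bang_def] S]) simp
  from sym_multilinear_comp[OF sym_word_sym_multilinear[OF k V] this]
  show ?thesis unfolding ket_def .
qed

lemma ket_closed:
  assumes "cring k" and "module k V" and "P \<in> carrier V" and "xs \<in> lists (carrier V)"
  shows "ket k V P xs \<in> carrier (bang k V)"
  by (rule sym_multilinearD(1)[OF ket_sym_multilinear[OF assms(1-3)] assms(4)])

lemma bang_lift_sym_multilinear:
  assumes "cring k" and "module k V" and "module k N"
    and g: "\<And>P. P \<in> carrier V \<Longrightarrow> sym_multilinear k V N (g P)"
  shows bang_lift_linear: "linear_on k (bang k V) N (bang_lift k V N g)"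
    and bang_lift_ket: "P \<in> carrier V \<Longrightarrow> xs \<in> lists (carrier V) \<Longrightarrow> bang_lift k V N g (ket k V P xs) = g P xs"
proof -
  have "bang_lift k V N g \<in> linear_maps k (bang k V) N \<and>
     (\<forall>P\<in>carrier V. \<forall>\<nu>s\<in>lists (carrier V). bang_lift k V N g (ket k V P \<nu>s) = g P \<nu>s)"
    by (rule bang_lift[OF assms(1-3)])
      (simp_all add: sym_multilinearD[OF g] linear_onD[OF sym_multilinearD(2)[OF g]])
  then show "linear_on k (bang k V) N (bang_lift k V N g)"
    and "P \<in> carrier V \<Longrightarrow> xs \<in> lists (carrier V) \<Longrightarrow> bang_lift k V N g (ket k V P xs) = g P xs"
    by (simp_all add: linear_on_linear_maps)
qed

lemma bang_ext:
  assumes k: "cring k" and V: "module k V" and N: "module k N"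
    and f: "linear_on k (bang k V) N f" and g: "linear_on k (bang k V) N g"
    and eq: "\<And>P xs. P \<in> carrier V \<Longrightarrow> xs \<in> lists (carrier V) \<Longrightarrow> f (ket k V P xs) = g (ket k V P xs)"
    and x: "x \<in> carrier (bang k V)"
  shows "f x = g x"
proof -
  let ?B = "bang k V"
  note B = module_bang[OF k V]
  note m = sym_multilinear_comp[OF ket_sym_multilinear[OF k V] f]
  have ex1: "\<exists>!h. h \<in> linear_maps k ?B N \<and>
     (\<forall>P\<in>carrier V. \<forall>\<nu>s\<in>lists (carrier V). h (ket k V P \<nu>s) = f (ket k V P \<nu>s))"
    by (rule bang_lift_ex1[OF k V N])
      (simp_all add: sym_multilinearD[OF m] linear_onD[OF sym_multilinearD(2)[OF m]])
  have "restrict f (carrier ?B) = restrict g (carrier ?B)"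
    using restrict_linear_maps[OF f B] restrict_linear_maps[OF g B]
    by (intro ex1_unique[OF ex1]) (simp_all add: ket_closed[OF k V] eq)
  then show ?thesis using x by (metis restrict_apply')
qed

text \<open>This is the test principle behind naturality and all four axioms: kets detect equality
  of linear maps on \<open>bang k V\<close>, and for fixed \<open>w\<close> the pure tensor is
  linear in its first factor.\<close>

lemma tensor_bang_ext:
  assumes k: "cring k" and V: "module k V" and W: "module k W" and N: "module k N"
    and f: "linear_on k (tensor k (bang k V) W) N f" and g: "linear_on k (tensor k (bang k V) W) N g"
    and eq: "\<And>P xs w. P \<in> carrier V \<Longrightarrow> xs \<in> lists (carrier V) \<Longrightarrow> w \<in> carrier W \<Longrightarrow>
      f (pure_tensor k (bang k V) W (ket k V P xs) w) = g (pure_tensor k (bang k V) W (ket k V P xs) w)"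
    and t: "t \<in> carrier (tensor k (bang k V) W)"
  shows "f t = g t"
proof (rule tensor_ext[OF k module_bang[OF k V] W N f g _ t])
  fix x w assume x: "x \<in> carrier (bang k V)" and w: "w \<in> carrier W"
  note p = pure_tensor_linear1[OF k module_bang[OF k V] W w]
  show "f (pure_tensor k (bang k V) W x w) = g (pure_tensor k (bang k V) W x w)"
    by (rule bang_ext[OF k V N linear_on_comp[OF p f] linear_on_comp[OF p g] eq x]) (use w in simp_all)
qed

section \<open>Sums over splittings and set partitions of a word\<close>

text \<open>The unshuffle formula for the coproduct: every letter joins one of two words, and the
  order of the letters is kept in both. The choices are accumulated inside \<open>F\<close>, so
  inductions vary \<open>F\<close> and need no accumulators.\<close>

fun split_sum :: "('n, 'm) ring_scheme \<Rightarrow> ('v list \<Rightarrow> 'v list \<Rightarrow> 'n) \<Rightarrow> 'v list \<Rightarrow> 'n" where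
  "split_sum N F [] = F [] []"
| "split_sum N F (x # xs) =
     split_sum N (\<lambda>a b. F (x # a) b) xs \<oplus>\<^bsub>N\<^esub> split_sum N (\<lambda>a b. F a (x # b)) xs"

text \<open>The sum of \<open>F\<close> over the set partitions with at most \<open>n\<close> blocks, the block of the first letter
  being split off first. The truncation at \<open>n\<close> allows symmetry in the letters to be proved by induction on
  \<open>n\<close>, for words of all lengths at once.\<close>

fun part_sum :: "('n, 'm) ring_scheme \<Rightarrow> nat \<Rightarrow> ('v list list \<Rightarrow> 'n) \<Rightarrow> 'v list \<Rightarrow> 'n" where
  "part_sum N n F [] = F []"
| "part_sum N 0 F (x # xs) = \<zero>\<^bsub>N\<^esub>"
| "part_sum N (Suc n) F (x # xs) =
     split_sum N (\<lambda>a b. part_sum N n (\<lambda>ls. F ((x # b) # ls)) a) xs"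

text \<open>The length condition records that a splitting uses every letter exactly once. It is what
  bounds the length of \<open>a\<close> when a sum truncated at the length of the whole word is
  evaluated at a part of it.\<close>

lemma split_sum_cong:
  assumes "xs \<in> lists S"
    and "\<And>a b. a \<in> lists S \<Longrightarrow> b \<in> lists S \<Longrightarrow> length a + length b = length xs \<Longrightarrow> F a b = G a b"
  shows "split_sum N F xs = split_sum N G xs"
  using assms
proof (induction xs arbitrary: F G rule: list.induct)
  case (Cons x xs)
  then have x: "x \<in> S" "xs \<in> lists S" by simp_all
  have "split_sum N (\<lambda>a b. F (x # a) b) xs = split_sum N (\<lambda>a b. G (x # a) b) xs"
    by (rule Cons.IH[OF x(2) Cons.prems(2)]) (simp_all add: x)
  moreover have "split_sum N (\<lambda>a b. F a (x # b)) xs = split_sum N (\<lambda>a b. G a (x # b)) xs"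
    by (rule Cons.IH[OF x(2) Cons.prems(2)]) (simp_all add: x)
  ultimately show ?case by simp
qed simp

lemma split_sum_closed:
  assumes N: "module k N" and "xs \<in> lists S"
    and "\<And>a b. a \<in> lists S \<Longrightarrow> b \<in> lists S \<Longrightarrow> F a b \<in> carrier N"
  shows "split_sum N F xs \<in> carrier N"
proof -
  interpret module k N by (rule N)
  show ?thesis using assms(2,3)
    by (induction xs arbitrary: F rule: list.induct) simp_all
qed

lemma split_sum_add:
  assumes N: "module k N" and "xs \<in> lists S"
    and "\<And>a b. a \<in> lists S \<Longrightarrow> b \<in> lists S \<Longrightarrow> F a b \<in> carrier N"
    and "\<And>a b. a \<in> lists S \<Longrightarrow> b \<in> lists S \<Longrightarrow> G a b \<in> carrier N"
  shows "split_sum N (\<lambda>a b. F a b \<oplus>\<^bsub>N\<^esub> G a b) xs = split_sum N F xs \<oplus>\<^bsub>N\<^esub> split_sum N G xs"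
proof -
  interpret module k N by (rule N)
  show ?thesis using assms(2-)
  proof (induction xs arbitrary: F G rule: list.induct)
    case (Cons x xs)
    then have x: "x \<in> S" "xs \<in> lists S" by simp_all
    have cl: "split_sum N (\<lambda>a b. F (x # a) b) xs \<in> carrier N" "split_sum N (\<lambda>a b. F a (x # b)) xs \<in> carrier N"
      "split_sum N (\<lambda>a b. G (x # a) b) xs \<in> carrier N" "split_sum N (\<lambda>a b. G a (x # b)) xs \<in> carrier N"
      by (rule split_sum_closed[OF N x(2)], rule Cons.prems, simp_all add: x)+
    show ?case
      using Cons.IH[of "\<lambda>a b. F (x # a) b" "\<lambda>a b. G (x # a) b"]
        Cons.IH[of "\<lambda>a b. F a (x # b)" "\<lambda>a b. G a (x # b)"] Cons.prems
      by (simp add: cl M.add.m_ac)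
  qed simp
qed

lemma split_sum_linear:
  assumes N: "module k N" and "xs \<in> lists S"
    and "\<And>a b. a \<in> lists S \<Longrightarrow> b \<in> lists S \<Longrightarrow> linear_on k V N (\<lambda>v. F v a b)"
  shows "linear_on k V N (\<lambda>v. split_sum N (F v) xs)"
  using assms(2,3) by (induction xs arbitrary: F rule: list.induct) (simp_all add: linear_on_add[OF _ _ N])

lemma split_sum_hom:
  assumes N: "module k N" and T: "linear_on k N M T" and "xs \<in> lists S"
    and "\<And>a b. a \<in> lists S \<Longrightarrow> b \<in> lists S \<Longrightarrow> F a b \<in> carrier N"
  shows "T (split_sum N F xs) = split_sum M (\<lambda>a b. T (F a b)) xs"
  using assms(3,4)
proof (induction xs arbitrary: F rule: list.induct)
  case (Cons x xs)
  then have x: "x \<in> S" "xs \<in> lists S" by simp_all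
  have "split_sum N (\<lambda>a b. F (x # a) b) xs \<in> carrier N" "split_sum N (\<lambda>a b. F a (x # b)) xs \<in> carrier N"
    by (rule split_sum_closed[OF N x(2)], rule Cons.prems, simp_all add: x)+
  then show ?case using Cons by (simp add: linear_onD(2)[OF T])
qed simp

text \<open>Letters before the position under consideration are absorbed into \<open>F\<close>,
  which stays symmetric multilinear in both arguments. What remains is the front of the word, where
  the recursion shows explicitly which argument of \<open>F\<close> receives the letter.\<close>

lemma split_sum_sym_multilinear:
  assumes N: "module k N"
    and "\<And>b. b \<in> lists (carrier V) \<Longrightarrow> sym_multilinear k V N (\<lambda>a. F a b)"
    and "\<And>a. a \<in> lists (carrier V) \<Longrightarrow> sym_multilinear k V N (F a)"
  shows "sym_multilinear k V N (split_sum N F)"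
proof (rule sym_multilinearI)
  interpret module k N by (rule N)
  let ?L = "lists (carrier V)"
  have cl: "F a b \<in> carrier N" if "a \<in> ?L" "b \<in> ?L" for a b
    by (rule sym_multilinearD(1)[OF assms(3)[OF that(1)] that(2)])
  show "split_sum N F xs \<in> carrier N" if "xs \<in> ?L" for xs
    by (rule split_sum_closed[OF N that cl])
  show "linear_on k V N (\<lambda>v. split_sum N F (xs @ v # ys))" if "xs \<in> ?L" "ys \<in> ?L" for xs ys
    using that(1) assms(2,3)
  proof (induction xs arbitrary: F rule: list.induct)
    case Nil
    have "linear_on k V N (\<lambda>v. F (v # a) b)" if "a \<in> ?L" "b \<in> ?L" for a b
      using sym_multilinearD(2)[OF Nil.prems(2)[OF that(2)] lists.Nil that(1)] by simp
    moreover have "linear_on k V N (\<lambda>v. F a (v # b))" if "a \<in> ?L" "b \<in> ?L" for a b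
      using sym_multilinearD(2)[OF Nil.prems(3)[OF that(1)] lists.Nil that(2)] by simp
    ultimately show ?case
      by (simp add: linear_on_add[OF _ _ N] split_sum_linear[OF N that(2)])
  next
    case (Cons x xs)
    then have x: "x \<in> carrier V" "xs \<in> ?L" by auto
    have "linear_on k V N (\<lambda>v. split_sum N (\<lambda>a b. F (x # a) b) (xs @ v # ys))"
      by (rule Cons.IH[OF x(2)]) (simp_all add: Cons.prems sym_multilinear_Cons[OF _ x(1), where g = "\<lambda>a. F a _"] x)
    moreover have "linear_on k V N (\<lambda>v. split_sum N (\<lambda>a b. F a (x # b)) (xs @ v # ys))"
      by (rule Cons.IH[OF x(2)]) (simp_all add: Cons.prems sym_multilinear_Cons[OF _ x(1)] x)
    ultimately show ?case by (simp add: linear_on_add[OF _ _ N])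
  qed
  show "split_sum N F (xs @ v # w # ys) = split_sum N F (xs @ w # v # ys)"
    if "xs \<in> ?L" "ys \<in> ?L" "v \<in> carrier V" "w \<in> carrier V" for xs ys v w
    using that(1) assms(2,3)
  proof (induction xs arbitrary: F rule: list.induct)
    case Nil
    note vw = that(3,4)
    have cl: "F a b \<in> carrier N" if "a \<in> ?L" "b \<in> ?L" for a b
      by (rule sym_multilinearD(1)[OF Nil.prems(3)[OF that(1)] that(2)])
    \<comment> \<open>Two leading letters give four sums. If both land in the same word, symmetry of
      \<open>F\<close> in that argument applies; the two mixed sums are interchanged when
      \<open>v\<close> and \<open>w\<close> are.\<close>
    have s1: "split_sum N (\<lambda>a b. F (v # w # a) b) ys = split_sum N (\<lambda>a b. F (w # v # a) b) ys"
      by (rule split_sum_cong[OF that(2)])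
        (use sym_multilinearD(3)[OF Nil.prems(2), of _ "[]" _ v w] vw in simp)
    have s2: "split_sum N (\<lambda>a b. F a (v # w # b)) ys = split_sum N (\<lambda>a b. F a (w # v # b)) ys"
      by (rule split_sum_cong[OF that(2)])
        (use sym_multilinearD(3)[OF Nil.prems(3), of _ "[]" _ v w] vw in simp)
    have "split_sum N (\<lambda>a b. F (v # w # a) b) ys \<in> carrier N"
      "split_sum N (\<lambda>a b. F a (v # w # b)) ys \<in> carrier N"
      "split_sum N (\<lambda>a b. F (v # a) (w # b)) ys \<in> carrier N"
      "split_sum N (\<lambda>a b. F (w # a) (v # b)) ys \<in> carrier N"
      by (rule split_sum_closed[OF N that(2)]; use vw in \<open>simp add: cl\<close>)+
    then show ?case by (simp add: s1[symmetric] s2[symmetric] M.add.m_ac)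
  next
    case (Cons x xs)
    then have x: "x \<in> carrier V" "xs \<in> ?L" by auto
    have "split_sum N (\<lambda>a b. F (x # a) b) (xs @ v # w # ys) = split_sum N (\<lambda>a b. F (x # a) b) (xs @ w # v # ys)"
      by (rule Cons.IH[OF x(2)]) (simp_all add: Cons.prems sym_multilinear_Cons[OF _ x(1), where g = "\<lambda>a. F a _"] x)
    moreover have "split_sum N (\<lambda>a b. F a (x # b)) (xs @ v # w # ys) = split_sum N (\<lambda>a b. F a (x # b)) (xs @ w # v # ys)"
      by (rule Cons.IH[OF x(2)]) (simp_all add: Cons.prems sym_multilinear_Cons[OF _ x(1)] x)
    ultimately show ?case by simp
  qed
qed

text \<open>Both sides sum over all ways to distribute the letters among three words, and they
  differ only in which of the last two is split off first. This is coassociativity together with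
  cocommutativity, at the level of words.\<close>

lemma split_sum_nested_commute:
  assumes N: "module k N" and "xs \<in> lists S"
    and "\<And>a b c. a \<in> lists S \<Longrightarrow> b \<in> lists S \<Longrightarrow> c \<in> lists S \<Longrightarrow> H a b c \<in> carrier N"
  shows "split_sum N (\<lambda>a b. split_sum N (\<lambda>c d. H c d b) a) xs =
    split_sum N (\<lambda>a b. split_sum N (\<lambda>c d. H c b d) a) xs"
proof -
  interpret module k N by (rule N)
  show ?thesis using assms(2,3)
  proof (induction xs arbitrary: H rule: list.induct)
    case (Cons x xs)
    then have x: "x \<in> S" "xs \<in> lists S" by auto
    define A where "A H = split_sum N (\<lambda>a b. split_sum N (\<lambda>c d. H c d b) a) xs" for H 
    define B where "B H = split_sum N (\<lambda>a b. split_sum N (\<lambda>c d. H c b d) a) xs" for H 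
    \<comment> \<open>These are the three destinations of the leading letter. Unfolding yields them
      in the order 1, 2, 3 on the left and 1, 3, 2 on the right.\<close>
    let ?H1 = "\<lambda>a b c. H (x # a) b c" and ?H2 = "\<lambda>a b c. H a (x # b) c" and ?H3 = "\<lambda>a b c. H a b (x # c)"
    have IH: "A ?H1 = B ?H1" "A ?H2 = B ?H2" "A ?H3 = B ?H3"
      unfolding A_def B_def by (rule Cons.IH[OF x(2)]; simp add: Cons.prems x)+
    have c: "split_sum N (\<lambda>c d. H (x # c) d b) a \<in> carrier N" "split_sum N (\<lambda>c d. H c (x # d) b) a \<in> carrier N"
      "split_sum N (\<lambda>c d. H c d (x # b)) a \<in> carrier N"
      "split_sum N (\<lambda>c d. H (x # c) b d) a \<in> carrier N" "split_sum N (\<lambda>c d. H c (x # b) d) a \<in> carrier N"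
      "split_sum N (\<lambda>c d. H c b (x # d)) a \<in> carrier N"
      if "a \<in> lists S" "b \<in> lists S" for a b
      by (rule split_sum_closed[OF N that(1)]; simp add: that Cons.prems x)+
    have A: "A ?H1 \<in> carrier N" "A ?H2 \<in> carrier N" "A ?H3 \<in> carrier N"
      unfolding A_def by (rule split_sum_closed[OF N x(2)]; simp add: c)+
    have "split_sum N (\<lambda>a b. split_sum N (\<lambda>c d. H c d b) a) (x # xs) = (A ?H1 \<oplus>\<^bsub>N\<^esub> A ?H2) \<oplus>\<^bsub>N\<^esub> A ?H3"
      unfolding A_def by (simp add: split_sum_add[OF N x(2)] c)
    also have "\<dots> = (B ?H1 \<oplus>\<^bsub>N\<^esub> B ?H3) \<oplus>\<^bsub>N\<^esub> B ?H2"
      unfolding IH[symmetric] by (simp add: A M.add.m_ac)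
    also have "\<dots> = split_sum N (\<lambda>a b. split_sum N (\<lambda>c d. H c b d) a) (x # xs)"
      unfolding B_def by (simp add: split_sum_add[OF N x(2)] c)
    finally show ?case .
  qed simp
qed

section \<open>Truncated sums over set partitions of a word\<close>

lemma part_sum_cong:
  assumes "xs \<in> lists S" and "\<And>ls. ls \<in> lists (lists S) \<Longrightarrow> F ls = G ls"
  shows "part_sum N n F xs = part_sum N n G xs"
  using assms
proof (induction n arbitrary: F G xs)
  case 0
  then show ?case by (cases xs) simp_all
next
  case (Suc n)
  show ?case
  proof (cases xs)
    case (Cons x ys)
    then have ys: "ys \<in> lists S" "x \<in> S" using Suc.prems by auto
    show ?thesis unfolding Cons part_sum.simps
      by (rule split_sum_cong[OF ys(1)], rule Suc.IH) (use Suc.prems ys in simp_all)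
  qed (use Suc.prems in simp)
qed

lemma part_sum_closed:
  assumes N: "module k N" and "xs \<in> lists S"
    and "\<And>ls. ls \<in> lists (lists S) \<Longrightarrow> F ls \<in> carrier N"
  shows "part_sum N n F xs \<in> carrier N"
proof -
  interpret module k N by (rule N)
  show ?thesis using assms(2,3)
  proof (induction n arbitrary: F xs)
    case 0
    then show ?case by (cases xs) simp_all
  next
    case (Suc n)
    show ?case
    proof (cases xs)
      case (Cons x ys)
      then have ys: "ys \<in> lists S" "x \<in> S" using Suc.prems by auto
      show ?thesis unfolding Cons part_sum.simps
        by (rule split_sum_closed[OF N ys(1)], rule Suc.IH) (use Suc.prems ys in simp_all)
    qed (use Suc.prems in simp)
  qed
qed

lemma part_sum_linear:
  assumes N: "module k N" and "xs \<in> lists S"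
    and "\<And>ls. ls \<in> lists (lists S) \<Longrightarrow> linear_on k V N (\<lambda>v. F v ls)"
  shows "linear_on k V N (\<lambda>v. part_sum N n (F v) xs)"
  using assms(2,3)
proof (induction n arbitrary: F xs)
  case 0
  then show ?case by (cases xs) (simp_all add: linear_on_const_zero[OF N])
next
  case (Suc n)
  show ?case
  proof (cases xs)
    case (Cons x ys)
    then have ys: "ys \<in> lists S" "x \<in> S" using Suc.prems by auto
    show ?thesis unfolding Cons part_sum.simps
      by (rule split_sum_linear[OF N ys(1)], rule Suc.IH) (use Suc.prems ys in simp_all)
  qed (use Suc.prems in simp)
qed

text \<open>In contrast to \<open>split_sum_hom\<close>, preservation of zero enters here, because a
  truncated sum over a nonempty word is zero by definition.\<close>

lemma part_sum_hom:
  assumes N: "module k N" and M: "module k M" and T: "linear_on k N M T" and "xs \<in> lists S"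
    and "\<And>ls. ls \<in> lists (lists S) \<Longrightarrow> F ls \<in> carrier N"
  shows "T (part_sum N n F xs) = part_sum M n (\<lambda>ls. T (F ls)) xs"
  using assms(4,5)
proof (induction n arbitrary: F xs)
  case 0
  then show ?case by (cases xs) (simp_all add: linear_on_zero[OF T N M])
next
  case (Suc n)
  show ?case
  proof (cases xs)
    case (Cons x ys)
    then have ys: "ys \<in> lists S" "x \<in> S" using Suc.prems by auto
    have c: "part_sum N n (\<lambda>ls. F ((x # b) # ls)) a \<in> carrier N" if "a \<in> lists S" "b \<in> lists S" for a b
      by (rule part_sum_closed[OF N that(1)]) (use Suc.prems ys that in simp)
    have "T (part_sum N (Suc n) F xs) =
        split_sum M (\<lambda>a b. T (part_sum N n (\<lambda>ls. F ((x # b) # ls)) a)) ys"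
      unfolding Cons part_sum.simps by (rule split_sum_hom[OF N T ys(1) c])
    also have "\<dots> = part_sum M (Suc n) (\<lambda>ls. T (F ls)) xs"
      unfolding Cons part_sum.simps
      by (rule split_sum_cong[OF ys(1)], rule Suc.IH) (use Suc.prems ys in simp_all)
    finally show ?thesis .
  qed (use Suc.prems in simp)
qed

text \<open>Two uses: the formula of the counit, and \<open>part_sum\<close> truncated at 0, which
  vanishes on every nonempty word.\<close>

lemma sym_multilinear_const_zero:
  assumes N: "module k N" and c: "c \<in> carrier N"
  shows "sym_multilinear k V N (\<lambda>xs. if xs = [] then c else \<zero>\<^bsub>N\<^esub>)"
proof -
  interpret module k N by (rule N)
  show ?thesis
    by (rule sym_multilinearI) (simp_all add: c linear_on_const_zero[OF N])
qed

text \<open>The condition on the summand that makes its sum over set partitions symmetric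
  multilinear: it must be so in the letters of every block, and blind to the order of the blocks.
  The value at \<open>[]\<close> is mentioned separately since the second clause only reaches
  nonempty lists of blocks.\<close>

definition block_multilinear ::
  "'k ring \<Rightarrow> ('k, 'v) module \<Rightarrow> ('k, 'n) module \<Rightarrow> ('v list list \<Rightarrow> 'n) \<Rightarrow> bool" where
  "block_multilinear k V N F \<longleftrightarrow> F [] \<in> carrier N \<and>
     (\<forall>ls\<in>lists (lists (carrier V)). \<forall>ms\<in>lists (lists (carrier V)).
        sym_multilinear k V N (\<lambda>a. F (ls @ a # ms))) \<and>
     (\<forall>ls\<in>lists (lists (carrier V)). \<forall>ms\<in>lists (lists (carrier V)).
        mset ls = mset ms \<longrightarrow> F ls = F ms)"

lemma block_multilinearD:
  assumes "block_multilinear k V N F"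
  shows "ls \<in> lists (lists (carrier V)) \<Longrightarrow> F ls \<in> carrier N"
    and "ls \<in> lists (lists (carrier V)) \<Longrightarrow> ms \<in> lists (lists (carrier V)) \<Longrightarrow>
      sym_multilinear k V N (\<lambda>a. F (ls @ a # ms))"
    and "ls \<in> lists (lists (carrier V)) \<Longrightarrow> ms \<in> lists (lists (carrier V)) \<Longrightarrow>
      mset ls = mset ms \<Longrightarrow> F ls = F ms"
proof -
  show "sym_multilinear k V N (\<lambda>a. F (ls @ a # ms))"
    if "ls \<in> lists (lists (carrier V))" "ms \<in> lists (lists (carrier V))"
    using assms that unfolding block_multilinear_def by blast
  show "F ls = F ms" if "ls \<in> lists (lists (carrier V))" "ms \<in> lists (lists (carrier V))" "mset ls = mset ms"
    using assms that unfolding block_multilinear_def by blast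
  show "F ls \<in> carrier N" if "ls \<in> lists (lists (carrier V))"
  proof (cases ls)
    case Nil
    then show ?thesis using assms unfolding block_multilinear_def by blast
  next
    case (Cons a ms)
    then have "sym_multilinear k V N (\<lambda>a. F ([] @ a # ms))"
      using assms that unfolding block_multilinear_def by (meson Cons_in_lists_iff lists.Nil)
    from sym_multilinearD(1)[OF this, of a] Cons that show ?thesis by simp
  qed
qed

lemma block_multilinear_Cons:
  assumes F: "block_multilinear k V N F" and c: "c \<in> lists (carrier V)"
  shows "block_multilinear k V N (\<lambda>ls. F (c # ls))"
  unfolding block_multilinear_def
proof (intro conjI ballI impI)
  show "F [c] \<in> carrier N" by (rule block_multilinearD(1)[OF F]) (simp add: c)
  fix ls ms assume "ls \<in> lists (lists (carrier V))" "ms \<in> lists (lists (carrier V))"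
  then show "sym_multilinear k V N (\<lambda>a. F (c # ls @ a # ms))"
    and "mset ls = mset ms \<Longrightarrow> F (c # ls) = F (c # ms)"
    using block_multilinearD(2)[OF F, of "c # ls" ms] block_multilinearD(3)[OF F, of "c # ls" "c # ms"] c
    by simp_all
qed

text \<open>\<open>?\<Phi> x a b\<close> is the contribution in which \<open>x # b\<close> is the
  block of the first letter and \<open>a\<close> is left to be partitioned. It is symmetric
  multilinear in \<open>a\<close> by the induction hypothesis on the truncation, which covers words
  of any length, and in \<open>b\<close> directly from \<open>F\<close>. So every position after the
  first letter is handled by \<open>split_sum_sym_multilinear\<close>; the first position needs
  linearity of \<open>F\<close> in its first block, and the exchange of the first two letters is
  treated by hand.\<close>

lemma part_sum_sym_multilinear:
  assumes N: "module k N" and "block_multilinear k V N F"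
  shows "sym_multilinear k V N (part_sum N n F)"
  using assms(2)
proof (induction n arbitrary: F)
  case 0
  have "part_sum N 0 F xs = (if xs = [] then F [] else \<zero>\<^bsub>N\<^esub>)" for xs
    by (cases xs) simp_all
  moreover have "F [] \<in> carrier N" using 0 by (simp add: block_multilinear_def)
  ultimately show ?case using sym_multilinear_const_zero[OF N, of "F []" V] by (simp add: fun_eq_iff[symmetric])
next
  case (Suc n)
  let ?L = "lists (carrier V)"
  let ?\<Phi> = "\<lambda>x a b. part_sum N n (\<lambda>ls. F ((x # b) # ls)) a"
  have F: "sym_multilinear k V N (\<lambda>b. F (b # ls))" if "ls \<in> lists ?L" for ls
    using block_multilinearD(2)[OF Suc.prems, of "[]" ls] that by simp
  have \<Phi>1: "sym_multilinear k V N (\<lambda>a. ?\<Phi> x a b)" if "x \<in> carrier V" "b \<in> ?L" for x b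
    by (rule Suc.IH[OF block_multilinear_Cons[OF Suc.prems]]) (use that in simp)
  have \<Phi>2: "sym_multilinear k V N (?\<Phi> x a)" if x: "x \<in> carrier V" and a: "a \<in> ?L" for x a
  proof (rule sym_multilinearI)
    fix xs assume "xs \<in> ?L"
    then show "?\<Phi> x a xs \<in> carrier N" using sym_multilinearD(1)[OF \<Phi>1[OF x] a] by simp
  next
    fix xs ys assume "xs \<in> ?L" "ys \<in> ?L"
    then show "linear_on k V N (\<lambda>v. ?\<Phi> x a (xs @ v # ys))"
      using sym_multilinearD(2)[OF F, of _ "x # xs" ys] x
      by (intro part_sum_linear[OF N a]) simp
  next
    fix xs ys v w assume "xs \<in> ?L" "ys \<in> ?L" "v \<in> carrier V" "w \<in> carrier V"
    then show "?\<Phi> x a (xs @ v # w # ys) = ?\<Phi> x a (xs @ w # v # ys)"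
      using sym_multilinearD(3)[OF F, of _ "x # xs" ys v w] x
      by (intro part_sum_cong[OF a]) simp
  qed
  have sp: "sym_multilinear k V N (split_sum N (?\<Phi> x))" if "x \<in> carrier V" for x
    by (rule split_sum_sym_multilinear[OF N]) (use \<Phi>1 \<Phi>2 that in blast)+
  show ?case
  proof (rule sym_multilinearI)
    show "part_sum N (Suc n) F xs \<in> carrier N" if "xs \<in> ?L" for xs
      by (rule part_sum_closed[OF N that block_multilinearD(1)[OF Suc.prems]])
    show "linear_on k V N (\<lambda>v. part_sum N (Suc n) F (xs @ v # ys))" if "xs \<in> ?L" "ys \<in> ?L" for xs ys
    proof (cases xs)
      case Nil
      have "linear_on k V N (\<lambda>v. F ((v # b) # ls))" if "b \<in> ?L" "ls \<in> lists ?L" for b ls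
        using sym_multilinearD(2)[OF F, of ls "[]" b] that by simp
      then show ?thesis unfolding Nil append_Nil part_sum.simps
        by (intro split_sum_linear[OF N that(2)] part_sum_linear[OF N, of _ "carrier V"])
    next
      case (Cons x zs)
      with that have "x \<in> carrier V" "zs \<in> ?L" by auto
      then show ?thesis using sym_multilinearD(2)[OF sp _ that(2), of x zs] Cons by simp
    qed
    show "part_sum N (Suc n) F (xs @ v # w # ys) = part_sum N (Suc n) F (xs @ w # v # ys)"
      if "xs \<in> ?L" "ys \<in> ?L" "v \<in> carrier V" "w \<in> carrier V" for xs ys v w
    proof (cases xs)
      case (Cons x zs)
      with that have "x \<in> carrier V" "zs \<in> ?L" by auto
      then show ?thesis using sym_multilinearD(3)[OF sp _ that(2-4), of x zs] Cons by simp
    next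
      case Nil
      \<comment> \<open>Both letters lie in one block: symmetry of \<open>F\<close> in that
        block.\<close>
      have 1: "split_sum N (\<lambda>a b. ?\<Phi> v a (w # b)) ys = split_sum N (\<lambda>a b. ?\<Phi> w a (v # b)) ys"
        by (rule split_sum_cong[OF that(2)], rule part_sum_cong)
          (use sym_multilinearD(3)[OF F, of _ "[]" _ v w] that in simp_all)
      \<comment> \<open>The letters lie in different blocks \<open>v # b\<close> and
        \<open>w # d\<close>. One more recursion step exposes the second block; exchanging
        \<open>v\<close> and \<open>w\<close> then amounts to exchanging \<open>b\<close> with
        \<open>d\<close> by \<open>split_sum_nested_commute\<close> and reordering the two blocks.
        For \<open>n = 0\<close> there is no room for a second block and both sides vanish.\<close>
      have 2: "split_sum N (\<lambda>a b. ?\<Phi> v (w # a) b) ys = split_sum N (\<lambda>a b. ?\<Phi> w (v # a) b) ys"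
      proof (cases n)
        case (Suc m)
        let ?H = "\<lambda>v w c d b. part_sum N m (\<lambda>ls. F ((v # b) # (w # d) # ls)) c"
        have H: "?H v w c d b \<in> carrier N" if "c \<in> ?L" "d \<in> ?L" "b \<in> ?L" for c d b
          by (rule part_sum_closed[OF N that(1) block_multilinearD(1)[OF Suc.prems]])
            (use that \<open>v \<in> _\<close> \<open>w \<in> _\<close> in simp)
        have sw: "?H v w c b d = ?H w v c d b" if "c \<in> ?L" "d \<in> ?L" "b \<in> ?L" for c d b
          by (rule part_sum_cong[OF that(1)], rule block_multilinearD(3)[OF Suc.prems])
            (use that \<open>v \<in> _\<close> \<open>w \<in> _\<close> in simp_all)
        have "split_sum N (\<lambda>a b. split_sum N (\<lambda>c d. ?H v w c d b) a) ys =
          split_sum N (\<lambda>a b. split_sum N (\<lambda>c d. ?H v w c b d) a) ys"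
          by (rule split_sum_nested_commute[OF N that(2)]) (rule H)
        also have "\<dots> = split_sum N (\<lambda>a b. split_sum N (\<lambda>c d. ?H w v c d b) a) ys"
          by (rule split_sum_cong[OF that(2)], rule split_sum_cong[where S = "carrier V"], assumption, rule sw)
        finally show ?thesis by (simp add: Suc)
      qed simp
      show ?thesis using 1 2 Nil by simp
    qed
  qed
qed

section \<open>From subsets of an index set to splittings of a word\<close>

lemma nths_eq_map_sorted_list_of_set:
  assumes "C \<subseteq> {..<length xs}"
  shows "nths xs C = map ((!) xs) (sorted_list_of_set C)"
proof -
  have "set (nths [0..<length xs] C) = C"
    using assms by (force simp: set_nths)
  then have "nths [0..<length xs] C = sorted_list_of_set C"
    by (metis sorted_list_of_set.idem_if_sorted_distinct sorted_nths distinct_nthsI distinct_upt sorted_upt)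
  then show ?thesis
    by (metis map_nth nths_map)
qed

lemma map_sorted_list_of_set_insert_less:
  assumes "finite A" and "\<And>a. a \<in> A \<Longrightarrow> s < a" and "I \<subseteq> A"
  shows "map f (sorted_list_of_set (insert s I)) = f s # map f (sorted_list_of_set I)"
proof -
  have I: "finite I" "\<And>a. a \<in> I \<Longrightarrow> s < a"
    using assms finite_subset by auto
  have "sorted_list_of_set (insert s I) = insort s (sorted_list_of_set I)"
    using I by (subst sorted_list_of_set_insert) auto
  also have "\<dots> = s # sorted_list_of_set I"
    using I by (intro insort_is_Cons) (auto simp: less_imp_le)
  finally show ?thesis by (simp only: list.map)
qed

text \<open>The case of interest is \<open>A = {..<length xs}\<close> with
  \<open>f = (!) xs\<close>. A general ordered \<open>A\<close> is what lets the induction run: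
  removing the least index from an initial segment does not leave an initial segment.\<close>

lemma split_sum_finsum:
  fixes A :: "'i :: linorder set"
  assumes N: "module k N" and "finite A" and "f \<in> A \<rightarrow> S"
    and "\<And>a b. a \<in> lists S \<Longrightarrow> b \<in> lists S \<Longrightarrow> F a b \<in> carrier N"
  shows "(\<Oplus>\<^bsub>N\<^esub>I\<in>Pow A. F (map f (sorted_list_of_set I)) (map f (sorted_list_of_set (A - I)))) =
    split_sum N F (map f (sorted_list_of_set A))"
proof -
  interpret module k N by (rule N)
  have lst: "map f (sorted_list_of_set B) \<in> lists S" if "B \<subseteq> A" "finite A" "f \<in> A \<rightarrow> S" for A B
    using that finite_subset[OF that(1,2)] by (auto simp: in_lists_conv_set)
  show ?thesis using assms(2-)
  proof (induction A arbitrary: F rule: finite_linorder_min_induct)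
    case empty
    then show ?case by simp
  next
    case (insert s A)
    let ?m = "\<lambda>I. map f (sorted_list_of_set I)"
    have s: "s \<notin> A" "f s \<in> S" "f \<in> A \<rightarrow> S" using insert by auto
    have sl: "?m (insert s I) = f s # ?m I" if "I \<subseteq> A" for I
      by (rule map_sorted_list_of_set_insert_less[OF insert(1) _ that]) (use insert(2) in blast)
    have d: "insert s A - I = insert s (A - I)" if "I \<subseteq> A" for I using that s by auto
    have d': "insert s A - insert s I = A - I" for I using s by auto
    let ?g = "\<lambda>I. F (?m I) (?m (insert s A - I))"
    have inj: "inj_on (Set.insert s) (Pow A)" using s by (auto simp: inj_on_def)
    have g1: "?g I = F (?m I) (f s # ?m (A - I))" if "I \<in> Pow A" for I
      using that by (simp add: d sl)
    have g2: "?g (Set.insert s I) = F (f s # ?m I) (?m (A - I))" if "I \<in> Pow A" for I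
      using that by (simp add: d' sl)
    note L = lst[OF _ insert(1) s(3)]
    have c1: "F (?m I) (f s # ?m (A - I)) \<in> carrier N" "F (f s # ?m I) (?m (A - I)) \<in> carrier N"
      if "I \<in> Pow A" for I
      by (rule insert.prems(2); use that s(2) in \<open>simp add: L\<close>)+
    have cg: "?g \<in> Pow A \<rightarrow> carrier N" "?g \<in> Set.insert s ` Pow A \<rightarrow> carrier N"
      using c1 g1 g2 by (simp_all add: Pi_iff)
    \<comment> \<open>Since \<open>s\<close> is the least index, \<open>f s\<close> is the leading
      letter. The subsets avoiding \<open>s\<close> give the second summand of the recursion, those
      containing \<open>s\<close> the first.\<close>
    have "finsum N ?g (Pow (insert s A)) = finsum N ?g (Pow A) \<oplus>\<^bsub>N\<^esub> finsum N ?g (Set.insert s ` Pow A)"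
      unfolding Pow_insert using insert(1) s(1) cg by (intro M.finsum_Un_disjoint) auto
    also have "finsum N ?g (Set.insert s ` Pow A) = (\<Oplus>\<^bsub>N\<^esub>I\<in>Pow A. ?g (Set.insert s I))"
      by (rule M.finsum_reindex[OF cg(2) inj])
    also have "\<dots> = (\<Oplus>\<^bsub>N\<^esub>I\<in>Pow A. F (f s # ?m I) (?m (A - I)))"
      by (rule M.finsum_cong'[OF refl funcsetI[OF c1(2)] g2])
    also have "\<dots> = split_sum N (\<lambda>a b. F (f s # a) b) (?m A)"
      by (rule insert.IH[OF s(3)]) (simp add: insert.prems(2) s(2))
    also have "finsum N ?g (Pow A) = (\<Oplus>\<^bsub>N\<^esub>I\<in>Pow A. F (?m I) (f s # ?m (A - I)))"
      by (rule M.finsum_cong'[OF refl funcsetI[OF c1(1)] g1])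
    also have "\<dots> = split_sum N (\<lambda>a b. F a (f s # b)) (?m A)"
      by (rule insert.IH[OF s(3)]) (simp add: insert.prems(2) s(2))
    also have "\<dots> \<oplus>\<^bsub>N\<^esub> split_sum N (\<lambda>a b. F (f s # a) b) (?m A) = split_sum N F (?m (insert s A))"
      unfolding sl[OF order_refl] split_sum.simps
      by (rule M.a_comm; rule split_sum_closed[OF N L[OF order_refl]]; simp add: insert.prems(2) s(2))
    finally show ?case .
  qed
qed

section \<open>From set partitions of an index set to \<open>part_sum\<close>\<close>

lemma partitions_insert:
  assumes "s \<notin> A"
  shows "{\<C>. partition_on (insert s A) \<C>} =
    (\<Union>I\<in>Pow A. insert (insert s (A - I)) ` {\<C>. partition_on I \<C>})"
proof (rule subset_antisym; rule subsetI)
  fix \<C> assume "\<C> \<in> {\<C>. partition_on (insert s A) \<C>}"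
  then have \<C>: "partition_on (insert s A) \<C>" by simp
  then obtain B where B: "B \<in> \<C>" "s \<in> B" by (auto simp: partition_on_def)
  \<comment> \<open>\<open>I\<close> is the set covered by the remaining blocks, so that
    \<open>insert s (A - I)\<close> gives back \<open>B\<close>.\<close>
  define I where "I = insert s A - B"
  have sub: "B \<subseteq> insert s A" using \<C> B by (auto simp: partition_on_def)
  have "disjnt B (\<Union>(\<C> - {B}))"
    using \<C> B(1) by (fastforce simp: partition_on_def pairwise_def disjnt_def)
  moreover have "insert B (\<C> - {B}) = \<C>" using B(1) by blast
  ultimately have "partition_on I (\<C> - {B})"
    using \<C> partition_on_insert[of B "\<C> - {B}" "insert s A"] unfolding I_def by metis
  moreover have "I \<in> Pow A" "insert s (A - I) = B"
    using B(2) sub assms unfolding I_def by auto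
  ultimately have "insert B (\<C> - {B}) \<in> (\<Union>I\<in>Pow A. insert (insert s (A - I)) ` {\<C>. partition_on I \<C>})"
    by blast
  then show "\<C> \<in> (\<Union>I\<in>Pow A. insert (insert s (A - I)) ` {\<C>. partition_on I \<C>})"
    using \<open>insert B (\<C> - {B}) = \<C>\<close> by simp
next
  fix \<C> assume "\<C> \<in> (\<Union>I\<in>Pow A. insert (insert s (A - I)) ` {\<C>. partition_on I \<C>})"
  then obtain I \<D> where I: "I \<subseteq> A" "partition_on I \<D>" "\<C> = insert (insert s (A - I)) \<D>"
    by auto
  have "disjnt (insert s (A - I)) (\<Union>\<D>)" "insert s A - insert s (A - I) = I"
    using I(1) assms partition_onD1[OF I(2)] by (auto simp: disjnt_def)
  then show "\<C> \<in> {\<C>. partition_on (insert s A) \<C>}"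
    using I partition_on_insert[of "insert s (A - I)" \<D> "insert s A"] by auto
qed

text \<open>The block containing \<open>s\<close> determines \<open>I\<close>, so the families for
  different \<open>I\<close> are disjoint. Within one family, no block of a partition of
  \<open>I\<close> contains \<open>s\<close>, so adding the block of \<open>s\<close> is injective.
  Hence the sum can be iterated and reindexed.\<close>

lemma finsum_partitions_insert:
  assumes N: "module k N" and A: "finite A" "s \<notin> A"
    and g: "\<And>\<C>. partition_on (insert s A) \<C> \<Longrightarrow> g \<C> \<in> carrier N"
  shows "(\<Oplus>\<^bsub>N\<^esub>\<C>\<in>{\<C>. partition_on (insert s A) \<C>}. g \<C>) =
    (\<Oplus>\<^bsub>N\<^esub>I\<in>Pow A. \<Oplus>\<^bsub>N\<^esub>\<C>\<in>{\<C>. partition_on I \<C>}. g (insert (insert s (A - I)) \<C>))"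
proof -
  interpret module k N by (rule N)
  let ?Q = "\<lambda>I. insert (insert s (A - I)) ` {\<C>. partition_on I \<C>}"
  have fin: "finite {\<C>. partition_on I \<C>}" if "I \<in> Pow A" for I
    using that finitely_many_partition_on[of I] finite_subset[of I A] A by auto
  have notin: "s \<notin> B" if "I \<in> Pow A" "partition_on I \<C>" "B \<in> \<C>" for I \<C> B
    using that A(2) by (auto simp: partition_on_def)
  have cl: "g \<C> \<in> carrier N" if "I \<in> Pow A" "\<C> \<in> ?Q I" for I \<C>
    using that partitions_insert[OF A(2)] by (intro g) blast
  have dj: "pairwise (\<lambda>i j. disjnt (?Q i) (?Q j)) (Pow A)"
  proof (rule pairwiseI)
    fix I J assume IJ: "I \<in> Pow A" "J \<in> Pow A" "I \<noteq> J"
    have False if C: "\<C> \<in> ?Q I" "\<C> \<in> ?Q J" for \<C>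
    proof -
      obtain \<D> where D: "partition_on I \<D>" "\<C> = insert (insert s (A - I)) \<D>" using C(1) by blast
      obtain \<E> where E: "partition_on J \<E>" "\<C> = insert (insert s (A - J)) \<E>" using C(2) by blast
      have "insert s (A - J) \<in> insert (insert s (A - I)) \<D>"
        unfolding D(2)[symmetric] unfolding E(2) by (rule insertI1)
      moreover have "insert s (A - J) \<notin> \<D>" using notin[OF IJ(1) D(1)] by blast
      ultimately have "insert s (A - J) = insert s (A - I)" by (elim insertE) simp_all
      then have "A - J = A - I" using A(2) insert_ident[of s "A - J" "A - I"] by simp
      then show False using IJ by blast
    qed
    then show "disjnt (?Q I) (?Q J)" unfolding disjnt_def by blast
  qed
  have "(\<Oplus>\<^bsub>N\<^esub>\<C>\<in>{\<C>. partition_on (insert s A) \<C>}. g \<C>) = (\<Oplus>\<^bsub>N\<^esub>I\<in>Pow A. finsum N g (?Q I))"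
    unfolding partitions_insert[OF A(2)]
    by (rule M.add.finprod_UN_disjoint[OF _ _ dj cl, folded finsum_def]) (use A(1) fin in simp_all)
  also have "\<dots> = (\<Oplus>\<^bsub>N\<^esub>I\<in>Pow A. \<Oplus>\<^bsub>N\<^esub>\<C>\<in>{\<C>. partition_on I \<C>}. g (insert (insert s (A - I)) \<C>))"
  proof (rule M.finsum_cong')
    fix I assume I: "I \<in> Pow A"
    have "inj_on (insert (insert s (A - I))) {\<C>. partition_on I \<C>}"
    proof (rule inj_onI)
      fix \<C> \<D> assume "\<C> \<in> {\<C>. partition_on I \<C>}" "\<D> \<in> {\<C>. partition_on I \<C>}"
        and eq: "insert (insert s (A - I)) \<C> = insert (insert s (A - I)) \<D>"
      then have "insert s (A - I) \<notin> \<C>" "insert s (A - I) \<notin> \<D>" using notin[OF I] by blast+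
      then show "\<C> = \<D>" using eq by (metis insert_ident)
    qed
    then show "finsum N g (?Q I) = (\<Oplus>\<^bsub>N\<^esub>\<C>\<in>{\<C>. partition_on I \<C>}. g (insert (insert s (A - I)) \<C>))"
      using cl[OF I] by (intro M.finsum_reindex) auto
  next
    show "(\<lambda>I. \<Oplus>\<^bsub>N\<^esub>\<C>\<in>{\<C>. partition_on I \<C>}. g (insert (insert s (A - I)) \<C>)) \<in> Pow A \<rightarrow> carrier N"
      using cl by (intro funcsetI M.finsum_closed) auto
  qed simp
  finally show ?thesis .
qed

lemma blocks_finite:
  assumes "finite \<C>"
  shows "distinct (blocks \<C>)" and "set (blocks \<C>) = \<C>"
proof -
  have "distinct (blocks \<C>) \<and> set (blocks \<C>) = \<C>"
    unfolding blocks_def by (rule someI_ex) (use finite_distinct_list[OF assms] in blast)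
  then show "distinct (blocks \<C>)" and "set (blocks \<C>) = \<C>" by simp_all
qed

lemma blocks_empty: "blocks {} = []"
  using blocks_finite(2)[of "{}"] by simp

text \<open>As \<open>blocks\<close> is a choice, the lists for \<open>insert B \<C>\<close> and for
  \<open>\<C>\<close> need not be compatible as lists; only their multisets of entries can be
  compared.\<close>

lemma mset_blocks_insert:
  assumes "finite \<C>" and "B \<notin> \<C>"
  shows "mset (map f (blocks (insert B \<C>))) = mset (f B # map f (blocks \<C>))"
proof -
  have "mset (blocks \<D>) = mset_set \<D>" if "finite \<D>" for \<D>
    using mset_set_set[OF blocks_finite(1)[OF that]] blocks_finite(2)[OF that] by simp
  then show ?thesis using assms by simp
qed

text \<open>The induction follows the truncation, because the recursion passes from \<open>A\<close>
  to arbitrary subsets of the remaining indices. The bound on the cardinality survives, since each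
  step removes an index, and it keeps the truncated value zero from ever being reached.\<close>

lemma part_sum_finsum:
  fixes A :: "nat set"
  assumes N: "module k N" and "finite A" and "card A \<le> n" and "f \<in> A \<rightarrow> S"
    and "\<And>ls. ls \<in> lists (lists S) \<Longrightarrow> F ls \<in> carrier N"
    and "\<And>ls ms. ls \<in> lists (lists S) \<Longrightarrow> ms \<in> lists (lists S) \<Longrightarrow> mset ls = mset ms \<Longrightarrow> F ls = F ms"
  shows "(\<Oplus>\<^bsub>N\<^esub>\<C>\<in>{\<C>. partition_on A \<C>}. F (map (\<lambda>C. map f (sorted_list_of_set C)) (blocks \<C>))) =
    part_sum N n F (map f (sorted_list_of_set A))"
  using assms(2-)
proof (induction n arbitrary: A F)
  case (0 A F)
  interpret module k N by (rule N)
  have "A = {}" using 0(1,2) by simp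
  moreover have "F [] \<in> carrier N" by (rule 0(4)) simp
  ultimately show ?case by (simp add: partition_on_empty blocks_empty)
next
  case (Suc n A F)
  interpret module k N by (rule N)
  let ?m = "\<lambda>I. map f (sorted_list_of_set I)"
  show ?case
  proof (cases "A = {}")
    case True
    moreover have "F [] \<in> carrier N" by (rule Suc.prems(4)) simp
    ultimately show ?thesis by (simp add: partition_on_empty blocks_empty)
  next
    case False
    \<comment> \<open>The least index belongs to the first letter of the word, whose block
      \<open>part_sum\<close> splits off.\<close>
    define s where "s = Min A"
    define A' where "A' = A - {s}"
    have s: "s \<in> A" "\<And>a. a \<in> A \<Longrightarrow> s \<le> a" using False Suc.prems(1) by (simp_all add: s_def)
    have A: "A = insert s A'" "finite A'" "s \<notin> A'" "\<And>a. a \<in> A' \<Longrightarrow> s < a"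
      using s Suc.prems(1) by (auto simp: A'_def order.strict_iff_order)
    have card: "card A' \<le> n" using Suc.prems(1,2) A by simp
    have f: "f s \<in> S" "f \<in> A' \<rightarrow> S" using Suc.prems(3) A by auto
    have sl: "?m (insert s I) = f s # ?m I" if "I \<subseteq> A'" for I
      by (rule map_sorted_list_of_set_insert_less[OF A(2,4) that])
    have L: "?m I \<in> lists S" if "I \<subseteq> A" for I
      using Suc.prems(1,3) finite_subset[OF that] that by (auto simp: in_lists_conv_set)
    have LL: "map ?m (blocks \<C>) \<in> lists (lists S)" if "partition_on I \<C>" "I \<subseteq> A" for I \<C>
    proof -
      have "finite \<C>" "\<Union>\<C> \<subseteq> A"
        using that Suc.prems(1) finite_elements[of I \<C>] finite_subset[of I A] by (auto simp: partition_on_def)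
      then have "C \<subseteq> A" if "C \<in> set (blocks \<C>)" for C
        using that blocks_finite(2)[of \<C>] by auto
      then have "?m C \<in> lists S" if "C \<in> set (blocks \<C>)" for C
        by (rule L) (rule that)
      then show ?thesis by (intro in_listsI) simp
    qed
    let ?F = "\<lambda>b ls. F ((f s # b) # ls)"
    have F: "?F b ls \<in> carrier N" if "b \<in> lists S" "ls \<in> lists (lists S)" for b ls
      using that f(1) by (intro Suc.prems(4)) simp
    have g: "F (map ?m (blocks \<C>)) \<in> carrier N" if "partition_on A \<C>" for \<C>
      by (rule Suc.prems(4)[OF LL[OF that order_refl]])
    \<comment> \<open>The two lists of blocks agree only up to order, which is where invariance of
      \<open>F\<close> under permutations is used.\<close>
    have term_eq: "F (map ?m (blocks (insert (insert s (A' - I)) \<C>))) = ?F (?m (A' - I)) (map ?m (blocks \<C>))"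
      if I: "I \<subseteq> A'" and \<C>: "partition_on I \<C>" for I \<C>
    proof (rule Suc.prems(5))
      have "partition_on A (insert (insert s (A' - I)) \<C>)"
        using partitions_insert[OF A(3)] that unfolding A(1) by blast
      then show "map ?m (blocks (insert (insert s (A' - I)) \<C>)) \<in> lists (lists S)"
        by (rule LL) simp
      show "(f s # ?m (A' - I)) # map ?m (blocks \<C>) \<in> lists (lists S)"
        using LL[OF \<C>] L[of "A' - I"] I f(1) A(1) by auto
      have "finite \<C>" "insert s (A' - I) \<notin> \<C>"
        using \<C> I A(2,3) finite_elements[of I \<C>] finite_subset[of I A'] by (auto simp: partition_on_def)
      from mset_blocks_insert[OF this, of ?m]
      show "mset (map ?m (blocks (insert (insert s (A' - I)) \<C>))) = mset ((f s # ?m (A' - I)) # map ?m (blocks \<C>))"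
        using sl[of "A' - I"] by simp
    qed
    have "(\<Oplus>\<^bsub>N\<^esub>\<C>\<in>{\<C>. partition_on A \<C>}. F (map ?m (blocks \<C>))) =
      (\<Oplus>\<^bsub>N\<^esub>I\<in>Pow A'. \<Oplus>\<^bsub>N\<^esub>\<C>\<in>{\<C>. partition_on I \<C>}. F (map ?m (blocks (insert (insert s (A' - I)) \<C>))))"
      using finsum_partitions_insert[OF N A(2,3), of "\<lambda>\<C>. F (map ?m (blocks \<C>))"] g unfolding A(1) by simp
    also have "\<dots> = (\<Oplus>\<^bsub>N\<^esub>I\<in>Pow A'. part_sum N n (?F (?m (A' - I))) (?m I))"
    proof (rule M.finsum_cong')
      fix I assume "I \<in> Pow A'"
      then have I: "I \<subseteq> A'" "I \<subseteq> A" "A' - I \<subseteq> A" using A(1) by auto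
      have "(\<Oplus>\<^bsub>N\<^esub>\<C>\<in>{\<C>. partition_on I \<C>}. F (map ?m (blocks (insert (insert s (A' - I)) \<C>)))) =
        (\<Oplus>\<^bsub>N\<^esub>\<C>\<in>{\<C>. partition_on I \<C>}. ?F (?m (A' - I)) (map ?m (blocks \<C>)))"
        by (rule M.finsum_cong') (use term_eq[OF I(1)] F[OF L[OF I(3)] LL[OF _ I(2)]] in auto)
      also have "\<dots> = part_sum N n (?F (?m (A' - I))) (?m I)"
      proof (rule Suc.IH)
        show "finite I" "card I \<le> n" "f \<in> I \<rightarrow> S"
          using I(1) A(2) card f(2) finite_subset card_mono[OF A(2) I(1)] by auto
        show "?F (?m (A' - I)) ls \<in> carrier N" if "ls \<in> lists (lists S)" for ls
          by (rule F[OF L[OF I(3)] that])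
        show "?F (?m (A' - I)) ls = ?F (?m (A' - I)) ms"
          if "ls \<in> lists (lists S)" "ms \<in> lists (lists S)" "mset ls = mset ms" for ls ms
          using that L[OF I(3)] f(1) by (intro Suc.prems(5)) simp_all
      qed
      finally show "(\<Oplus>\<^bsub>N\<^esub>\<C>\<in>{\<C>. partition_on I \<C>}. F (map ?m (blocks (insert (insert s (A' - I)) \<C>)))) =
        part_sum N n (?F (?m (A' - I))) (?m I)" .
    next
      show "(\<lambda>I. part_sum N n (?F (?m (A' - I))) (?m I)) \<in> Pow A' \<rightarrow> carrier N"
      proof (rule funcsetI)
        fix I assume "I \<in> Pow A'"
        then have I: "I \<subseteq> A" "A' - I \<subseteq> A" using A(1) by auto
        show "part_sum N n (?F (?m (A' - I))) (?m I) \<in> carrier N"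
          by (rule part_sum_closed[OF N L[OF I(1)] F[OF L[OF I(2)]]])
      qed
    qed simp
    also have "\<dots> = split_sum N (\<lambda>a b. part_sum N n (?F b) a) (?m A')"
      by (rule split_sum_finsum[OF N A(2) f(2), of "\<lambda>a b. part_sum N n (?F b) a"])
        (rule part_sum_closed[OF N _ F])
    also have "\<dots> = part_sum N (Suc n) F (?m A)"
      unfolding A(1) sl[OF order_refl] by simp
    finally show ?thesis .
  qed
qed

section \<open>Back to words: sums over \<open>nths\<close>\<close>

lemma sym_multilinear_cong:
  assumes g: "sym_multilinear k V N g" and V: "module k V"
    and eq: "\<And>xs. xs \<in> lists (carrier V) \<Longrightarrow> h xs = g xs"
  shows "sym_multilinear k V N h"
proof (rule sym_multilinearI)
  show "h xs \<in> carrier N" if "xs \<in> lists (carrier V)" for xs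
    using sym_multilinearD(1)[OF g that] eq[OF that] by simp
  show "linear_on k V N (\<lambda>v. h (xs @ v # ys))" if "xs \<in> lists (carrier V)" "ys \<in> lists (carrier V)" for xs ys
    by (rule linear_on_cong[OF sym_multilinearD(2)[OF g that] V]) (simp add: eq that)
  show "h (xs @ v # w # ys) = h (xs @ w # v # ys)"
    if "xs \<in> lists (carrier V)" "ys \<in> lists (carrier V)" "v \<in> carrier V" "w \<in> carrier V" for xs ys v w
    using sym_multilinearD(3)[OF g that] that by (simp add: eq)
qed

lemma split_sum_nths:
  assumes N: "module k N" and xs: "xs \<in> lists S"
    and F: "\<And>a b. a \<in> lists S \<Longrightarrow> b \<in> lists S \<Longrightarrow> F a b \<in> carrier N"
  shows "(\<Oplus>\<^bsub>N\<^esub>I\<in>Pow {..<length xs}. F (nths xs I) (nths xs ({..<length xs} - I))) = split_sum N F xs"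
proof -
  interpret module k N by (rule N)
  have mem: "nths xs I \<in> lists S" for I
    using xs set_nths_subset[of xs I] by (auto simp: in_lists_conv_set)
  have "(\<Oplus>\<^bsub>N\<^esub>I\<in>Pow {..<length xs}. F (nths xs I) (nths xs ({..<length xs} - I))) =
    (\<Oplus>\<^bsub>N\<^esub>I\<in>Pow {..<length xs}. F (map ((!) xs) (sorted_list_of_set I)) (map ((!) xs) (sorted_list_of_set ({..<length xs} - I))))"
    by (rule M.finsum_cong') (use F[OF mem mem] in \<open>auto simp: nths_eq_map_sorted_list_of_set[symmetric]\<close>)
  also have "\<dots> = split_sum N F (map ((!) xs) (sorted_list_of_set {..<length xs}))"
    by (rule split_sum_finsum[OF N _ _ F]) (use xs in \<open>auto simp: in_lists_conv_set\<close>)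
  also have "map ((!) xs) (sorted_list_of_set {..<length xs}) = xs"
    by (simp add: lessThan_atLeast0 map_nth)
  finally show ?thesis .
qed

text \<open>Any bound \<open>n\<close> that is at least the length gives the same value, so later
  \<open>n\<close> can be chosen uniformly for all parts of a word.\<close>

lemma part_sum_nths:
  assumes N: "module k N" and F: "block_multilinear k V N F"
    and xs: "xs \<in> lists (carrier V)" "length xs \<le> n"
  shows "(\<Oplus>\<^bsub>N\<^esub>\<C>\<in>{\<C>. partition_on {..<length xs} \<C>}. F (map (nths xs) (blocks \<C>))) = part_sum N n F xs"
proof -
  interpret module k N by (rule N)
  have mem: "nths xs I \<in> lists (carrier V)" for I
    using xs(1) set_nths_subset[of xs I] by (auto simp: in_lists_conv_set)
  have mem': "map (nths xs) Cs \<in> lists (lists (carrier V))" for Cs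
    using mem by (induction Cs) simp_all
  have eq: "map (nths xs) (blocks \<C>) = map (\<lambda>C. map ((!) xs) (sorted_list_of_set C)) (blocks \<C>)"
    if "partition_on {..<length xs} \<C>" for \<C>
  proof (rule map_cong[OF refl])
    fix C assume "C \<in> set (blocks \<C>)"
    then have "C \<subseteq> {..<length xs}"
      using blocks_finite(2)[OF finite_elements[OF finite_lessThan that]] partition_onD1[OF that] by auto
    then show "nths xs C = map ((!) xs) (sorted_list_of_set C)"
      by (rule nths_eq_map_sorted_list_of_set)
  qed
  have "(\<Oplus>\<^bsub>N\<^esub>\<C>\<in>{\<C>. partition_on {..<length xs} \<C>}. F (map (nths xs) (blocks \<C>))) =
    (\<Oplus>\<^bsub>N\<^esub>\<C>\<in>{\<C>. partition_on {..<length xs} \<C>}. F (map (\<lambda>C. map ((!) xs) (sorted_list_of_set C)) (blocks \<C>)))"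
    by (rule M.finsum_cong') (use block_multilinearD(1)[OF F mem'] in \<open>auto simp: eq[symmetric]\<close>)
  also have "\<dots> = part_sum N n F (map ((!) xs) (sorted_list_of_set {..<length xs}))"
    by (rule part_sum_finsum[OF N _ _ _ block_multilinearD(1)[OF F] block_multilinearD(3)[OF F]])
      (use xs in \<open>auto simp: in_lists_conv_set\<close>)
  also have "map ((!) xs) (sorted_list_of_set {..<length xs}) = xs"
    by (simp add: lessThan_atLeast0 map_nth)
  finally show ?thesis .
qed

section \<open>The structure maps on kets\<close>

lemma coproduct_linear_ket:
  assumes k: "cring k" and V: "module k V"
  shows coproduct_linear: "linear_on k (bang k V) (tensor k (bang k V) (bang k V)) (coproduct k V)"
    and coproduct_ket: "P \<in> carrier V \<Longrightarrow> xs \<in> lists (carrier V) \<Longrightarrow>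
      coproduct k V (ket k V P xs) = split_sum (tensor k (bang k V) (bang k V))
        (\<lambda>a b. pure_tensor k (bang k V) (bang k V) (ket k V P a) (ket k V P b)) xs"
proof -
  let ?B = "bang k V" let ?T = "tensor k ?B ?B"
  let ?F = "\<lambda>P a b. pure_tensor k ?B ?B (ket k V P a) (ket k V P b)"
  note B = module_bang[OF k V]
  note T = module_tensor[OF k B B]
  have F: "?F P a b \<in> carrier ?T" if "P \<in> carrier V" "a \<in> lists (carrier V)" "b \<in> lists (carrier V)" for P a b
    by (rule pure_tensor_closed[OF k B B ket_closed[OF k V that(1,2)] ket_closed[OF k V that(1,3)]])
  have eq: "(\<Oplus>\<^bsub>?T\<^esub>I\<in>Pow {..<length xs}. ?F P (nths xs I) (nths xs ({..<length xs} - I))) = split_sum ?T (?F P) xs"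
    if "P \<in> carrier V" "xs \<in> lists (carrier V)" for P xs
    by (rule split_sum_nths[OF T that(2) F[OF that(1)]])
  have sym: "sym_multilinear k V ?T
      (\<lambda>xs. \<Oplus>\<^bsub>?T\<^esub>I\<in>Pow {..<length xs}. ?F P (nths xs I) (nths xs ({..<length xs} - I)))"
    if P: "P \<in> carrier V" for P
  proof (rule sym_multilinear_cong[OF split_sum_sym_multilinear[OF T] V eq[OF P]])
    fix a assume a: "a \<in> lists (carrier V)"
    show "sym_multilinear k V ?T (\<lambda>b. ?F P b a)"
      by (rule sym_multilinear_comp[OF ket_sym_multilinear[OF k V P] pure_tensor_linear1[OF k B B ket_closed[OF k V P a]]])
    show "sym_multilinear k V ?T (?F P a)"
      by (rule sym_multilinear_comp[OF ket_sym_multilinear[OF k V P] pure_tensor_linear2[OF k B B ket_closed[OF k V P a]]])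
  qed
  show "linear_on k ?B ?T (coproduct k V)"
    unfolding coproduct_def by (rule bang_lift_linear[OF k V T sym])
  show "coproduct k V (ket k V P xs) = split_sum ?T (?F P) xs"
    if "P \<in> carrier V" "xs \<in> lists (carrier V)"
    using bang_lift_ket[OF k V T sym that] eq[OF that] unfolding coproduct_def by simp
qed

lemma counit_linear_ket:
  assumes k: "cring k" and V: "module k V"
  shows counit_linear: "linear_on k (bang k V) (scalars k) (counit k V)"
    and counit_ket: "P \<in> carrier V \<Longrightarrow> xs \<in> lists (carrier V) \<Longrightarrow>
      counit k V (ket k V P xs) = (if xs = [] then \<one>\<^bsub>k\<^esub> else \<zero>\<^bsub>k\<^esub>)"
proof -
  interpret cring k by (rule k)
  have sym: "sym_multilinear k V (scalars k) (\<lambda>xs. if xs = [] then \<one>\<^bsub>k\<^esub> else \<zero>\<^bsub>k\<^esub>)"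
  proof -
    have "\<one>\<^bsub>k\<^esub> \<in> carrier (scalars k)" "\<zero>\<^bsub>scalars k\<^esub> = \<zero>\<^bsub>k\<^esub>" by (simp_all add: scalars_def)
    then show ?thesis
      using sym_multilinear_const_zero[OF module_scalars[OF k], of "\<one>\<^bsub>k\<^esub>" V] by (simp cong: if_cong)
  qed
  show "linear_on k (bang k V) (scalars k) (counit k V)"
    unfolding counit_def by (rule bang_lift_linear[OF k V module_scalars[OF k] sym])
  show "counit k V (ket k V P xs) = (if xs = [] then \<one>\<^bsub>k\<^esub> else \<zero>\<^bsub>k\<^esub>)"
    if "P \<in> carrier V" "xs \<in> lists (carrier V)"
    unfolding counit_def by (rule bang_lift_ket[OF k V module_scalars[OF k] sym that])
qed

text \<open>The base point \<open>P\<close> is returned only for the empty word, which has no letter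
  to vary, so its presence does not disturb multilinearity. On one letter the formula is the
  identity, and on longer words it is constantly zero.\<close>

lemma dereliction_linear_ket:
  assumes k: "cring k" and V: "module k V"
  shows dereliction_linear: "linear_on k (bang k V) V (dereliction k V)"
    and dereliction_ket: "P \<in> carrier V \<Longrightarrow> xs \<in> lists (carrier V) \<Longrightarrow>
      dereliction k V (ket k V P xs) = (case xs of [] \<Rightarrow> P | [\<nu>] \<Rightarrow> \<nu> | _ \<Rightarrow> \<zero>\<^bsub>V\<^esub>)"
proof -
  interpret V: module k V by (rule V)
  have sym: "sym_multilinear k V V (\<lambda>xs. case xs of [] \<Rightarrow> P | [\<nu>] \<Rightarrow> \<nu> | _ \<Rightarrow> \<zero>\<^bsub>V\<^esub>)"
    if P: "P \<in> carrier V" for P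
  proof (rule sym_multilinearI)
    show "(case xs of [] \<Rightarrow> P | [\<nu>] \<Rightarrow> \<nu> | _ \<Rightarrow> \<zero>\<^bsub>V\<^esub>) \<in> carrier V" if "xs \<in> lists (carrier V)" for xs
      using P that by (auto split: list.split)
    show "linear_on k V V (\<lambda>v. case xs @ v # ys of [] \<Rightarrow> P | [\<nu>] \<Rightarrow> \<nu> | _ \<Rightarrow> \<zero>\<^bsub>V\<^esub>)" for xs ys
    proof (cases "xs = [] \<and> ys = []")
      case True
      then show ?thesis by (simp add: linear_on_ident[OF V])
    next
      case False
      then have "(case xs @ v # ys of [] \<Rightarrow> P | [\<nu>] \<Rightarrow> \<nu> | _ \<Rightarrow> \<zero>\<^bsub>V\<^esub>) = \<zero>\<^bsub>V\<^esub>" for v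
        by (cases xs; cases ys) (auto split: list.split)
      then show ?thesis by (simp add: linear_on_const_zero[OF V])
    qed
    show "(case xs @ v # w # ys of [] \<Rightarrow> P | [\<nu>] \<Rightarrow> \<nu> | _ \<Rightarrow> \<zero>\<^bsub>V\<^esub>) =
        (case xs @ w # v # ys of [] \<Rightarrow> P | [\<nu>] \<Rightarrow> \<nu> | _ \<Rightarrow> \<zero>\<^bsub>V\<^esub>)" for xs ys v w
      by (cases xs) (auto split: list.split)
  qed
  show "linear_on k (bang k V) V (dereliction k V)"
    unfolding dereliction_def by (rule bang_lift_linear[OF k V V sym])
  show "dereliction k V (ket k V P xs) = (case xs of [] \<Rightarrow> P | [\<nu>] \<Rightarrow> \<nu> | _ \<Rightarrow> \<zero>\<^bsub>V\<^esub>)"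
    if "P \<in> carrier V" "xs \<in> lists (carrier V)"
    unfolding dereliction_def by (rule bang_lift_ket[OF k V V sym that])
qed

lemma bang_map_linear_ket:
  assumes k: "cring k" and V: "module k V" and W: "module k W" and f: "linear_on k V W f"
  shows bang_map_linear: "linear_on k (bang k V) (bang k W) (bang_map k V W f)"
    and bang_map_ket: "P \<in> carrier V \<Longrightarrow> xs \<in> lists (carrier V) \<Longrightarrow>
      bang_map k V W f (ket k V P xs) = ket k W (f P) (map f xs)"
proof -
  have sym: "sym_multilinear k V (bang k W) (\<lambda>xs. ket k W (f P) (map f xs))" if P: "P \<in> carrier V" for P
    by (rule sym_multilinear_map[OF ket_sym_multilinear[OF k W linear_onD(1)[OF f P]] f])
  show "linear_on k (bang k V) (bang k W) (bang_map k V W f)"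
    unfolding bang_map_def by (rule bang_lift_linear[OF k V module_bang[OF k W] sym])
  show "bang_map k V W f (ket k V P xs) = ket k W (f P) (map f xs)"
    if "P \<in> carrier V" "xs \<in> lists (carrier V)"
    unfolding bang_map_def by (rule bang_lift_ket[OF k V module_bang[OF k W] sym that])
qed

text \<open>The outer ket is multilinear and symmetric in its entries, and each entry is an inner
  ket, multilinear and symmetric in the letters of its block. This makes the summand of promotion
  eligible for the results on \<open>part_sum\<close>.\<close>

lemma ket_block_multilinear:
  assumes k: "cring k" and V: "module k V" and P: "P \<in> carrier V" and Q: "Q \<in> carrier (bang k V)"
  shows "block_multilinear k V (bang k (bang k V)) (\<lambda>ls. ket k (bang k V) Q (map (ket k V P) ls))"
  unfolding block_multilinear_def
proof (intro conjI ballI impI)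
  let ?B = "bang k V"
  note B = module_bang[OF k V]
  note K = ket_sym_multilinear[OF k B Q]
  have m: "map (ket k V P) ls \<in> lists (carrier ?B)" if "ls \<in> lists (lists (carrier V))" for ls
    using that by (induction ls rule: list.induct) (simp_all add: ket_closed[OF k V P])
  show "ket k ?B Q (map (ket k V P) []) \<in> carrier (bang k ?B)"
    by (simp add: ket_closed[OF k B Q])
  fix ls ms assume ls: "ls \<in> lists (lists (carrier V))" and ms: "ms \<in> lists (lists (carrier V))"
  show "sym_multilinear k V (bang k ?B) (\<lambda>a. ket k ?B Q (map (ket k V P) (ls @ a # ms)))"
    using sym_multilinear_comp[OF ket_sym_multilinear[OF k V P] sym_multilinearD(2)[OF K m[OF ls] m[OF ms]]]
    by simp
  show "ket k ?B Q (map (ket k V P) ls) = ket k ?B Q (map (ket k V P) ms)" if "mset ls = mset ms"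
    by (rule sym_multilinear_mset[OF K _ m[OF ls] m[OF ms]]) (simp add: that)
qed

lemma promotion_linear_ket:
  assumes k: "cring k" and V: "module k V"
  shows promotion_linear: "linear_on k (bang k V) (bang k (bang k V)) (promotion k V)"
    and promotion_ket: "P \<in> carrier V \<Longrightarrow> xs \<in> lists (carrier V) \<Longrightarrow> length xs \<le> n \<Longrightarrow>
      promotion k V (ket k V P xs) = part_sum (bang k (bang k V)) n
        (\<lambda>ls. ket k (bang k V) (ket k V P []) (map (ket k V P) ls)) xs"
proof -
  let ?B = "bang k V" let ?BB = "bang k ?B"
  let ?F = "\<lambda>P ls. ket k ?B (ket k V P []) (map (ket k V P) ls)"
  let ?G = "\<lambda>P xs. \<Oplus>\<^bsub>?BB\<^esub>\<C>\<in>{\<C>. partition_on {..<length xs} \<C>}.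
        ket k ?B (ket k V P []) (map (\<lambda>C. ket k V P (nths xs C)) (blocks \<C>))"
  note B = module_bang[OF k V]
  note BB = module_bang[OF k B]
  have F: "block_multilinear k V ?BB (?F P)" if "P \<in> carrier V" for P
    by (rule ket_block_multilinear[OF k V that ket_closed[OF k V that]]) simp
  have eq: "?G P xs = part_sum ?BB n (?F P) xs"
    if "P \<in> carrier V" "xs \<in> lists (carrier V)" "length xs \<le> n" for P xs n
    using part_sum_nths[OF BB F[OF that(1)] that(2,3)] by (simp add: comp_def)
  have sym: "sym_multilinear k V ?BB (?G P)" if P: "P \<in> carrier V" for P
  proof (rule sym_multilinear_cong[OF _ V eq[OF P _ order_refl]])
    note S = sym_multilinearD[OF part_sum_sym_multilinear[OF BB F[OF P]]]
    \<comment> \<open>The truncation depends on the word, but only through its length, which neither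
      varying a letter nor exchanging neighbours changes; so the result for a fixed truncation
      applies.\<close>
    show "sym_multilinear k V ?BB (\<lambda>xs. part_sum ?BB (length xs) (?F P) xs)"
      by (rule sym_multilinearI) (simp_all only: length_append list.size S)
  qed
  show "linear_on k ?B ?BB (promotion k V)"
    unfolding promotion_def by (rule bang_lift_linear[OF k V BB sym])
  show "promotion k V (ket k V P xs) = part_sum ?BB n (?F P) xs"
    if "P \<in> carrier V" "xs \<in> lists (carrier V)" "length xs \<le> n"
    using bang_lift_ket[OF k V BB sym that(1,2)] eq[OF that] unfolding promotion_def by simp
qed

text \<open>For fixed \<nu>, prefixing \<nu> is symmetric multilinear in the word and lifts to an
  endomorphism \<open>?b \<nu>\<close> of \<open>bang k V\<close>. Its linearity in \<nu> is checked
  on kets, and the resulting bilinear map lifts to the tensor product.\<close>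

lemma deriv_map_ex1:
  assumes k: "cring k" and V: "module k V"
  shows "\<exists>!f. f \<in> linear_maps k (tensor k (bang k V) V) (bang k V) \<and>
     (\<forall>P\<in>carrier V. \<forall>\<nu>s\<in>lists (carrier V). \<forall>\<nu>\<in>carrier V.
        f (pure_tensor k (bang k V) V (ket k V P \<nu>s) \<nu>) = ket k V P (\<nu> # \<nu>s))"
proof (rule ex_ex1I)
  let ?B = "bang k V" let ?T = "tensor k ?B V"
  let ?b = "\<lambda>\<nu>. bang_lift k V ?B (\<lambda>P \<nu>s. ket k V P (\<nu> # \<nu>s))"
  interpret V: module k V by (rule V)
  note B = module_bang[OF k V]
  note T = module_tensor[OF k B V]
  note K = ket_sym_multilinear[OF k V]
  have b: "linear_on k ?B ?B (?b \<nu>)" if "\<nu> \<in> carrier V" for \<nu>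
    by (rule bang_lift_linear[OF k V B sym_multilinear_Cons[OF K that]])
  have bk: "?b \<nu> (ket k V P \<nu>s) = ket k V P (\<nu> # \<nu>s)"
    if "\<nu> \<in> carrier V" "P \<in> carrier V" "\<nu>s \<in> lists (carrier V)" for P \<nu> \<nu>s
    by (rule bang_lift_ket[OF k V B sym_multilinear_Cons[OF K that(1)] that(2,3)])
  have b2: "linear_on k V ?B (\<lambda>\<nu>. ?b \<nu> x)" if x: "x \<in> carrier ?B" for x
  proof (rule linear_onI)
    fix v assume "v \<in> carrier V"
    then show "?b v x \<in> carrier ?B" by (rule linear_onD(1)[OF b x])
  next
    fix v w assume v: "v \<in> carrier V" "w \<in> carrier V"
    show "?b (v \<oplus>\<^bsub>V\<^esub> w) x = ?b v x \<oplus>\<^bsub>?B\<^esub> ?b w x"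
      by (rule bang_ext[OF k V B b linear_on_add[OF b b B] _ x])
        (use v linear_onD(2)[OF sym_multilinearD(2)[OF K], of _ "[]" _ v w] in \<open>simp_all add: bk\<close>)
  next
    fix c v assume v: "c \<in> carrier k" "v \<in> carrier V"
    show "?b (c \<odot>\<^bsub>V\<^esub> v) x = c \<odot>\<^bsub>?B\<^esub> ?b v x"
      by (rule bang_ext[OF k V B b linear_on_smult[OF b B] _ x])
        (use v linear_onD(3)[OF sym_multilinearD(2)[OF K], of _ "[]" _ c v] in \<open>simp_all add: bk\<close>)
  qed
  let ?f = "tensor_lift k ?B V ?B (\<lambda>x \<nu>. ?b \<nu> x)"
  have f: "linear_on k ?T ?B ?f" by (rule tensor_lift_linear[OF k B V B b b2])
  have fp: "?f (pure_tensor k ?B V x \<nu>) = ?b \<nu> x" if "x \<in> carrier ?B" "\<nu> \<in> carrier V" for x \<nu>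
    by (rule tensor_lift_pure[OF k B V B b b2 that])
  show "\<exists>f. f \<in> linear_maps k ?T ?B \<and> (\<forall>P\<in>carrier V. \<forall>\<nu>s\<in>lists (carrier V). \<forall>\<nu>\<in>carrier V.
        f (pure_tensor k ?B V (ket k V P \<nu>s) \<nu>) = ket k V P (\<nu> # \<nu>s))"
    by (rule exI[of _ "restrict ?f (carrier ?T)"])
      (simp add: restrict_linear_maps[OF f T] pure_tensor_closed[OF k B V] ket_closed[OF k V] fp bk)
  fix f g
  assume f: "f \<in> linear_maps k ?T ?B \<and> (\<forall>P\<in>carrier V. \<forall>\<nu>s\<in>lists (carrier V). \<forall>\<nu>\<in>carrier V.
        f (pure_tensor k ?B V (ket k V P \<nu>s) \<nu>) = ket k V P (\<nu> # \<nu>s))"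
    and g: "g \<in> linear_maps k ?T ?B \<and> (\<forall>P\<in>carrier V. \<forall>\<nu>s\<in>lists (carrier V). \<forall>\<nu>\<in>carrier V.
        g (pure_tensor k ?B V (ket k V P \<nu>s) \<nu>) = ket k V P (\<nu> # \<nu>s))"
  show "f = g"
  proof
    fix t
    show "f t = g t"
    proof (cases "t \<in> carrier ?T")
      case True
      show ?thesis
        by (rule tensor_bang_ext[OF k V V B linear_on_linear_maps[OF conjunct1[OF f]]
              linear_on_linear_maps[OF conjunct1[OF g]] _ True])
          (use conjunct2[OF f] conjunct2[OF g] in simp)
    next
      case False
      show ?thesis
        using linear_mapsD(2)[OF conjunct1[OF f] False] linear_mapsD(2)[OF conjunct1[OF g] False]
        by (rule trans[OF _ sym])
    qed
  qed
qed

lemma deriv_map_linear_maps_ket: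
  assumes k: "cring k" and V: "module k V"
  shows deriv_map_linear_maps: "deriv_map k V \<in> linear_maps k (tensor k (bang k V) V) (bang k V)"
    and deriv_map_ket: "P \<in> carrier V \<Longrightarrow> \<nu>s \<in> lists (carrier V) \<Longrightarrow> \<nu> \<in> carrier V \<Longrightarrow>
      deriv_map k V (pure_tensor k (bang k V) V (ket k V P \<nu>s) \<nu>) = ket k V P (\<nu> # \<nu>s)"
proof -
  note T = theI'[OF deriv_map_ex1[OF k V], folded deriv_map_def]
  show "deriv_map k V \<in> linear_maps k (tensor k (bang k V) V) (bang k V)"
    by (rule conjunct1[OF T])
  show "deriv_map k V (pure_tensor k (bang k V) V (ket k V P \<nu>s) \<nu>) = ket k V P (\<nu> # \<nu>s)"
    if "P \<in> carrier V" "\<nu>s \<in> lists (carrier V)" "\<nu> \<in> carrier V"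
    using conjunct2[OF T] that by simp
qed

lemma deriv_map_linear:
  assumes "cring k" and "module k V"
  shows "linear_on k (tensor k (bang k V) V) (bang k V) (deriv_map k V)"
  by (rule linear_on_linear_maps[OF deriv_map_linear_maps[OF assms]])

lemma id_map_apply: "x \<in> carrier V \<Longrightarrow> id_map V x = x"
  by (simp add: id_map_def)

lemma linear_on_id_map: "module k V \<Longrightarrow> linear_on k V V (id_map V)"
  by (rule linear_on_cong[OF linear_on_ident]) (simp_all add: id_map_apply)

section \<open>The deriving transformation\<close>

text \<open>The element written \<open>y\<close> in the theorem, common to the product rule and the
  chain rule: the coproduct on the first factor, rebracketed so that the second copy of
  \<open>bang k V\<close> stands next to \<open>V\<close>.\<close>

definition coproduct_tensor ::
  "'k ring \<Rightarrow> ('k, 'v) module \<Rightarrow> (('k, 'v) bang_elem \<times> 'v \<Rightarrow> 'k) set \<Rightarrow>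
   (('k, 'v) bang_elem \<times> (('k, 'v) bang_elem \<times> 'v \<Rightarrow> 'k) set \<Rightarrow> 'k) set" where
  "coproduct_tensor k V x = tensor_assoc k (bang k V) (bang k V) V
     (tensor_map k (bang k V) V (tensor k (bang k V) (bang k V)) V (coproduct k V) (id_map V) x)"

lemma coproduct_tensor_linear_ket:
  assumes k: "cring k" and V: "module k V"
  shows coproduct_tensor_linear: "linear_on k (tensor k (bang k V) V)
      (tensor k (bang k V) (tensor k (bang k V) V)) (coproduct_tensor k V)"
    and coproduct_tensor_ket: "P \<in> carrier V \<Longrightarrow> xs \<in> lists (carrier V) \<Longrightarrow> \<nu> \<in> carrier V \<Longrightarrow>
      coproduct_tensor k V (pure_tensor k (bang k V) V (ket k V P xs) \<nu>) =
      split_sum (tensor k (bang k V) (tensor k (bang k V) V))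
        (\<lambda>a b. pure_tensor k (bang k V) (tensor k (bang k V) V) (ket k V P a)
          (pure_tensor k (bang k V) V (ket k V P b) \<nu>)) xs"
proof -
  let ?B = "bang k V" let ?BB = "tensor k ?B ?B" let ?BV = "tensor k ?B V"
  note B = module_bang[OF k V]
  note BB = module_tensor[OF k B B] and id = linear_on_id_map[OF V] and cp = coproduct_linear[OF k V]
  note tm = tensor_map_linear[OF k B V BB V cp id] and as = tensor_assoc_linear[OF k B B V]
  show "linear_on k ?BV (tensor k ?B ?BV) (coproduct_tensor k V)"
    unfolding coproduct_tensor_def by (rule linear_on_comp[OF tm as])
  assume P: "P \<in> carrier V" and xs: "xs \<in> lists (carrier V)" and \<nu>: "\<nu> \<in> carrier V"
  note K = ket_closed[OF k V P]
  have "tensor_map k ?B V ?BB V (coproduct k V) (id_map V) (pure_tensor k ?B V (ket k V P xs) \<nu>) =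
    pure_tensor k ?BB V (split_sum ?BB (\<lambda>a b. pure_tensor k ?B ?B (ket k V P a) (ket k V P b)) xs) \<nu>"
    by (simp add: tensor_map_pure[OF k B V BB V cp id] K[OF xs] \<nu> coproduct_ket[OF k V P xs] id_map_apply)
  then have "coproduct_tensor k V (pure_tensor k ?B V (ket k V P xs) \<nu>) =
    tensor_assoc k ?B ?B V (pure_tensor k ?BB V (split_sum ?BB (\<lambda>a b. pure_tensor k ?B ?B (ket k V P a) (ket k V P b)) xs) \<nu>)"
    unfolding coproduct_tensor_def by simp
  also have "\<dots> = split_sum (tensor k ?B ?BV)
     (\<lambda>a b. tensor_assoc k ?B ?B V (pure_tensor k ?BB V (pure_tensor k ?B ?B (ket k V P a) (ket k V P b)) \<nu>)) xs"
    \<comment> \<open>Tensoring with \<nu> and then rebracketing is linear in the remaining factor,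
      so it passes inside the sum.\<close>
    by (rule split_sum_hom[OF BB linear_on_comp[OF pure_tensor_linear1[OF k BB V \<nu>] as] xs])
      (rule pure_tensor_closed[OF k B B K K])
  also have "\<dots> = split_sum (tensor k ?B ?BV)
     (\<lambda>a b. pure_tensor k ?B ?BV (ket k V P a) (pure_tensor k ?B V (ket k V P b) \<nu>)) xs"
    by (rule split_sum_cong[OF xs]) (rule tensor_assoc_pure[OF k B B V K K \<nu>])
  finally show "coproduct_tensor k V (pure_tensor k ?B V (ket k V P xs) \<nu>) = \<dots>" .
qed

lemma deriv_map_natural:
  assumes k: "cring k" and V: "module k V" and W: "module k W" and \<phi>: "linear_on k V W \<phi>"
    and x: "x \<in> carrier (tensor k (bang k V) V)"
  shows "deriv_map k W (tensor_map k (bang k V) V (bang k W) W (bang_map k V W \<phi>) \<phi> x) =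
    bang_map k V W \<phi> (deriv_map k V x)"
proof (rule tensor_bang_ext[OF k V V module_bang[OF k W] _ _ _ x])
  note BV = module_bang[OF k V] and BW = module_bang[OF k W]
  note bm = bang_map_linear[OF k V W \<phi>]
  show "linear_on k (tensor k (bang k V) V) (bang k W)
      (\<lambda>x. deriv_map k W (tensor_map k (bang k V) V (bang k W) W (bang_map k V W \<phi>) \<phi> x))"
    by (rule linear_on_comp[OF tensor_map_linear[OF k BV V BW W bm \<phi>] deriv_map_linear[OF k W]])
  show "linear_on k (tensor k (bang k V) V) (bang k W) (\<lambda>x. bang_map k V W \<phi> (deriv_map k V x))"
    by (rule linear_on_comp[OF deriv_map_linear[OF k V] bm])
  fix P xs \<nu> assume P: "P \<in> carrier V" and xs: "xs \<in> lists (carrier V)" and \<nu>: "\<nu> \<in> carrier V"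
  have "map \<phi> xs \<in> lists (carrier W)"
    using xs by (induction xs rule: list.induct) (simp_all add: linear_onD(1)[OF \<phi>])
  then show "deriv_map k W (tensor_map k (bang k V) V (bang k W) W (bang_map k V W \<phi>) \<phi>
      (pure_tensor k (bang k V) V (ket k V P xs) \<nu>)) =
    bang_map k V W \<phi> (deriv_map k V (pure_tensor k (bang k V) V (ket k V P xs) \<nu>))"
    by (simp add: tensor_map_pure[OF k BV V BW W bm \<phi>] ket_closed[OF k V] deriv_map_ket[OF k]
        bang_map_ket[OF k V W \<phi>] linear_onD(1)[OF \<phi>] V W P xs \<nu>)
qed

lemma counit_deriv_map:
  assumes k: "cring k" and V: "module k V" and x: "x \<in> carrier (tensor k (bang k V) V)"
  shows "counit k V (deriv_map k V x) = \<zero>\<^bsub>k\<^esub>"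
proof -
  note S = module_scalars[OF k]
  have "counit k V (deriv_map k V x) = \<zero>\<^bsub>scalars k\<^esub>"
    by (rule tensor_bang_ext[OF k V V S linear_on_comp[OF deriv_map_linear[OF k V] counit_linear[OF k V]]
          linear_on_const_zero[OF S] _ x])
      (simp add: deriv_map_ket[OF k V] counit_ket[OF k V], simp add: scalars_def)
  then show ?thesis by (simp add: scalars_def)
qed

lemma dereliction_deriv_map:
  assumes k: "cring k" and V: "module k V" and x: "x \<in> carrier (tensor k (bang k V) V)"
  shows "dereliction k V (deriv_map k V x) =
    scalar_action k V (tensor_map k (bang k V) V (scalars k) V (counit k V) (id_map V) x)"
proof (rule tensor_bang_ext[OF k V V V _ _ _ x])
  interpret V: module k V by (rule V)
  note S = module_scalars[OF k] and B = module_bang[OF k V]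
  note cu = counit_linear[OF k V] and id = linear_on_id_map[OF V]
  show "linear_on k (tensor k (bang k V) V) V (\<lambda>x. dereliction k V (deriv_map k V x))"
    by (rule linear_on_comp[OF deriv_map_linear[OF k V] dereliction_linear[OF k V]])
  show "linear_on k (tensor k (bang k V) V) V
      (\<lambda>x. scalar_action k V (tensor_map k (bang k V) V (scalars k) V (counit k V) (id_map V) x))"
    by (rule linear_on_comp[OF tensor_map_linear[OF k B V S V cu id] scalar_action_linear[OF V]])
  fix P xs \<nu> assume P: "P \<in> carrier V" and xs: "xs \<in> lists (carrier V)" and \<nu>: "\<nu> \<in> carrier V"
  show "dereliction k V (deriv_map k V (pure_tensor k (bang k V) V (ket k V P xs) \<nu>)) =
    scalar_action k V (tensor_map k (bang k V) V (scalars k) V (counit k V) (id_map V)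
      (pure_tensor k (bang k V) V (ket k V P xs) \<nu>))"
    using P xs \<nu>
    \<comment> \<open>For the empty word both sides equal \<nu>. Otherwise the prefixed word has at
      least two letters and dereliction kills it, while on the right the counit already
      vanishes.\<close>
    by (cases xs) (simp_all add: deriv_map_ket[OF k V] dereliction_ket[OF k V] counit_ket[OF k V]
        tensor_map_pure[OF k B V S V cu id] ket_closed[OF k V] scalar_action_pure[OF V] id_map_apply)
qed

text \<open>On the word \<nu> # xs the recursion of \<open>split_sum\<close> has two summands,
  according to the factor that \<nu> joins. The map \<open>?L\<close> inserts \<nu> into the right
  factor, and \<open>?R\<close>, which first moves \<nu> next to the left factor, inserts it
  there.\<close>

lemma coproduct_deriv_map:
  assumes k: "cring k" and V: "module k V" and x: "x \<in> carrier (tensor k (bang k V) V)"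
  shows "coproduct k V (deriv_map k V x) =
    tensor_map k (bang k V) (tensor k (bang k V) V) (bang k V) (bang k V) (id_map (bang k V)) (deriv_map k V)
      (coproduct_tensor k V x)
    \<oplus>\<^bsub>tensor k (bang k V) (bang k V)\<^esub>
    tensor_map k (tensor k (bang k V) V) (bang k V) (bang k V) (bang k V) (deriv_map k V) (id_map (bang k V))
      (tensor_assoc_inv k (bang k V) V (bang k V)
        (tensor_map k (bang k V) (tensor k (bang k V) V) (bang k V) (tensor k V (bang k V))
          (id_map (bang k V)) (tensor_swap k (bang k V) V) (coproduct_tensor k V x)))"
proof -
  let ?B = "bang k V" let ?BB = "tensor k ?B ?B" let ?BV = "tensor k ?B V" let ?VB = "tensor k V ?B"
  note B = module_bang[OF k V]
  note BB = module_tensor[OF k B B] and BV = module_tensor[OF k B V] and VB = module_tensor[OF k V B]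
  note BBV = module_tensor[OF k B BV]
  note id = linear_on_id_map[OF B] and D = deriv_map_linear[OF k V] and sw = tensor_swap_linear[OF k B V]
  let ?L = "\<lambda>y. tensor_map k ?B ?BV ?B ?B (id_map ?B) (deriv_map k V) y"
  let ?R = "\<lambda>y. tensor_map k ?BV ?B ?B ?B (deriv_map k V) (id_map ?B)
      (tensor_assoc_inv k ?B V ?B
        (tensor_map k ?B ?BV ?B ?VB (id_map ?B) (tensor_swap k ?B V) y))"
  note cD = linear_on_comp[OF coproduct_tensor_linear[OF k V]]
  have L: "linear_on k (tensor k ?B ?BV) ?BB ?L"
    by (rule tensor_map_linear[OF k B BV B B id D])
  have R: "linear_on k (tensor k ?B ?BV) ?BB ?R"
    by (rule linear_on_comp[OF linear_on_comp[OF tensor_map_linear[OF k B BV B VB id sw]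
          tensor_assoc_inv_linear[OF k B V B]] tensor_map_linear[OF k BV B B B D id]])
  show ?thesis
  proof (rule tensor_bang_ext[OF k V V BB linear_on_comp[OF D coproduct_linear[OF k V]]
        linear_on_add[OF cD[OF L] cD[OF R] BB] _ x])
    fix P xs \<nu> assume P: "P \<in> carrier V" and xs: "xs \<in> lists (carrier V)" and \<nu>: "\<nu> \<in> carrier V"
    note K = ket_closed[OF k V P]
    let ?t = "\<lambda>a b. pure_tensor k ?B ?B (ket k V P a) (ket k V P b)"
    let ?s = "\<lambda>a b. pure_tensor k ?B ?BV (ket k V P a) (pure_tensor k ?B V (ket k V P b) \<nu>)"
    have s: "?s a b \<in> carrier (tensor k ?B ?BV)" if "a \<in> lists (carrier V)" "b \<in> lists (carrier V)" for a b
      by (rule pure_tensor_closed[OF k B BV K[OF that(1)] pure_tensor_closed[OF k B V K[OF that(2)] \<nu>]])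
    have cl: "split_sum ?BB (\<lambda>a b. ?t (\<nu> # a) b) xs \<in> carrier ?BB" "split_sum ?BB (\<lambda>a b. ?t a (\<nu> # b)) xs \<in> carrier ?BB"
      by (rule split_sum_closed[OF BB xs], rule pure_tensor_closed[OF k B B], simp_all add: K \<nu>)+
    have "?L (coproduct_tensor k V (pure_tensor k ?B V (ket k V P xs) \<nu>)) = split_sum ?BB (\<lambda>a b. ?L (?s a b)) xs"
      unfolding coproduct_tensor_ket[OF k V P xs \<nu>] by (rule split_sum_hom[OF BBV L xs s])
    also have "\<dots> = split_sum ?BB (\<lambda>a b. ?t a (\<nu> # b)) xs"
      by (rule split_sum_cong[OF xs])
        (simp add: tensor_map_pure[OF k B BV B B id D] K \<nu> P pure_tensor_closed[OF k B V] deriv_map_ket[OF k V] id_map_apply)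
    finally have 1: "?L (coproduct_tensor k V (pure_tensor k ?B V (ket k V P xs) \<nu>)) = \<dots>" .
    have "?R (coproduct_tensor k V (pure_tensor k ?B V (ket k V P xs) \<nu>)) = split_sum ?BB (\<lambda>a b. ?R (?s a b)) xs"
      unfolding coproduct_tensor_ket[OF k V P xs \<nu>] by (rule split_sum_hom[OF BBV R xs s])
    also have "\<dots> = split_sum ?BB (\<lambda>a b. ?t (\<nu> # a) b) xs"
      by (rule split_sum_cong[OF xs])
        (simp add: tensor_map_pure[OF k B BV B VB id sw] tensor_map_pure[OF k BV B B B D id]
          tensor_swap_pure[OF k B V] tensor_assoc_inv_pure[OF k B V B]
          K \<nu> P pure_tensor_closed[OF k B V] deriv_map_ket[OF k V] id_map_apply)
    finally have 2: "?R (coproduct_tensor k V (pure_tensor k ?B V (ket k V P xs) \<nu>)) = \<dots>" .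
    interpret BB: module k ?BB by (rule BB)
    have "coproduct k V (deriv_map k V (pure_tensor k ?B V (ket k V P xs) \<nu>)) =
      split_sum ?BB (\<lambda>a b. ?t (\<nu> # a) b) xs \<oplus>\<^bsub>?BB\<^esub> split_sum ?BB (\<lambda>a b. ?t a (\<nu> # b)) xs"
      by (simp add: deriv_map_ket[OF k V P xs \<nu>] coproduct_ket[OF k V P] xs \<nu>)
    then show "coproduct k V (deriv_map k V (pure_tensor k ?B V (ket k V P xs) \<nu>)) =
      ?L (coproduct_tensor k V (pure_tensor k ?B V (ket k V P xs) \<nu>)) \<oplus>\<^bsub>?BB\<^esub>
      ?R (coproduct_tensor k V (pure_tensor k ?B V (ket k V P xs) \<nu>))"
      \<comment> \<open>The recursion lists the summand with \<nu> on the left first, the product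
        rule lists it second.\<close>
      unfolding 1 2 by (simp only: BB.M.a_comm[OF cl])
  qed
qed

text \<open>The first factor of the coproduct carries the letters outside the block of \<nu>, and
  promotion partitions them; the second factor, with \<nu> prefixed, is that block. Differentiating
  in \<open>bang k (bang k V)\<close> prefixes it to each list of blocks, which is the recursion
  clause of \<open>part_sum\<close>.\<close>

lemma promotion_deriv_map:
  assumes k: "cring k" and V: "module k V" and x: "x \<in> carrier (tensor k (bang k V) V)"
  shows "promotion k V (deriv_map k V x) = deriv_map k (bang k V)
    (tensor_map k (bang k V) (tensor k (bang k V) V) (bang k (bang k V)) (bang k V)
      (promotion k V) (deriv_map k V) (coproduct_tensor k V x))"
proof -
  let ?B = "bang k V" let ?BB = "bang k ?B" let ?BV = "tensor k ?B V"
  note B = module_bang[OF k V]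
  note BB = module_bang[OF k B] and BV = module_tensor[OF k B V]
  note BBV = module_tensor[OF k B BV]
  note pr = promotion_linear[OF k V] and D = deriv_map_linear[OF k V] and DB = deriv_map_linear[OF k B]
  let ?R = "\<lambda>y. deriv_map k ?B (tensor_map k ?B ?BV ?BB ?B (promotion k V) (deriv_map k V) y)"
  have R: "linear_on k (tensor k ?B ?BV) ?BB ?R"
    by (rule linear_on_comp[OF tensor_map_linear[OF k B BV BB B pr D] DB])
  show ?thesis
  proof (rule tensor_bang_ext[OF k V V BB linear_on_comp[OF D pr]
        linear_on_comp[OF coproduct_tensor_linear[OF k V] R] _ x])
    fix P xs \<nu> assume P: "P \<in> carrier V" and xs: "xs \<in> lists (carrier V)" and \<nu>: "\<nu> \<in> carrier V"
    note K = ket_closed[OF k V P]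
    let ?F = "\<lambda>ls. ket k ?B (ket k V P []) (map (ket k V P) ls)"
    let ?s = "\<lambda>a b. pure_tensor k ?B ?BV (ket k V P a) (pure_tensor k ?B V (ket k V P b) \<nu>)"
    let ?n = "length xs"
    have s: "?s a b \<in> carrier (tensor k ?B ?BV)" if "a \<in> lists (carrier V)" "b \<in> lists (carrier V)" for a b
      by (rule pure_tensor_closed[OF k B BV K[OF that(1)] pure_tensor_closed[OF k B V K[OF that(2)] \<nu>]])
    have m: "map (ket k V P) ls \<in> lists (carrier ?B)" if "ls \<in> lists (lists (carrier V))" for ls
      using that by (induction ls rule: list.induct) (simp_all add: K)
    have Q: "ket k V P [] \<in> carrier ?B" by (rule K) simp
    have Rs: "?R (?s a b) = part_sum ?BB ?n (\<lambda>ls. ?F ((\<nu> # b) # ls)) a"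
      if a: "a \<in> lists (carrier V)" and b: "b \<in> lists (carrier V)" and len: "length a + length b = ?n" for a b
    proof -
      have \<nu>b: "ket k V P (\<nu> # b) \<in> carrier ?B" by (rule K) (simp add: b \<nu>)
      have "?R (?s a b) = deriv_map k ?B (pure_tensor k ?BB ?B (promotion k V (ket k V P a)) (ket k V P (\<nu> # b)))"
        by (simp add: tensor_map_pure[OF k B BV BB B pr D] K a b \<nu> P pure_tensor_closed[OF k B V] deriv_map_ket[OF k V])
      also have "promotion k V (ket k V P a) = part_sum ?BB ?n ?F a"
        \<comment> \<open>The truncation is the length of the whole word \<open>xs\<close> for every
          part \<open>a\<close>, since this is what the recursion of \<open>part_sum\<close>
          produces.\<close>
        by (rule promotion_ket[OF k V P a]) (use len in simp)
      also have "deriv_map k ?B (pure_tensor k ?BB ?B (part_sum ?BB ?n ?F a) (ket k V P (\<nu> # b))) =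
        part_sum ?BB ?n (\<lambda>ls. deriv_map k ?B (pure_tensor k ?BB ?B (?F ls) (ket k V P (\<nu> # b)))) a"
        by (rule part_sum_hom[OF BB BB linear_on_comp[OF pure_tensor_linear1[OF k BB B \<nu>b] DB] a])
          (rule ket_closed[OF k B Q m])
      also have "\<dots> = part_sum ?BB ?n (\<lambda>ls. ?F ((\<nu> # b) # ls)) a"
        by (rule part_sum_cong[OF a]) (simp add: deriv_map_ket[OF k B Q m \<nu>b])
      finally show ?thesis .
    qed
    \<comment> \<open>Prefixing \<nu> makes the word one letter longer, so the bound
      \<open>Suc ?n\<close> suffices and one unfolding returns to \<open>?n\<close>.\<close>
    have "promotion k V (deriv_map k V (pure_tensor k ?B V (ket k V P xs) \<nu>)) = part_sum ?BB (Suc ?n) ?F (\<nu> # xs)"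
      unfolding deriv_map_ket[OF k V P xs \<nu>] by (rule promotion_ket[OF k V P]) (simp_all add: xs \<nu>)
    also have "\<dots> = split_sum ?BB (\<lambda>a b. ?R (?s a b)) xs"
      unfolding part_sum.simps by (rule split_sum_cong[OF xs]) (rule Rs[symmetric])
    also have "\<dots> = ?R (coproduct_tensor k V (pure_tensor k ?B V (ket k V P xs) \<nu>))"
      unfolding coproduct_tensor_ket[OF k V P xs \<nu>] by (rule split_sum_hom[OF BBV R xs s, symmetric])
    finally show "promotion k V (deriv_map k V (pure_tensor k ?B V (ket k V P xs) \<nu>)) = \<dots>" .
  qed
qed

theorem theorem2p3:
  fixes k :: "'k ring" and V :: "('k, 'v) module"
  assumes "algebraically_closed k"
    and "\<And>n :: nat. n > 0 \<Longrightarrow> [n] \<cdot>\<^bsub>k\<^esub> \<one>\<^bsub>k\<^esub> \<noteq> \<zero>\<^bsub>k\<^esub>"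
    and "module k V"
  shows
    "deriv_map k V \<in> linear_maps k (tensor k (bang k V) V) (bang k V) \<and>
     (\<forall>P\<in>carrier V. \<forall>\<nu>s\<in>lists (carrier V). \<forall>\<nu>\<in>carrier V.
        deriv_map k V (pure_tensor k (bang k V) V (ket k V P \<nu>s) \<nu>) = ket k V P (\<nu> # \<nu>s)) \<and>
     (\<forall>(W :: ('k, 'w) module) \<phi>. module k W \<longrightarrow> \<phi> \<in> linear_maps k V W \<longrightarrow>
        (\<forall>x\<in>carrier (tensor k (bang k V) V).
           deriv_map k W (tensor_map k (bang k V) V (bang k W) W (bang_map k V W \<phi>) \<phi> x) =
           bang_map k V W \<phi> (deriv_map k V x))) \<and>
     (\<forall>x\<in>carrier (tensor k (bang k V) V). counit k V (deriv_map k V x) = \<zero>\<^bsub>k\<^esub>) \<and>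
     (\<forall>x\<in>carrier (tensor k (bang k V) V).
        let B = bang k V;
            y = tensor_assoc k B B V
                  (tensor_map k B V (tensor k B B) V (coproduct k V) (id_map V) x)
        in coproduct k V (deriv_map k V x) =
           tensor_map k B (tensor k B V) B B (id_map B) (deriv_map k V) y
           \<oplus>\<^bsub>tensor k B B\<^esub>
           tensor_map k (tensor k B V) B B B (deriv_map k V) (id_map B)
             (tensor_assoc_inv k B V B
               (tensor_map k B (tensor k B V) B (tensor k V B) (id_map B) (tensor_swap k B V) y))) \<and>
     (\<forall>x\<in>carrier (tensor k (bang k V) V).
        dereliction k V (deriv_map k V x) =
        scalar_action k V
          (tensor_map k (bang k V) V (scalars k) V (counit k V) (id_map V) x)) \<and>
     (\<forall>x\<in>carrier (tensor k (bang k V) V).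
        let B = bang k V
        in promotion k V (deriv_map k V x) =
           deriv_map k B
             (tensor_map k B (tensor k B V) (bang k B) B (promotion k V) (deriv_map k V)
               (tensor_assoc k B B V
                 (tensor_map k B V (tensor k B B) V (coproduct k V) (id_map V) x))))"
proof -
  interpret V: module k V by fact
  note k = V.R.is_cring and V = V.module_axioms
  show ?thesis
    \<comment> \<open>Folding \<open>coproduct_tensor\<close> identifies the rebracketed coproduct
      in the product rule and in the chain rule with the form used in the lemmas.\<close>
    unfolding Let_def coproduct_tensor_def[symmetric]
    using deriv_map_linear_maps[OF k V] deriv_map_ket[OF k V] deriv_map_natural[OF k V _ linear_on_linear_maps]
      counit_deriv_map[OF k V] coproduct_deriv_map[OF k V] dereliction_deriv_map[OF k V]
      promotion_deriv_map[OF k V]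
    by (intro conjI ballI allI impI) assumption+
qed

end
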